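(* Let $(\Omega,\Sigma)$ be an uncountable standard Borel space and let $$FEAS=\{\nu\in BC\cap pNA_\infty:\ \partial^+_{\emptyset}(\nu,\Omega)=\nu(\Omega)\}.$$ Then the Burkill-Cesari integral $\partial^+_{\emptyset}$ is a value on $FEAS$, and it does not agree on $FEAS$ with the Aumann-Shapley value $\Phi$: there exists $\nu\in FEAS$ with $\partial^+_{\emptyset}(\nu,\cdot)\ne\Phi(\nu)$. In particular the value on $FEAS$ is not unique.
   Context: A game is a set function $\nu:\Sigma\to\mathbb{R}$ with $\nu(\emptyset)=0$; it is monotone if $\nu(A)\le\nu(B)$ whenever $A\subseteq B$. $NA$ is the space of (finite signed) nonatomic countably additive measures on $\Sigma$, and $NA^+$ its nonnegative elements. $BV$ is the space of games with finite variation norm $\|\nu\|=\sup\sum_i|\nu(S_i)-\nu(S_{i-1})|$, the supremum being over all finite chains $\emptyset=S_0\subset\dots\subset S_m=\Omega$ in $\Sigma$. For games write $\nu\preceq\eta$ if $\eta-\nu$ is monotone. $AC_\infty$ (Lipschitz games) is the space of $\nu\in BV$ such that $-\mu\preceq\nu\preceq\mu$ for some $\mu\in NA^+$, with norm $\|\nu\|_\infty=\inf\{\mu(\Omega):\mu\in NA^+,\ -\mu\preceq\nu\preceq\mu\}$. $pNA_\infty$ is the $\|\cdot\|_\infty$-closure in $AC_\infty$ of the linear span of the powers $\mu^r$ ($E\mapsto\mu(E)^r$, $r\in\mathbb{N}^+$) of nonatomic probability measures $\mu$; $pNA$ is the closure of the same span in the variation norm of $BV$, and $pNA_\infty\subset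 pNA$. For $E\in\Sigma$, $\Pi(E)$ is the set of finite partitions of $E$ into disjoint elements of $\Sigma$. For $\lambda\in NA^+$ and $D\in\Pi(E)$ put $\delta_\lambda(D)=\max\{\lambda(I):I\in D\}$. A game $\nu$ is $\delta_\lambda$-BC (Burkill-Cesari) integrable if for every $E\in\Sigma$ the finite limit $\partial^+_{\emptyset}(\nu,E):=\lim_{\delta_\lambda(D)\to0,\,D\in\Pi(E)}\sum_{I\in D}\nu(I)$ exists, i.e. for every $\varepsilon>0$ there is $\delta>0$ such that $|\sum_{I\in D}\nu(I)-\partial^+_{\emptyset}(\nu,E)|<\varepsilon$ for all $D\in\Pi(E)$ with $\delta_\lambda(D)<\delta$. $BC$ is the space of games that are $\delta_\lambda$-BC integrable for some $\lambda\in NA^+$; the integral is known not to depend on the choice of such $\lambda$. $\mathcal G$ is the group of automorphisms of $(\Omega,\Sigma)$ (bijections of $\Omega$ measurable in both directions); for $\vartheta\in\mathcal G$, $(\vartheta_*\nu)(E)=\nu(\vartheta(E))$. A subspace of $BV$ is symmetric if it is invariant under every $\vartheta_*$. A value on a symmetric subspace $W$ of $BV$ is a linear mapping $\varphi:W\to NA$ such that (symmetry) $\vartheta_*(\varphi(\nu))=\varphi(\vartheta_*\nu)$ for all $\vartheta\in\mathcal G$, $\nu\in W$; (positivity) $\varphi(\nu)\ge0$ for every monotone $\nu\in W$; $\varphi(\nu)=\nu$ for $\nu\in NA\cap W$; and (efficiency) $\varphi(\nu)(\Omega)=\nu(\Omega)$ for all $\nu\in W$. The Aumann-Shapley value $\Phi$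 is the unique value on $pNA$; it is continuous in the variation norm, and if $\mu=(\mu_1,\dots,\mu_n)$ is a vector of nonatomic probability measures and $f$ is a $C^1$ function with $f(0)=0$, then $\Phi(f\circ\mu)=\sum_{i=1}^n\left(\int_0^1\frac{\partial f}{\partial x_i}(t,\dots,t)\,dt\right)\mu_i$. *)

theory Defs
  imports "HOL-Analysis.Analysis"
begin

text \<open>
  A measurable space \<open>(\<Omega>, \<Sigma>)\<close> is given by a value \<open>M\<close> of type \<open>'a measure\<close>, of which only
  \<open>\<Omega> = space M\<close> and \<open>\<Sigma> = sets M\<close> are used; the measure carried by \<open>M\<close> plays no role.
\<close>

definition standard_borel :: "'a measure \<Rightarrow> bool" where
  "standard_borel M \<longleftrightarrow>
     (\<exists>T. completely_metrizable_space T \<and> second_countable T \<and> topspace T = space M \<and>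
          sets M = sigma_sets (space M) {U. openin T U})"

subsection \<open>Games\<close>

text \<open>
  Set functions on \<open>\<Sigma>\<close> are represented by total functions that vanish outside \<open>\<Sigma>\<close>, so that
  equality of HOL functions is equality of set functions on \<open>\<Sigma>\<close>.
\<close>

definition games :: "'a measure \<Rightarrow> ('a set \<Rightarrow> real) set" where
  "games M = {\<nu>. \<nu> {} = 0 \<and> (\<forall>E. E \<notin> sets M \<longrightarrow> \<nu> E = 0)}"

definition monotone_game :: "'a measure \<Rightarrow> ('a set \<Rightarrow> real) \<Rightarrow> bool" where
  "monotone_game M \<nu> \<longleftrightarrow> (\<forall>A\<in>sets M. \<forall>B\<in>sets M. A \<subseteq> B \<longrightarrow> \<nu> A \<le> \<nu> B)"

definition game_le :: "'a measure \<Rightarrow> ('a set \<Rightarrow> real) \<Rightarrow> ('a set \<Rightarrow> real) \<Rightarrow> bool" where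
  "game_le M \<nu> \<eta> \<longleftrightarrow> monotone_game M (\<lambda>E. \<eta> E - \<nu> E)"

text \<open>
  A signed measure is nonatomic if it has no atom, an atom being a set of nonzero measure
  that does not split into two measurable parts of nonzero measure.
\<close>

definition NA :: "'a measure \<Rightarrow> ('a set \<Rightarrow> real) set" where
  "NA M = {\<mu> \<in> games M.
     (\<forall>A :: nat \<Rightarrow> 'a set. range A \<subseteq> sets M \<longrightarrow> disjoint_family A \<longrightarrow>
        (\<lambda>i. \<mu> (A i)) sums \<mu> (\<Union>i. A i)) \<and>
     (\<forall>S\<in>sets M. \<mu> S \<noteq> 0 \<longrightarrow>
        (\<exists>T\<in>sets M. T \<subseteq> S \<and> \<mu> T \<noteq> 0 \<and> \<mu> (S - T) \<noteq> 0))}"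

definition NA_plus :: "'a measure \<Rightarrow> ('a set \<Rightarrow> real) set" where
  "NA_plus M = {\<mu> \<in> NA M. \<forall>E\<in>sets M. 0 \<le> \<mu> E}"

definition NA_prob :: "'a measure \<Rightarrow> ('a set \<Rightarrow> real) set" where
  "NA_prob M = {\<mu> \<in> NA_plus M. \<mu> (space M) = 1}"

subsection \<open>Bounded variation and Lipschitz games\<close>

definition variation_sums :: "'a measure \<Rightarrow> ('a set \<Rightarrow> real) \<Rightarrow> real set" where
  "variation_sums M \<nu> =
     {(\<Sum>i<m. \<bar>\<nu> (S (Suc i)) - \<nu> (S i)\<bar>) | (m :: nat) S.
        (\<forall>i\<le>m. S i \<in> sets M) \<and> S 0 = {} \<and> S m = space M \<and> (\<forall>i<m. S i \<subseteq> S (Suc i))}"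

definition BV :: "'a measure \<Rightarrow> ('a set \<Rightarrow> real) set" where
  "BV M = {\<nu> \<in> games M. bdd_above (variation_sums M \<nu>)}"

definition BV_norm :: "'a measure \<Rightarrow> ('a set \<Rightarrow> real) \<Rightarrow> real" where
  "BV_norm M \<nu> = Sup (variation_sums M \<nu>)"

definition lipschitz_bounds :: "'a measure \<Rightarrow> ('a set \<Rightarrow> real) \<Rightarrow> ('a set \<Rightarrow> real) set" where
  "lipschitz_bounds M \<nu> =
     {\<mu> \<in> NA_plus M. game_le M (\<lambda>E. - \<mu> E) \<nu> \<and> game_le M \<nu> \<mu>}"

definition AC_inf :: "'a measure \<Rightarrow> ('a set \<Rightarrow> real) set" where
  "AC_inf M = {\<nu> \<in> BV M. lipschitz_bounds M \<nu> \<noteq> {}}"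

definition AC_inf_norm :: "'a measure \<Rightarrow> ('a set \<Rightarrow> real) \<Rightarrow> real" where
  "AC_inf_norm M \<nu> = Inf {\<mu> (space M) | \<mu>. \<mu> \<in> lipschitz_bounds M \<nu>}"

text \<open>The linear span of the powers \<open>\<mu>\<^sup>r\<close>, \<open>r \<ge> 1\<close>, of nonatomic probability measures.\<close>

definition power_span :: "'a measure \<Rightarrow> ('a set \<Rightarrow> real) set" where
  "power_span M =
     {(\<lambda>E. \<Sum>i<n. c i * \<mu> i E ^ r i) | (n :: nat) (c :: nat \<Rightarrow> real) \<mu> (r :: nat \<Rightarrow> nat).
        \<forall>i<n. \<mu> i \<in> NA_prob M \<and> 1 \<le> r i}"

definition pNA :: "'a measure \<Rightarrow> ('a set \<Rightarrow> real) set" where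
  "pNA M = {\<nu> \<in> BV M. \<forall>\<epsilon>>0. \<exists>\<eta>\<in>power_span M. BV_norm M (\<lambda>E. \<nu> E - \<eta> E) < \<epsilon>}"

definition pNA_inf :: "'a measure \<Rightarrow> ('a set \<Rightarrow> real) set" where
  "pNA_inf M = {\<nu> \<in> AC_inf M. \<forall>\<epsilon>>0. \<exists>\<eta>\<in>power_span M. AC_inf_norm M (\<lambda>E. \<nu> E - \<eta> E) < \<epsilon>}"

subsection \<open>The Burkill-Cesari integral\<close>

definition fin_partitions :: "'a measure \<Rightarrow> 'a set \<Rightarrow> 'a set set set" where
  "fin_partitions M E = {D. finite D \<and> D \<subseteq> sets M \<and> disjoint D \<and> \<Union>D = E}"

text \<open>
  Inserting \<open>0\<close> does not change the maximum for nonnegative \<open>\<rho>\<close>; it only makes the mesh of the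
  empty partition of the empty set equal to \<open>0\<close>.
\<close>

definition mesh :: "('a set \<Rightarrow> real) \<Rightarrow> 'a set set \<Rightarrow> real" where
  "mesh \<rho> D = Max (insert 0 (\<rho> ` D))"

definition has_BC_limit ::
    "'a measure \<Rightarrow> ('a set \<Rightarrow> real) \<Rightarrow> ('a set \<Rightarrow> real) \<Rightarrow> 'a set \<Rightarrow> real \<Rightarrow> bool" where
  "has_BC_limit M \<rho> \<nu> E L \<longleftrightarrow>
     (\<forall>\<epsilon>>0. \<exists>\<delta>>0. \<forall>D\<in>fin_partitions M E. mesh \<rho> D < \<delta> \<longrightarrow> \<bar>(\<Sum>I\<in>D. \<nu> I) - L\<bar> < \<epsilon>)"

definition BC_integrable :: "'a measure \<Rightarrow> ('a set \<Rightarrow> real) \<Rightarrow> ('a set \<Rightarrow> real) \<Rightarrow> bool" where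
  "BC_integrable M \<rho> \<nu> \<longleftrightarrow> (\<forall>E\<in>sets M. \<exists>L. has_BC_limit M \<rho> \<nu> E L)"

definition BC :: "'a measure \<Rightarrow> ('a set \<Rightarrow> real) set" where
  "BC M = {\<nu> \<in> games M. \<exists>\<rho>\<in>NA_plus M. BC_integrable M \<rho> \<nu>}"

text \<open>The limit is the same for all admissible \<open>\<rho>\<close>, so the description below is definite on \<open>BC\<close>.\<close>

definition BC_integral :: "'a measure \<Rightarrow> ('a set \<Rightarrow> real) \<Rightarrow> 'a set \<Rightarrow> real" where
  "BC_integral M \<nu> E =
     (if E \<in> sets M
      then THE L. \<exists>\<rho>\<in>NA_plus M. BC_integrable M \<rho> \<nu> \<and> has_BC_limit M \<rho> \<nu> E L
      else 0)"

definition FEAS :: "'a measure \<Rightarrow> ('a set \<Rightarrow> real) set" where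
  "FEAS M = {\<nu> \<in> BC M \<inter> pNA_inf M. BC_integral M \<nu> (space M) = \<nu> (space M)}"

subsection \<open>Values\<close>

text \<open>Only the restriction of an automorphism to \<open>\<Omega>\<close> matters.\<close>

definition automorphisms :: "'a measure \<Rightarrow> ('a \<Rightarrow> 'a) set" where
  "automorphisms M =
     {\<theta>. bij_betw \<theta> (space M) (space M) \<and> \<theta> \<in> measurable M M \<and>
         the_inv_into (space M) \<theta> \<in> measurable M M}"

definition transport ::
    "'a measure \<Rightarrow> ('a \<Rightarrow> 'a) \<Rightarrow> ('a set \<Rightarrow> real) \<Rightarrow> 'a set \<Rightarrow> real" where
  "transport M \<theta> \<nu> E = (if E \<in> sets M then \<nu> (\<theta> ` E) else 0)"

definition symmetric_subspace :: "'a measure \<Rightarrow> ('a set \<Rightarrow> real) set \<Rightarrow> bool" where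
  "symmetric_subspace M W \<longleftrightarrow>
     W \<subseteq> BV M \<and> (\<lambda>E. 0) \<in> W \<and>
     (\<forall>\<nu>\<in>W. \<forall>\<eta>\<in>W. (\<lambda>E. \<nu> E + \<eta> E) \<in> W) \<and>
     (\<forall>c. \<forall>\<nu>\<in>W. (\<lambda>E. c * \<nu> E) \<in> W) \<and>
     (\<forall>\<theta>\<in>automorphisms M. \<forall>\<nu>\<in>W. transport M \<theta> \<nu> \<in> W)"

definition is_value ::
    "'a measure \<Rightarrow> ('a set \<Rightarrow> real) set \<Rightarrow> (('a set \<Rightarrow> real) \<Rightarrow> 'a set \<Rightarrow> real) \<Rightarrow> bool" where
  "is_value M W \<phi> \<longleftrightarrow>
     symmetric_subspace M W \<and>
     (\<forall>\<nu>\<in>W. \<phi> \<nu> \<in> NA M) \<and>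
     (\<forall>\<nu>\<in>W. \<forall>\<eta>\<in>W. \<phi> (\<lambda>E. \<nu> E + \<eta> E) = (\<lambda>E. \<phi> \<nu> E + \<phi> \<eta> E)) \<and>
     (\<forall>c. \<forall>\<nu>\<in>W. \<phi> (\<lambda>E. c * \<nu> E) = (\<lambda>E. c * \<phi> \<nu> E)) \<and>
     (\<forall>\<theta>\<in>automorphisms M. \<forall>\<nu>\<in>W. transport M \<theta> (\<phi> \<nu>) = \<phi> (transport M \<theta> \<nu>)) \<and>
     (\<forall>\<nu>\<in>W. monotone_game M \<nu> \<longrightarrow> (\<forall>E\<in>sets M. 0 \<le> \<phi> \<nu> E)) \<and>
     (\<forall>\<nu>\<in>W \<inter> NA M. \<phi> \<nu> = \<nu>) \<and>
     (\<forall>\<nu>\<in>W. \<phi> \<nu> (space M) = \<nu> (space M))"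

text \<open>
  The Aumann-Shapley value is the value on \<open>pNA\<close>. It is characterised by this property up to its
  behaviour outside \<open>pNA\<close>, so it is represented by a predicate and not by a constant.
\<close>

definition is_aumann_shapley_value ::
    "'a measure \<Rightarrow> (('a set \<Rightarrow> real) \<Rightarrow> 'a set \<Rightarrow> real) \<Rightarrow> bool" where
  "is_aumann_shapley_value M \<Phi> \<longleftrightarrow> is_value M (pNA M) \<Phi>"

end

theory Submission
  imports Defs
begin

text \<open>
  The Burkill-Cesari integral sees a game only near \<open>\<emptyset>\<close>. Take nonatomic probability measures
  \<open>\<mu>\<close> and \<open>\<mu>'\<close> with \<open>\<mu> A = 1\<close> and \<open>\<mu>' A = 0\<close>. The game \<open>\<mu>\<^sup>2 - \<mu>'\<^sup>2\<close> has Burkill-Cesari integral \<open>0\<close>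
  and lies in \<open>FEAS\<close>. A value \<open>\<Phi>\<close> on a space containing the powers satisfies
  \<open>0 \<le> \<Phi> (\<mu>\<^sup>2) \<le> 2 \<mu>\<close>, because \<open>\<mu>\<^sup>2\<close> and \<open>2 \<mu> - \<mu>\<^sup>2\<close> are monotone; so \<open>\<Phi> (\<mu>\<^sup>2)\<close> is carried by \<open>A\<close> and,
  by efficiency, \<open>\<Phi> (\<mu>\<^sup>2 - \<mu>'\<^sup>2) A = 1\<close>.

  For non-uniqueness on \<open>FEAS\<close> a second value has to exist. It is obtained on all of \<open>pNA\<^sub>\<infinity>\<close> as a limit
  along chains from \<open>\<emptyset>\<close> to \<open>\<Omega>\<close> whose steps carry nearly equal shares of any prescribed finitely many
  nonatomic measures (an approximate Lyapunov theorem): a coalition \<open>E\<close> is credited with the increments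
  caused by the parts of the steps that lie in \<open>E\<close>. The chains form a filter that is invariant
  under automorphisms, which gives symmetry.
\<close>

text \<open>The claim about \<open>is_aumann_shapley_value\<close> is conditional, so non-uniqueness
  needs a value that is actually constructed. Sending \<open>\<mu> E ^ r\<close> to
  \<open>\<mu> E\<close> and extending linearly would leave open whether the result depends on how a
  game is written in the span, and whether it is positive. Sums along chains avoid both questions:
  linearity, positivity, efficiency and the identity on \<open>NA\<close> hold exactly for each
  single chain. What a single chain need not give is additivity in the coalition, because every
  coalition is joined to the same start of a step; additivity appears only in the limit, through the
  games of the span. Here the Lipschitz norm matters: a bound \<open>\<mu>\<close> of
  \<open>\<nu>\<close> bounds each sum for \<open>E\<close> by \<open>\<mu> E\<close>, uniformly in
  the chain. This carries convergence from the span to its closure, and domination makes the limit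
  countably additive and nonatomic. Exact shares would require Lyapunov's convexity theorem; nearly
  equal shares follow from densities and the intermediate value property of a single
  measure.\<close>

section \<open>Nonatomic measures\<close>

lemma NA_plusD:
  assumes "\<mu> \<in> NA_plus M"
  shows "\<mu> \<in> NA M" "\<mu> {} = 0" "E \<notin> sets M \<Longrightarrow> \<mu> E = 0" "0 \<le> \<mu> E"
proof -
  show 1: "\<mu> \<in> NA M" using assms by (simp add: NA_plus_def)
  show "\<mu> {} = 0" using 1 by (simp add: NA_def games_def)
  show 2: "\<mu> E = 0" if "E \<notin> sets M" for E using 1 that by (simp add: NA_def games_def)
  show "0 \<le> \<mu> E"
    using assms 2[of E] by (cases "E \<in> sets M") (auto simp: NA_plus_def)
qed

text \<open>This gives access to monotonicity, continuity from below and Radon-Nikodym for library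
  measures. The equation holds as one of functions on all sets, because both sides are 0 outside
  \<open>sets M\<close>.\<close>

lemma NA_plus_measureE:
  assumes "\<mu> \<in> NA_plus M"
  obtains N where "finite_measure N" "space N = space M" "sets N = sets M" "\<mu> = measure N"
proof -
  define N where "N = measure_of (space M) (sets M) (\<lambda>E. ennreal (\<mu> E))"
  have nn: "0 \<le> \<mu> E" for E using NA_plusD[OF assms] by auto
  have sp: "space N = space M" and se: "sets N = sets M"
    by (simp_all add: N_def sets.space_closed)
  have em: "emeasure N E = ennreal (\<mu> E)" if "E \<in> sets M" for E
    unfolding N_def
  proof (rule emeasure_measure_of_sigma)
    show "sigma_algebra (space M) (sets M)" by (rule sets.sigma_algebra_axioms)
    show "positive (sets M) (\<lambda>E. ennreal (\<mu> E))"
      using NA_plusD[OF assms] by (simp add: positive_def)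
    show "countably_additive (sets M) (\<lambda>E. ennreal (\<mu> E))"
    proof (rule countably_additiveI)
      fix A :: "nat \<Rightarrow> 'a set"
      assume A: "range A \<subseteq> sets M" "disjoint_family A"
      have "(\<lambda>i. \<mu> (A i)) sums \<mu> (\<Union>i. A i)"
        using NA_plusD(1)[OF assms] A by (auto simp: NA_def)
      then show "(\<Sum>i. ennreal (\<mu> (A i))) = ennreal (\<mu> (\<Union>i. A i))"
        using nn by (metis suminf_ennreal2 sums_iff)
    qed
    show "E \<in> sets M" by fact
  qed
  have "finite_measure N"
    by (rule finite_measureI) (simp add: sp em)
  moreover have "\<mu> = measure N"
  proof
    fix E show "\<mu> E = measure N E"
      using nn[of E] NA_plusD(3)[OF assms, of E]
      by (cases "E \<in> sets M") (auto simp: measure_def em emeasure_notin_sets se)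
  qed
  ultimately show ?thesis using that sp se by blast
qed

lemma NA_plus_mono:
  assumes "\<mu> \<in> NA_plus M" "A \<subseteq> B" "B \<in> sets M"
  shows "\<mu> A \<le> \<mu> B"
proof -
  obtain N where N: "finite_measure N" "sets N = sets M" "\<mu> = measure N"
    using NA_plus_measureE[OF assms(1)] by metis
  then interpret finite_measure N by simp
  show ?thesis using assms N by (simp add: finite_measure_mono)
qed

lemma NA_plus_Diff:
  assumes "\<mu> \<in> NA_plus M" "A \<subseteq> B" "A \<in> sets M" "B \<in> sets M"
  shows "\<mu> (B - A) = \<mu> B - \<mu> A"
proof -
  obtain N where N: "finite_measure N" "sets N = sets M" "\<mu> = measure N"
    using NA_plus_measureE[OF assms(1)] by metis
  then interpret finite_measure N by simp
  show ?thesis using assms N by (simp add: finite_measure_Diff)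
qed

lemma NA_Union:
  assumes "\<mu> \<in> NA M" "A \<in> sets M" "B \<in> sets M" "A \<inter> B = {}"
  shows "\<mu> (A \<union> B) = \<mu> A + \<mu> B"
proof -
  have "range (binaryset A B) \<subseteq> sets M" 
    using assms by (auto simp: range_binaryset_eq)
  moreover have "disjoint_family (binaryset A B)"
    using assms(4) by (auto simp: disjoint_family_on_def binaryset_def)
  ultimately have "(\<lambda>i. \<mu> (binaryset A B i)) sums \<mu> (\<Union>i. binaryset A B i)"
    using assms(1) by (auto simp: NA_def)
  moreover have "(\<lambda>i. \<mu> (binaryset A B i)) sums (\<mu> A + \<mu> B)"
    using assms(1) by (intro binaryset_sums) (auto simp: NA_def games_def)
  ultimately show ?thesis
    by (metis UN_binaryset_eq sums_unique2)
qed

lemma NA_sum_partition: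
  assumes "\<mu> \<in> NA M" "finite D" "D \<subseteq> sets M" "disjoint D"
  shows "(\<Sum>I\<in>D. \<mu> I) = \<mu> (\<Union>D)"
  using assms(2-)
proof (induction D rule: finite_induct)
  case empty
  then show ?case using assms(1) by (simp add: NA_def games_def)
next
  case (insert I D)
  have "I \<inter> \<Union>D = {}" using insert by (auto simp: disjoint_def)
  then have "\<mu> (I \<union> \<Union>D) = \<mu> I + \<mu> (\<Union>D)"
    using insert by (intro NA_Union[OF assms(1)]) auto
  moreover have "disjoint D" using insert by (auto simp: disjoint_def)
  ultimately show ?case using insert by simp
qed

lemma NA_sum_UN:
  assumes "\<mu> \<in> NA M" "finite J" "\<And>j. j \<in> J \<Longrightarrow> A j \<in> sets M" "disjoint_family_on A J"
  shows "(\<Sum>j\<in>J. \<mu> (A j)) = \<mu> (\<Union>j\<in>J. A j)"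
  using assms(2-)
proof (induction J rule: finite_induct)
  case empty
  then show ?case using assms(1) by (simp add: NA_def games_def)
next
  case (insert j J)
  have "A j \<inter> (\<Union>j\<in>J. A j) = {}" using insert by (auto simp: disjoint_family_on_def)
  then have "\<mu> (A j \<union> (\<Union>j\<in>J. A j)) = \<mu> (A j) + \<mu> (\<Union>j\<in>J. A j)"
    using insert by (intro NA_Union[OF assms(1)]) auto
  moreover have "disjoint_family_on A J" using insert by (auto simp: disjoint_family_on_def)
  ultimately show ?case using insert by simp
qed

text \<open>Nonatomicity splits a set of positive measure into two such sets, one of which has at
  most half the measure; the halving is iterated.\<close>

lemma NA_plus_small_subset:
  assumes \<mu>: "\<mu> \<in> NA_plus M" and S: "S \<in> sets M" "0 < \<mu> S" and "0 < e"
  obtains B where "B \<in> sets M" "B \<subseteq> S" "0 < \<mu> B" "\<mu> B < e"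
proof -
  have halve: "\<exists>B\<in>sets M. B \<subseteq> S \<and> 0 < \<mu> B \<and> \<mu> B \<le> \<mu> S / 2 ^ n" for n
  proof (induction n)
    case 0
    then show ?case using S by auto
  next
    case (Suc n)
    then obtain B where B: "B \<in> sets M" "B \<subseteq> S" "0 < \<mu> B" "\<mu> B \<le> \<mu> S / 2 ^ n" by auto
    then obtain T where T: "T \<in> sets M" "T \<subseteq> B" "\<mu> T \<noteq> 0" "\<mu> (B - T) \<noteq> 0"
      using NA_plusD(1)[OF \<mu>] by (fastforce simp: NA_def)
    have "\<mu> (B - T) = \<mu> B - \<mu> T" using NA_plus_Diff[OF \<mu>] B T by auto
    moreover have "0 < \<mu> T" "0 < \<mu> (B - T)"
      using T NA_plusD(4)[OF \<mu>] by (auto simp: less_le)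
    ultimately have "\<mu> T \<le> \<mu> B / 2 \<or> \<mu> (B - T) \<le> \<mu> B / 2" "0 < \<mu> T" "0 < \<mu> (B - T)" by auto
    moreover have "\<mu> B / 2 \<le> \<mu> S / 2 ^ Suc n" using B(4) by (simp add: field_simps)
    ultimately show ?case using B T by (meson Diff_subset order_trans sets.Diff)
  qed
  obtain n where "\<mu> S / e < 2 ^ n" using real_arch_pow[of 2 "\<mu> S / e"] by auto
  then have "\<mu> S / 2 ^ n < e" using \<open>0 < e\<close> by (simp add: field_simps)
  then show ?thesis using halve[of n] that by force
qed

text \<open>Greedy exhaustion: each step adds at least half of what can still be added without exceeding \<open>c\<close>.\<close>

theorem NA_plus_intermediate_subset:
  assumes \<mu>: "\<mu> \<in> NA_plus M" and S: "S \<in> sets M" and c: "0 \<le> c" "c \<le> \<mu> S"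
  obtains T where "T \<in> sets M" "T \<subseteq> S" "\<mu> T = c"
proof -
  define P where "P = (\<lambda>k::nat. \<lambda>T. T \<in> sets M \<and> T \<subseteq> S \<and> \<mu> T \<le> c)"
  define Q where "Q = (\<lambda>k::nat. \<lambda>T T'. T \<subseteq> T' \<and>
    (\<forall>B\<in>sets M. B \<subseteq> S - T \<longrightarrow> \<mu> T + \<mu> B \<le> c \<longrightarrow> \<mu> B \<le> 2 * (\<mu> T' - \<mu> T)))"
  have "\<exists>f. \<forall>k. P k (f k) \<and> Q k (f k) (f (Suc k))"
  proof (rule dependent_nat_choice)
    show "\<exists>T. P 0 T" using c NA_plusD(2)[OF \<mu>] by (intro exI[of _ "{}"]) (auto simp: P_def)
  next
    fix T k assume T: "P k T"
    define V where "V = \<mu> ` {B \<in> sets M. B \<subseteq> S - T \<and> \<mu> T + \<mu> B \<le> c}"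
    have bdd: "bdd_above V" by (rule bdd_aboveI[of _ "c - \<mu> T"]) (auto simp: V_def)
    have V0: "0 \<in> V" using T NA_plusD(2)[OF \<mu>] by (force simp: V_def P_def)
    have up: "v \<le> Sup V" if "v \<in> V" for v using bdd that by (rule cSup_upper[rotated])
    obtain B where B: "B \<in> sets M" "B \<subseteq> S - T" "\<mu> T + \<mu> B \<le> c" "Sup V \<le> 2 * \<mu> B"
    proof (cases "Sup V = 0")
      case True
      then show ?thesis using that[of "{}"] T NA_plusD(2)[OF \<mu>] by (auto simp: P_def)
    next
      case False
      then have "Sup V / 2 < Sup V" using up[OF V0] by auto
      then obtain v where "v \<in> V" "Sup V / 2 < v" using V0 less_cSupE[of _ V] by blast
      then show ?thesis using that by (auto simp: V_def)
    qed
    have u: "\<mu> (T \<union> B) = \<mu> T + \<mu> B"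
      using B T by (intro NA_Union[OF NA_plusD(1)[OF \<mu>]]) (auto simp: P_def)
    have "P (Suc k) (T \<union> B)" using B T u by (auto simp: P_def)
    moreover have "Q k T (T \<union> B)"
      unfolding Q_def using B(4) u up by (force simp: V_def)
    ultimately show "\<exists>T'. P (Suc k) T' \<and> Q k T T'" by blast
  qed
  then obtain f where P: "\<And>k. P k (f k)" and Q: "\<And>k. Q k (f k) (f (Suc k))" by blast
  obtain N where N: "finite_measure N" "sets N = sets M" "\<mu> = measure N"
    using NA_plus_measureE[OF \<mu>] by metis
  then interpret finite_measure N by simp
  define T where "T = (\<Union>k. f k)"
  have Ts: "T \<in> sets M" "T \<subseteq> S" using P by (auto simp: T_def P_def)
  have lim: "(\<lambda>k. \<mu> (f k)) \<longlonglongrightarrow> \<mu> T"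
    unfolding T_def N(3)
    using P Q N(2) by (intro finite_Lim_measure_incseq incseq_SucI) (auto simp: P_def Q_def)
  have le: "\<mu> T \<le> c" using P by (intro LIMSEQ_le_const2[OF lim]) (auto simp: P_def)
  moreover have "\<not> \<mu> T < c"
  proof
    assume lt: "\<mu> T < c"
    have "\<mu> (S - T) = \<mu> S - \<mu> T" using NA_plus_Diff[OF \<mu>] Ts S by auto
    then obtain B where B: "B \<in> sets M" "B \<subseteq> S - T" "0 < \<mu> B" "\<mu> B < c - \<mu> T"
      using NA_plus_small_subset[OF \<mu>, of "S - T" "c - \<mu> T"] S Ts c lt by auto
    \<comment> \<open>The set \<open>B\<close> was an admissible addition at every stage, so each
      increment is at least half of \<open>\<mu> B\<close>. The increments of a convergent sequence
      tend to 0.\<close>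
    have "\<mu> B \<le> 2 * (\<mu> (f (Suc k)) - \<mu> (f k))" for k
    proof -
      have "\<mu> (f k) \<le> \<mu> T" using Ts by (intro NA_plus_mono[OF \<mu>]) (auto simp: T_def)
      moreover have "B \<subseteq> S - f k" using B by (auto simp: T_def)
      ultimately show ?thesis using B Q[of k] by (auto simp: Q_def)
    qed
    moreover have "(\<lambda>k. 2 * (\<mu> (f (Suc k)) - \<mu> (f k))) \<longlonglongrightarrow> 2 * (\<mu> T - \<mu> T)"
      by (intro tendsto_intros lim LIMSEQ_Suc[OF lim])
    ultimately have "\<mu> B \<le> 2 * (\<mu> T - \<mu> T)"
      by (intro LIMSEQ_le_const) auto
    then show False using B by simp
  qed
  ultimately show ?thesis using that[OF Ts] by auto
qed

lemma NA_plus_equal_chain: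
  assumes \<mu>: "\<mu> \<in> NA_plus M" and A: "A \<in> sets M" and n: "0 < n"
  obtains C :: "nat \<Rightarrow> 'a set" where "\<And>j. C j \<in> sets M" "\<And>j. C j \<subseteq> C (Suc j)" "C 0 = {}" "C n = A"
    "\<And>j. C j \<subseteq> A" "\<And>j. j < n \<Longrightarrow> \<mu> (C (Suc j) - C j) = \<mu> A / n"
proof -
  \<comment> \<open>The truncation \<open>min j n\<close> keeps the chain at \<open>A\<close> beyond
    index \<open>n\<close>, so that inclusion and measurability hold for all indices. The last two
    conditions fix the ends as sets; their measure would determine them only up to null
    sets.\<close>
  define P where "P = (\<lambda>j. \<lambda>X. X \<in> sets M \<and> X \<subseteq> A \<and> \<mu> X = real (min j n) / n * \<mu> A \<and>
     (j = 0 \<longrightarrow> X = {}) \<and> (n \<le> j \<longrightarrow> X = A))"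
  have "\<exists>C. \<forall>j. P j (C j) \<and> C j \<subseteq> C (Suc j)"
  proof (rule dependent_nat_choice)
    show "\<exists>X. P 0 X" using n NA_plusD(2)[OF \<mu>] by (auto simp: P_def)
  next
    fix X j assume X: "P j X"
    show "\<exists>Y. P (Suc j) Y \<and> X \<subseteq> Y"
    proof (cases "n \<le> Suc j")
      case True
      then show ?thesis using X A n by (intro exI[of _ A]) (auto simp: P_def min_def)
    next
      case False
      have "\<mu> (A - X) = \<mu> A - \<mu> X" using NA_plus_Diff[OF \<mu>] X A by (auto simp: P_def)
      also have "\<dots> = (1 - real j / n) * \<mu> A"
        using X False by (auto simp: P_def min_def algebra_simps)
      also have "\<dots> \<ge> 1 / n * \<mu> A"
        using False n by (intro mult_right_mono NA_plusD(4)[OF \<mu>]) (auto simp: field_simps)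
      finally have "\<mu> A / n \<le> \<mu> (A - X)" by simp
      then obtain T where T: "T \<in> sets M" "T \<subseteq> A - X" "\<mu> T = \<mu> A / n"
        using NA_plus_intermediate_subset[OF \<mu>, of "A - X" "\<mu> A / n"] A X NA_plusD(4)[OF \<mu>]
        by (auto simp: P_def)
      have "\<mu> (X \<union> T) = \<mu> X + \<mu> T"
        using X T by (intro NA_Union[OF NA_plusD(1)[OF \<mu>]]) (auto simp: P_def)
      also have "\<dots> = real (min (Suc j) n) / n * \<mu> A"
        using False X T by (auto simp: P_def min_def field_simps)
      finally show ?thesis using X T False by (intro exI[of _ "X \<union> T"]) (auto simp: P_def)
    qed
  qed
  then obtain C where C: "\<And>j. P j (C j)" "\<And>j. C j \<subseteq> C (Suc j)" by blast
  show ?thesis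
  proof (rule that[of C])
    fix j assume "j < n"
    then have "\<mu> (C j) = j / n * \<mu> A" "\<mu> (C (Suc j)) = Suc j / n * \<mu> A"
      using C(1)[of j] C(1)[of "Suc j"] by (auto simp: P_def min_def)
    moreover have "\<mu> (C (Suc j) - C j) = \<mu> (C (Suc j)) - \<mu> (C j)"
      using C(1)[of j] C(1)[of "Suc j"] C(2)[of j] by (intro NA_plus_Diff[OF \<mu>]) (auto simp: P_def)
    ultimately show "\<mu> (C (Suc j) - C j) = \<mu> A / n"
      by (simp add: algebra_simps add_divide_distrib)
  qed (use C in \<open>auto simp: P_def\<close>)
qed

lemma chain_mono:
  assumes "\<And>j::nat. C j \<subseteq> C (Suc j)" "i \<le> j"
  shows "C i \<subseteq> C j"
  using assms(2) by (induction rule: dec_induct) (use assms(1) in blast)+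

lemma UN_chain_differences:
  assumes "\<And>j::nat. C j \<subseteq> C (Suc j)"
  shows "(\<Union>j<n. C (Suc j) - C j) = C n - C 0"
proof (induction n)
  case (Suc n)
  have "C 0 \<subseteq> C n" using chain_mono[of C 0 n] assms by blast
  then show ?case using Suc assms[of n] by (auto simp: lessThan_Suc)
qed simp

lemma chain_differences_partition:
  assumes "\<And>j. C j \<in> sets M" "\<And>j::nat. C j \<subseteq> C (Suc j)" "C 0 = {}"
  shows "(\<lambda>j. C (Suc j) - C j) ` {..<n} \<in> fin_partitions M (C n)"
proof -
  have "disjoint ((\<lambda>j. C (Suc j) - C j) ` {..<n})"
    using disjoint_family_Suc[of C, OF assms(2)]
    by (auto intro!: disjoint_family_on_disjoint_image simp: disjoint_family_on_def)
  then show ?thesis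
    using UN_chain_differences[of C n] assms by (auto simp: fin_partitions_def)
qed

text \<open>Burkill-Cesari limits are unique because fine partitions exist; otherwise the defining
  condition would be vacuous. The same partitions break up an alleged atom of a dominated set
  function.\<close>

lemma fine_partition_exists:
  assumes \<mu>: "\<mu> \<in> NA_plus M" and A: "A \<in> sets M" and "0 < \<delta>"
  obtains D where "D \<in> fin_partitions M A" "mesh \<mu> D < \<delta>"
proof -
  obtain n where n: "\<mu> A / \<delta> < real n" "0 < n"
    using reals_Archimedean2[of "max 0 (\<mu> A / \<delta>)"] by auto
  then have s: "\<mu> A / n < \<delta>" using \<open>0 < \<delta>\<close> by (simp add: field_simps)
  obtain C :: "nat \<Rightarrow> 'a set" where C: "\<And>j. C j \<in> sets M" "\<And>j. C j \<subseteq> C (Suc j)" "C 0 = {}" "C n = A"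
    "\<And>j. j < n \<Longrightarrow> \<mu> (C (Suc j) - C j) = \<mu> A / n"
    using NA_plus_equal_chain[OF \<mu> A n(2)] by metis
  define D where "D = (\<lambda>j. C (Suc j) - C j) ` {..<n}"
  have "D \<in> fin_partitions M A"
    using chain_differences_partition[of C M n] C unfolding D_def by simp
  moreover have "mesh \<mu> D < \<delta>"
    using C(5) s \<open>0 < \<delta>\<close> by (auto simp: mesh_def D_def)
  ultimately show ?thesis by (rule that)
qed

text \<open>There are no atoms because an atom would split into pieces too small to carry its mass.\<close>

lemma dominated_additive_in_NA:
  assumes g: "\<kappa> \<in> games M" and \<mu>: "\<mu> \<in> NA_plus M"
    and dom: "\<And>E. E \<in> sets M \<Longrightarrow> \<bar>\<kappa> E\<bar> \<le> \<mu> E"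
    and add: "\<And>A B. A \<in> sets M \<Longrightarrow> B \<in> sets M \<Longrightarrow> A \<inter> B = {} \<Longrightarrow> \<kappa> (A \<union> B) = \<kappa> A + \<kappa> B"
  shows "\<kappa> \<in> NA M"
proof -
  have l0: "\<kappa> {} = 0" using g by (simp add: games_def)
  have diff: "\<kappa> (B - A) = \<kappa> B - \<kappa> A" if "A \<in> sets M" "B \<in> sets M" "A \<subseteq> B" for A B
    using add[of A "B - A"] that by (auto simp: Un_absorb1)
  have sums: "(\<lambda>i. \<kappa> (A i)) sums \<kappa> (\<Union>i. A i)"
    if A: "range A \<subseteq> sets M" "disjoint_family A" for A :: "nat \<Rightarrow> 'a set"
  proof -
    let ?U = "\<Union>i. A i"
    have fin: "(\<Union>i<n. A i) \<in> sets M" for n using A by auto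
    have part: "(\<Sum>i<n. \<kappa> (A i)) = \<kappa> (\<Union>i<n. A i)" for n
    proof (induction n)
      case (Suc n)
      have "A i \<inter> A n = {}" if "i < n" for i
        using disjoint_family_onD[OF A(2), of i n] that by simp
      then have "(\<Union>i<n. A i) \<inter> A n = {}" by blast
      then have "\<kappa> ((\<Union>i<n. A i) \<union> A n) = \<kappa> (\<Union>i<n. A i) + \<kappa> (A n)"
        using A by (intro add) auto
      then show ?case using Suc by (simp add: lessThan_Suc Un_commute)
    qed (simp add: l0)
    have msums: "(\<lambda>i. \<mu> (A i)) sums \<mu> ?U"
      using NA_plusD(1)[OF \<mu>] A by (auto simp: NA_def)
    have mpart: "(\<Sum>i<n. \<mu> (A i)) = \<mu> (\<Union>i<n. A i)" for n
      using A by (intro NA_sum_UN[OF NA_plusD(1)[OF \<mu>]]) (auto simp: disjoint_family_on_def)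
    have "(\<lambda>n. \<mu> ?U - (\<Sum>i<n. \<mu> (A i))) \<longlonglongrightarrow> \<mu> ?U - \<mu> ?U"
      using msums unfolding sums_def by (intro tendsto_intros)
    then have z: "(\<lambda>n. \<mu> ?U - (\<Sum>i<n. \<mu> (A i))) \<longlonglongrightarrow> 0" by simp
    have "(\<lambda>n. \<kappa> ?U - (\<Sum>i<n. \<kappa> (A i))) \<longlonglongrightarrow> 0"
    \<comment> \<open>The error is \<open>\<kappa>\<close> of the tail of the union, dominated by
      \<open>\<mu>\<close> of the same tail.\<close>
    proof (rule Lim_null_comparison[OF _ z], intro always_eventually allI)
      fix n
      have "\<bar>\<kappa> (?U - (\<Union>i<n. A i))\<bar> \<le> \<mu> (?U - (\<Union>i<n. A i))" using A by (intro dom) auto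
      moreover have "\<kappa> (?U - (\<Union>i<n. A i)) = \<kappa> ?U - (\<Sum>i<n. \<kappa> (A i))"
        unfolding part using A fin by (intro diff) auto
      moreover have "\<mu> (?U - (\<Union>i<n. A i)) = \<mu> ?U - (\<Sum>i<n. \<mu> (A i))"
        unfolding mpart using A fin by (intro NA_plus_Diff[OF \<mu>]) auto
      ultimately show "norm (\<kappa> ?U - (\<Sum>i<n. \<kappa> (A i))) \<le> \<mu> ?U - (\<Sum>i<n. \<mu> (A i))" by simp
    qed
    from tendsto_diff[OF tendsto_const[of "\<kappa> ?U"] this] show ?thesis by (simp add: sums_def)
  qed
  have "\<exists>T\<in>sets M. T \<subseteq> S \<and> \<kappa> T \<noteq> 0 \<and> \<kappa> (S - T) \<noteq> 0" if S: "S \<in> sets M" "\<kappa> S \<noteq> 0" for S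
  proof (rule ccontr)
    assume no: "\<not> ?thesis"
    obtain D where D: "D \<in> fin_partitions M S" "mesh \<mu> D < \<bar>\<kappa> S\<bar>"
      using fine_partition_exists[OF \<mu> S(1), of "\<bar>\<kappa> S\<bar>"] S by auto
    have zero: "\<kappa> I = 0" if "I \<in> D" for I
    proof (rule ccontr)
      assume "\<kappa> I \<noteq> 0"
      moreover have I: "I \<in> sets M" "I \<subseteq> S" using D that by (auto simp: fin_partitions_def)
      ultimately have "\<kappa> S = \<kappa> I" using no diff[OF I(1) S(1) I(2)] by auto
      moreover have "\<mu> I \<le> mesh \<mu> D"
        using D that by (auto simp: mesh_def fin_partitions_def intro!: Max_ge)
      ultimately show False using dom[OF I(1)] D(2) by linarith
    qed
    have "\<kappa> (\<Union>D') = 0" if "finite D'" "D' \<subseteq> D" for D'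
      using that
    proof (induction D' rule: finite_induct)
      case (insert I D')
      have "I \<inter> X = {}" if "X \<in> D'" for X
        using insert D that by (intro disjointD[of D]) (auto simp: fin_partitions_def)
      then have "I \<inter> \<Union>D' = {}" by blast
      moreover have "I \<in> sets M" "D' \<subseteq> sets M" using insert D by (auto simp: fin_partitions_def)
      then have "\<Union>D' \<in> sets M" using insert by auto
      ultimately show ?case using add[of I "\<Union>D'"] \<open>I \<in> sets M\<close> insert zero by auto
    qed (simp add: l0)
    from this[of D] show False using D S by (auto simp: fin_partitions_def)
  qed
  with g sums show ?thesis by (auto simp: NA_def)
qed

section \<open>Existence of nonatomic measures\<close>

context Metric_space
begin

definition condensation_point :: "'a \<Rightarrow> bool" where
  "condensation_point x \<longleftrightarrow> x \<in> M \<and> (\<forall>r>0. uncountable (mball x r))"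

text \<open>A point of \<open>M\<close> that is not a condensation point has a countable ball, hence
  lies in a countable basic open set. A countable base has only countably many such members, so all
  these points together form a countable set.\<close>

lemma uncountable_condensation_points:
  assumes "second_countable mtopology" "uncountable U" "U \<subseteq> M"
  shows "uncountable {x \<in> U. condensation_point x}"
proof
  assume c: "countable {x \<in> U. condensation_point x}"
  obtain B where B: "countable B" 
    "\<And>U x. openin mtopology U \<Longrightarrow> x \<in> U \<Longrightarrow> \<exists>V\<in>B. x \<in> V \<and> V \<subseteq> U"
    using assms(1) unfolding second_countable_def by metis
  have "U - {x \<in> U. condensation_point x} \<subseteq> \<Union>{V \<in> B. countable V}"
  proof
    fix x assume "x \<in> U - {x \<in> U. condensation_point x}"
    then obtain r where r: "r > 0" "countable (mball x r)" "x \<in> M"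
      using assms(3) by (auto simp: condensation_point_def)
    then obtain V where "V \<in> B" "x \<in> V" "V \<subseteq> mball x r"
      using B(2)[of "mball x r" x] by auto
    then show "x \<in> \<Union>{V \<in> B. countable V}" using r(2) countable_subset by blast
  qed
  moreover have "countable (\<Union>{V \<in> B. countable V})"
  proof -
    have "countable {V \<in> B. countable V}" using B(1) by (rule countable_subset[rotated]) auto
    then have "countable (\<Union>V\<in>{V \<in> B. countable V}. V)" by (rule countable_UN) auto
    then show ?thesis by simp
  qed
  ultimately have "countable (U - {x \<in> U. condensation_point x})" by (rule countable_subset)
  with c have "countable ({x \<in> U. condensation_point x} \<union> (U - {x \<in> U. condensation_point x}))"
    by blast
  then have "countable U" by (rule countable_subset[rotated]) auto
  then show False using assms(2) by simp
qed

lemma condensation_point_split: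
  assumes "second_countable mtopology" "condensation_point x" "0 < r"
  obtains y z s where "condensation_point y" "condensation_point z" "0 < s" "s \<le> r / 2"
    "mcball y s \<subseteq> mball x r" "mcball z s \<subseteq> mball x r" "mcball y s \<inter> mcball z s = {}"
proof -
  let ?C = "{y \<in> mball x r. condensation_point y}"
  have unc: "uncountable ?C"
    using assms by (intro uncountable_condensation_points) (auto simp: condensation_point_def)
  then obtain y where y: "y \<in> ?C" by (metis countable_empty ex_in_conv)
  have "uncountable (?C - {y})" using unc by (simp add: uncountable_minus_countable)
  then obtain z where z: "z \<in> ?C" "z \<noteq> y" by (metis countable_empty ex_in_conv Diff_iff singletonI)
  have M: "x \<in> M" "y \<in> M" "z \<in> M" using y z by auto
  \<comment> \<open>The first two entries keep the closed balls inside \<open>mball x r\<close>, the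
    third keeps them apart, and \<open>r / 2\<close> makes the radii vanish along the Cantor
    scheme.\<close>
  define s where "s = Min {(r - d x y) / 2, (r - d x z) / 2, d y z / 3, r / 2}"
  have s: "s \<le> (r - d x y) / 2" "s \<le> (r - d x z) / 2" "s \<le> d y z / 3" "s \<le> r / 2"
    unfolding s_def by (rule Min_le; simp)+
  have dyz: "0 < d y z" using M z(2) by (simp add: order_less_le)
  have spos: "0 < s" using y z dyz assms(3) by (auto simp: s_def)
  have dy: "d x y < r" "d x z < r" using y z by auto
  show ?thesis
  proof (rule that[of y z s])
    show "mcball y s \<subseteq> mball x r"
    proof
      fix w assume w: "w \<in> mcball y s"
      then have "d x w \<le> d x y + d y w" using M by (intro triangle) auto
      also have "\<dots> < r" using w s(1) dy by auto
      finally show "w \<in> mball x r" using w M by auto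
    qed
    show "mcball z s \<subseteq> mball x r"
    proof
      fix w assume w: "w \<in> mcball z s"
      then have "d x w \<le> d x z + d z w" using M by (intro triangle) auto
      also have "\<dots> < r" using w s(2) dy by auto
      finally show "w \<in> mball x r" using w M by auto
    qed
    show "mcball y s \<inter> mcball z s = {}"
    proof -
      have False if w: "w \<in> mcball y s" "w \<in> mcball z s" for w
      proof -
        have "d y z \<le> d y w + d w z" using M w by (intro triangle) auto
        also have "\<dots> \<le> s + s" using w by (auto simp: commute intro!: add_mono)
        finally show False using s(3) dyz by auto
      qed
      then show ?thesis by blast
    qed
  qed (use y z s spos in auto)
qed

text \<open>The usual Cantor scheme: nested closed balls, indexed by finite binary words, around
  condensation points.\<close>

theorem Cantor_space_embedding:
  assumes complete: mcomplete and sc: "second_countable mtopology" and unc: "uncountable M"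
  obtains g :: "(nat \<Rightarrow> bool) \<Rightarrow> 'a" where "inj g" "range g \<subseteq> M"
    "\<And>U b. openin mtopology U \<Longrightarrow> g b \<in> U \<Longrightarrow> \<exists>n. \<forall>c. (\<forall>i<n. c i = b i) \<longrightarrow> g c \<in> U"
proof -
  define good where "good = (\<lambda>p::'a \<times> real. condensation_point (fst p) \<and> 0 < snd p)"
  define C where "C = (\<lambda>p::'a \<times> real. mcball (fst p) (snd p))"
  have "\<exists>q. good p \<longrightarrow> (\<forall>b. good (q b) \<and> snd (q b) \<le> snd p / 2 \<and> C (q b) \<subseteq> C p) \<and>
      C (q True) \<inter> C (q False) = {}" for p
  proof (cases "good p")
    case True
    then obtain y z s where yz: "condensation_point y" "condensation_point z" "0 < s" "s \<le> snd p / 2"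
      "mcball y s \<subseteq> mball (fst p) (snd p)" "mcball z s \<subseteq> mball (fst p) (snd p)"
      "mcball y s \<inter> mcball z s = {}"
      using condensation_point_split[OF sc, of "fst p" "snd p"] unfolding good_def by metis
    have "mball (fst p) (snd p) \<subseteq> C p" unfolding C_def by (rule mball_subset_mcball)
    then show ?thesis
      using yz by (intro exI[of _ "\<lambda>b. if b then (y, s) else (z, s)"]) (auto simp: good_def C_def)
  qed auto
  then obtain f where f: "\<And>p b. good p \<Longrightarrow> good (f p b)" 
    "\<And>p b. good p \<Longrightarrow> snd (f p b) \<le> snd p / 2"
    "\<And>p b. good p \<Longrightarrow> C (f p b) \<subseteq> C p"
    "\<And>p. good p \<Longrightarrow> C (f p True) \<inter> C (f p False) = {}"
    by metis
  obtain x where "condensation_point x"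
    using uncountable_condensation_points[OF sc unc order_refl] 
    by (metis (mono_tags, lifting) Collect_empty_eq countable_empty)
  then have p0: "good (x, 1)" by (simp add: good_def)
  \<comment> \<open>The ball \<open>node b n\<close> is the one reached by the word
    \<open>b 0\<close>, ..., \<open>b (n - 1)\<close>; the digit \<open>b n\<close> then selects one
    of its two children.\<close>
  define node where "node = (\<lambda>b::nat \<Rightarrow> bool. rec_nat (x, 1) (\<lambda>n p. f p (b n)))"
  have node_Suc: "node b (Suc n) = f (node b n) (b n)" for b n by (simp add: node_def)
  have good_node: "good (node b n)" for b n
    by (induction n) (use p0 f(1) in \<open>auto simp: node_def\<close>)
  have rad: "snd (node b n) \<le> (1 / 2) ^ n" for b n
  proof (induction n)
    case (Suc n)
    then show ?case using f(2)[OF good_node[of b n], of "b n"] by (simp add: node_Suc)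
  qed (simp add: node_def)
  have node_cong: "node c n = node b n" if "\<forall>i<n. c i = b i" for b c n
    using that by (induction n) (auto simp: node_def)
  have dec: "decseq (\<lambda>n. C (node b n))" for b
    using f(3)[OF good_node] by (intro decseq_SucI) (simp add: node_Suc)
  have "\<Inter>(range (\<lambda>n. C (node b n))) \<noteq> {}" for b
  proof -
    have "closedin mtopology (C (node b n))" for n by (simp add: C_def closedin_mcball)
    moreover have "C (node b n) \<noteq> {}" for n
      using good_node[of b n] unfolding C_def good_def condensation_point_def
      by (auto simp: mcball_eq_empty)
    moreover have "\<exists>n a. C (node b n) \<subseteq> mcball a e" if "e > 0" for e
    proof -
      obtain n where n: "(1 / 2) ^ n < e" using real_arch_pow_inv[of e "1 / 2"] \<open>e > 0\<close> by auto
      have "C (node b n) \<subseteq> mcball (fst (node b n)) e"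
        unfolding C_def using rad[of b n] n by (intro mcball_subset_concentric) auto
      then show ?thesis by blast
    qed
    moreover have "(\<forall>n. closedin mtopology (C (node b n))) \<and> (\<forall>n. C (node b n) \<noteq> {}) \<and>
        decseq (\<lambda>n. C (node b n)) \<and> (\<forall>\<epsilon>>0. \<exists>n a. C (node b n) \<subseteq> mcball a \<epsilon>) \<longrightarrow>
        \<Inter> (range (\<lambda>n. C (node b n))) \<noteq> {}"
      using complete unfolding mcomplete_nest by (rule spec)
    ultimately show ?thesis using dec[of b] by simp
  qed
  then have "\<exists>y. \<forall>n. y \<in> C (node b n)" for b by blast
  then obtain g where g: "\<And>b n. g b \<in> C (node b n)" by metis
  show ?thesis
  proof (rule that[of g])
    show "inj g"
    proof (rule injI, rule ccontr)
      fix b c assume eq: "g b = g c" and "b \<noteq> c"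
      then have "\<exists>k. b k \<noteq> c k" by auto
      then obtain n where n: "b n \<noteq> c n" and "\<forall>i<n. b i = c i"
        using exists_least_iff[of "\<lambda>k. b k \<noteq> c k"] by blast
      from this(2) have same: "node b n = node c n" by (rule node_cong)
      have "g b \<in> C (f (node c n) (b n))" "g b \<in> C (f (node c n) (c n))"
        using g[of b "Suc n"] g[of c "Suc n"] eq by (auto simp: node_Suc same)
      then show False using f(4)[OF good_node[of c n]] n by (cases "b n"; cases "c n") auto
    qed
    show "range g \<subseteq> M" using g[of _ 0] by (auto simp: C_def)
    fix U b assume U: "openin mtopology U" "g b \<in> U"
    then obtain e where e: "e > 0" "mball (g b) e \<subseteq> U" by (auto simp: openin_mtopology)
    obtain n where n: "(1 / 2) ^ n < e / 2" using real_arch_pow_inv[of "e / 2" "1 / 2"] e by auto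
    have "g c \<in> U" if "\<forall>i<n. c i = b i" for c
    proof -
      have 1: "g c \<in> C (node b n)" using g[of c n] node_cong[OF that] by simp
      have 2: "g b \<in> C (node b n)" by (rule g)
      have "d (g b) (g c) \<le> d (g b) (fst (node b n)) + d (fst (node b n)) (g c)"
        using 1 2 by (intro triangle) (auto simp: C_def)
      also have "\<dots> \<le> (1 / 2) ^ n + (1 / 2) ^ n"
        using 1 2 rad[of b n] by (intro add_mono) (auto simp: C_def commute)
      also have "\<dots> < e" using n by simp
      finally show ?thesis using e 1 2 by (auto simp: C_def)
    qed
    then show "\<exists>n. \<forall>c. (\<forall>i<n. c i = b i) \<longrightarrow> g c \<in> U" by blast
  qed
qed

end

section \<open>Lebesgue measure carried over to a standard Borel space\<close>

text \<open>Digits after the binary point, counted from 0. For a dyadic number the floor selects the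
  terminating expansion.\<close>

definition binary_digit :: "real \<Rightarrow> nat \<Rightarrow> bool" where
  "binary_digit t n = odd \<lfloor>2 ^ Suc n * t\<rfloor>"

lemma floor_double: "\<lfloor>2 * x\<rfloor> = 2 * \<lfloor>x::real\<rfloor> + (if odd \<lfloor>2 * x\<rfloor> then 1 else 0)"
proof -
  have "2 * \<lfloor>x\<rfloor> \<le> \<lfloor>2 * x\<rfloor>" "\<lfloor>2 * x\<rfloor> < 2 * \<lfloor>x\<rfloor> + 2" by linarith+
  then have "\<lfloor>2 * x\<rfloor> = 2 * \<lfloor>x\<rfloor> \<or> \<lfloor>2 * x\<rfloor> = 2 * \<lfloor>x\<rfloor> + 1" by linarith
  then show ?thesis by auto
qed

text \<open>Equal digits give equal integer parts of \<open>2 ^ n * s\<close> and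
  \<open>2 ^ n * t\<close> by \<open>floor_double\<close>, so the two points differ by at most
  \<open>1 / 2 ^ n\<close> for every \<open>n\<close>.\<close>

lemma inj_on_binary_digit: "inj_on binary_digit {0..<1}"
proof (rule inj_onI)
  fix s t :: real assume st: "s \<in> {0..<1}" "t \<in> {0..<1}" and eq: "binary_digit s = binary_digit t"
  have fl: "\<lfloor>2 ^ n * s\<rfloor> = \<lfloor>2 ^ n * t\<rfloor>" for n
  proof (induction n)
    case 0
    then show ?case using st by (simp add: floor_eq_iff floor_unique[of 0])
  next
    case (Suc n)
    have "odd \<lfloor>2 ^ Suc n * s\<rfloor> = odd \<lfloor>2 ^ Suc n * t\<rfloor>"
      using fun_cong[OF eq, of n] by (simp add: binary_digit_def)
    then show ?case
      using Suc floor_double[of "2 ^ n * s"] floor_double[of "2 ^ n * t"] by (simp add: mult.assoc)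
  qed
  have bound: "\<bar>s - t\<bar> * 2 ^ n \<le> 1" for n
  proof -
    have "\<bar>2 ^ n * s - 2 ^ n * t\<bar> \<le> 1" using fl[of n] by linarith
    then have "\<bar>2 ^ n * (s - t)\<bar> \<le> 1" by (simp add: right_diff_distrib)
    then show ?thesis by (simp add: abs_mult mult.commute)
  qed
  show "s = t"
  proof (rule ccontr)
    assume "s \<noteq> t"
    then obtain n where "1 / \<bar>s - t\<bar> < 2 ^ n" using real_arch_pow[of 2 "1 / \<bar>s - t\<bar>"] by auto
    then have "1 < \<bar>s - t\<bar> * 2 ^ n" using \<open>s \<noteq> t\<close> by (simp add: field_simps)
    then show False using bound[of n] by simp
  qed
qed

lemma binary_digit_measurable [measurable]: "(\<lambda>t. binary_digit t n) \<in> measurable borel (count_space UNIV)"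
  unfolding binary_digit_def by measurable

text \<open>An atom \<open>S\<close> decides every basic open set \<open>V\<close>: one of
  \<open>S \<inter> V\<close> and \<open>S - V\<close> is null. Once these countably many null sets
  are removed, no two remaining points can be separated, so at most one point is left, and it is
  null too.\<close>

lemma nonatomic_if_no_point_mass:
  assumes N: "finite_measure N" and sc: "second_countable T" and T: "Hausdorff_space T" "topspace T = space N"
    and open_sets: "\<And>U. openin T U \<Longrightarrow> U \<in> sets N"
    and null: "\<And>x. measure N {x} = 0"
    and S: "S \<in> sets N" "measure N S \<noteq> 0"
  obtains R where "R \<in> sets N" "R \<subseteq> S" "measure N R \<noteq> 0" "measure N (S - R) \<noteq> 0"
proof -
  interpret finite_measure N by fact
  have "\<exists>R\<in>sets N. R \<subseteq> S \<and> measure N R \<noteq> 0 \<and> measure N (S - R) \<noteq> 0"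
  proof (rule ccontr)
    assume "\<not> ?thesis"
    then have atom: "measure N R = 0 \<or> measure N (S - R) = 0" if "R \<in> sets N" "R \<subseteq> S" for R
      using that by blast
    obtain B where B: "countable B" "\<And>V. V \<in> B \<Longrightarrow> openin T V"
      "\<And>U x. openin T U \<Longrightarrow> x \<in> U \<Longrightarrow> \<exists>V\<in>B. x \<in> V \<and> V \<subseteq> U"
      using sc unfolding second_countable_def by metis
    define h where "h = (\<lambda>V. if measure N (S \<inter> V) = 0 then S \<inter> V else S - V)"
    have h: "h V \<in> sets N" "measure N (h V) = 0" if "V \<in> B" for V
    proof -
      have "V \<in> sets N" using B(2)[OF that] open_sets by auto
      then show "h V \<in> sets N" using S by (auto simp: h_def)
      have "S - S \<inter> V = S - V" by blast
      then show "measure N (h V) = 0"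
        using atom[of "S \<inter> V"] \<open>V \<in> sets N\<close> S by (auto simp: h_def)
    qed
    define Z where "Z = (\<Union>V\<in>B. h V)"
    have "Z \<in> null_sets N"
      unfolding Z_def using h B(1) by (intro null_sets_UN') (auto simp: null_sets_def emeasure_eq_measure)
    moreover have "S - Z \<in> null_sets N"
    proof (cases "S - Z = {}")
      case False
      then obtain x where x: "x \<in> S - Z" by blast
      have xT: "x \<in> topspace T" using x S T(2) sets.sets_into_space by blast
      have "y = x" if y: "y \<in> S - Z" for y
      proof (rule ccontr)
        assume "y \<noteq> x"
        have yT: "y \<in> topspace T" using y S T(2) sets.sets_into_space by blast
        obtain U W where "openin T U" "openin T W" "x \<in> U" "y \<in> W" "disjnt U W"
          using T(1) xT yT \<open>y \<noteq> x\<close> unfolding Hausdorff_space_def by metis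
        then obtain V where V: "V \<in> B" "x \<in> V" "y \<notin> V" using B(3)[of U x] by (auto simp: disjnt_iff)
        then have "x \<in> h V \<or> y \<in> h V" using x y by (auto simp: h_def)
        then show False using x y V by (auto simp: Z_def)
      qed
      then have "S - Z = {x}" using x by blast
      moreover have "S - Z \<in> sets N" using S \<open>Z \<in> null_sets N\<close> by auto
      ultimately show ?thesis using null[of x] by (simp add: null_sets_def emeasure_eq_measure)
    next
      case True
      then show ?thesis by (metis null_sets.empty_sets)
    qed
    ultimately have "S \<in> null_sets N"
      using S by (metis Diff_Un Un_Diff_cancel2 null_sets.Un null_sets_subset sup_ge1)
    then show False using S by (auto simp: null_sets_def emeasure_eq_measure)
  qed
  then show ?thesis using that by blast
qed

text \<open>The measure is the image of Lebesgue measure on the unit interval under the binary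
  expansion followed by an embedding of Cantor space. Injectivity leaves at most one preimage to
  each point, so there are no point masses.\<close>

theorem NA_prob_nonempty:
  assumes sb: "standard_borel M" and unc: "uncountable (space M)"
  obtains \<mu> where "\<mu> \<in> NA_prob M"
proof -
  obtain T where T: "completely_metrizable_space T" "second_countable T" "topspace T = space M"
    "sets M = sigma_sets (space M) {U. openin T U}"
    using sb unfolding standard_borel_def by blast
  obtain X d where X: "Metric_space X d" "Metric_space.mcomplete X d" "T = Metric_space.mtopology X d"
    using T(1) unfolding completely_metrizable_space_def by blast
  interpret Metric_space X d by fact
  have XM: "X = space M" using T(3) X(3) by simp
  obtain g :: "(nat \<Rightarrow> bool) \<Rightarrow> 'a" where g: "inj g" "range g \<subseteq> X"
    "\<And>U b. openin mtopology U \<Longrightarrow> g b \<in> U \<Longrightarrow> \<exists>n. \<forall>c. (\<forall>i<n. c i = b i) \<longrightarrow> g c \<in> U"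
    using Cantor_space_embedding X T(2) unc XM by metis
  define L where "L = restrict_space lborel {0..<1::real}"
  define h where "h = (\<lambda>t. g (binary_digit t))"
  have spL: "space L = {0..<1}" by (simp add: L_def space_restrict_space)
  have meas: "h \<in> measurable borel M"
  proof (rule measurable_sigma_sets[OF T(4)])
    show "{U. openin T U} \<subseteq> Pow (space M)" using T(3) openin_subset by fastforce
    show "h \<in> space borel \<rightarrow> space M" using g(2) XM by (auto simp: h_def)
    fix U assume "U \<in> {U. openin T U}"
    then have U: "openin mtopology U" using X(3) by simp
    \<comment> \<open>Around each of its points the preimage of an open set contains a cylinder, by
      the last property of \<open>g\<close>. Cylinders are indexed by finite words, so the union is
      countable.\<close>
    let ?cyl = "\<lambda>w. {t. \<forall>i<length w. binary_digit t i = w ! i}"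
    let ?W = "{w. ?cyl w \<subseteq> h -` U}"
    have "h -` U = (\<Union>w\<in>?W. ?cyl w)"
    proof
      show "h -` U \<subseteq> (\<Union>w\<in>?W. ?cyl w)"
      proof
        fix t assume "t \<in> h -` U"
        then obtain n where n: "\<And>c. (\<forall>i<n. c i = binary_digit t i) \<Longrightarrow> g c \<in> U"
          using g(3)[OF U, of "binary_digit t"] by (auto simp: h_def)
        let ?w = "map (binary_digit t) [0..<n]"
        have "?w \<in> ?W" using n by (auto simp: h_def)
        moreover have "t \<in> ?cyl ?w" by auto
        ultimately show "t \<in> (\<Union>w\<in>?W. ?cyl w)" by blast
      qed
    qed blast
    moreover have "(\<Union>w\<in>?W. ?cyl w) \<in> sets borel"
    proof (rule sets.countable_UN'')
      show "countable ?W" by (rule countable_subset[of _ UNIV]) auto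
      fix w
      show "?cyl w \<in> sets borel" by measurable
    qed
    ultimately show "h -` U \<inter> space borel \<in> sets borel" by simp
  qed
  then have "h \<in> measurable lborel M" by simp
  then have hL: "h \<in> measurable L M" unfolding L_def by (rule measurable_restrict_space1)
  define N where "N = distr L M h"
  have setsN: "sets N = sets M" "space N = space M" by (simp_all add: N_def)
  have emL: "emeasure L A = emeasure lborel A" if "A \<subseteq> {0..<1}" for A
    unfolding L_def using that by (subst emeasure_restrict_space) auto
  have emN: "emeasure N E = emeasure lborel (h -` E \<inter> {0..<1})" if "E \<in> sets M" for E
    using emeasure_distr[OF hL that] emL[of "h -` E \<inter> {0..<1}"] by (simp add: N_def spL)
  have "h -` space M \<inter> {0..<1} = {0..<1}" using g(2) XM by (auto simp: h_def)
  then have em1: "emeasure N (space M) = 1" using emN[of "space M"] by simp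
  then have N: "finite_measure N" by (intro finite_measureI) (simp add: setsN)
  interpret N: finite_measure N by fact
  have null: "measure N {x} = 0" for x
  proof (cases "{x} \<in> sets M")
    case True
    have "inj_on h {0..<1}"
      unfolding h_def using comp_inj_on[OF inj_on_binary_digit, of g] g(1)
      by (auto simp: comp_def intro: inj_on_subset)
    then have "s = t" if "s \<in> h -` {x} \<inter> {0..<1}" "t \<in> h -` {x} \<inter> {0..<1}" for s t
      using that by (auto dest: inj_onD)
    then have "h -` {x} \<inter> {0..<1} = {} \<or> (\<exists>t. h -` {x} \<inter> {0..<1} = {t})" by blast
    then have "countable (h -` {x} \<inter> {0..<1})" by (auto simp only: countable_empty countable_insert)
    then have "emeasure lborel (h -` {x} \<inter> {0..<1}) = 0" by (rule emeasure_lborel_countable)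
    then show ?thesis using emN[OF True] by (simp add: measure_def)
  qed (simp add: measure_notin_sets setsN)
  have "Hausdorff_space T" using X(3) Hausdorff_space_mtopology by simp
  then have split: "\<exists>R\<in>sets M. R \<subseteq> S \<and> measure N R \<noteq> 0 \<and> measure N (S - R) \<noteq> 0"
    if S: "S \<in> sets M" "measure N S \<noteq> 0" for S
  proof -
    have "U \<in> sets N" if "openin T U" for U
      using that by (simp add: setsN T(4) sigma_sets.Basic)
    moreover have "topspace T = space N" using T(3) setsN by simp
    ultimately obtain R where "R \<in> sets N" "R \<subseteq> S" "measure N R \<noteq> 0" "measure N (S - R) \<noteq> 0"
      using nonatomic_if_no_point_mass[OF N T(2) \<open>Hausdorff_space T\<close>, of S] null S setsN(1) by metis
    then show ?thesis using setsN by auto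
  qed
  have "measure N \<in> NA M"
    unfolding NA_def games_def
    using split by (auto simp: setsN measure_notin_sets intro!: N.finite_measure_UNION)
  moreover have "measure N (space M) = 1" using em1 by (simp add: measure_def)
  ultimately show ?thesis using that[of "measure N"] by (simp add: NA_prob_def NA_plus_def)
qed

section \<open>Nearly uniform chains\<close>

lemma NA_plus_zero: "(\<lambda>E. 0) \<in> NA_plus M"
  by (auto simp: NA_plus_def NA_def games_def)

text \<open>Nonnegativity excludes cancellation: a set that splits for one summand splits for the
  sum.\<close>

lemma NA_plus_add:
  assumes "\<mu> \<in> NA_plus M" "\<nu> \<in> NA_plus M"
  shows "(\<lambda>E. \<mu> E + \<nu> E) \<in> NA_plus M"
proof -
  have "\<exists>T\<in>sets M. T \<subseteq> S \<and> \<mu> T + \<nu> T \<noteq> 0 \<and> \<mu> (S - T) + \<nu> (S - T) \<noteq> 0"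
    if S: "S \<in> sets M" "\<mu> S + \<nu> S \<noteq> 0" for S
  proof -
    have nz: "\<mu> T + \<nu> T \<noteq> 0" if "\<mu> T \<noteq> 0 \<or> \<nu> T \<noteq> 0" for T
      using that NA_plusD(4)[OF assms(1), of T] NA_plusD(4)[OF assms(2), of T] by linarith
    have "\<mu> S \<noteq> 0 \<or> \<nu> S \<noteq> 0" using S by auto
    then obtain T where "T \<in> sets M" "T \<subseteq> S"
      "\<mu> T \<noteq> 0 \<and> \<mu> (S - T) \<noteq> 0 \<or> \<nu> T \<noteq> 0 \<and> \<nu> (S - T) \<noteq> 0"
      using assms S(1) by (auto simp: NA_plus_def NA_def)
    then show ?thesis using nz by blast
  qed
  then show ?thesis
    using assms by (auto simp: NA_plus_def NA_def games_def intro: sums_add)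
qed

lemma NA_plus_scale:
  assumes "\<mu> \<in> NA_plus M" "0 \<le> c"
  shows "(\<lambda>E. c * \<mu> E) \<in> NA_plus M"
  using assms by (cases "c = 0") (auto simp: NA_plus_def NA_def games_def intro: sums_mult)

lemma NA_plus_sum:
  assumes "finite F" "\<And>i. i \<in> F \<Longrightarrow> \<mu> i \<in> NA_plus M"
  shows "(\<lambda>E. \<Sum>i\<in>F. \<mu> i E) \<in> NA_plus M"
  using assms by (induction F rule: finite_induct) (auto intro: NA_plus_zero NA_plus_add)

lemma NA_plus_restrict:
  assumes \<mu>: "\<mu> \<in> NA_plus M" and A: "A \<in> sets M"
  shows "(\<lambda>E. if E \<in> sets M then \<mu> (E \<inter> A) else 0) \<in> NA_plus M"
proof -
  let ?\<kappa> = "\<lambda>E. if E \<in> sets M then \<mu> (E \<inter> A) else 0"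
  have "?\<kappa> \<in> NA M"
  proof (rule dominated_additive_in_NA[OF _ \<mu>])
    show "?\<kappa> \<in> games M" using NA_plusD(2)[OF \<mu>] by (simp add: games_def)
    show "\<bar>?\<kappa> E\<bar> \<le> \<mu> E" if "E \<in> sets M" for E
      using that NA_plusD(4)[OF \<mu>] NA_plus_mono[OF \<mu>, of "E \<inter> A" E] by auto
    fix B C assume "B \<in> sets M" "C \<in> sets M" "B \<inter> C = {}"
    then show "?\<kappa> (B \<union> C) = ?\<kappa> B + ?\<kappa> C"
      using A NA_Union[OF NA_plusD(1)[OF \<mu>], of "B \<inter> A" "C \<inter> A"] by (auto simp: Int_Un_distrib2)
  qed
  then show ?thesis using NA_plusD(4)[OF \<mu>] by (auto simp: NA_plus_def)
qed

lemma fin_partitionsD: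
  assumes "D \<in> fin_partitions M E"
  shows "finite D" "D \<subseteq> sets M" "disjoint D" "\<Union>D = E"
  using assms by (auto simp: fin_partitions_def)

text \<open>Radon-Nikodym: cut \<open>\<Omega>\<close> along the level sets of the density of \<open>\<mu>\<close> with respect to \<open>\<rho>\<close>.\<close>

lemma nearly_proportional_partition:
  assumes \<rho>: "\<rho> \<in> NA_plus M" and \<mu>: "\<mu> \<in> NA_plus M"
    and dom: "\<And>E. E \<in> sets M \<Longrightarrow> \<mu> E \<le> \<rho> E" and "0 < \<epsilon>"
  obtains D where "D \<in> fin_partitions M (space M)"
    "\<And>A. A \<in> D \<Longrightarrow> \<exists>c. \<forall>B\<in>sets M. B \<subseteq> A \<longrightarrow> \<bar>\<mu> B - c * \<rho> B\<bar> \<le> \<epsilon> * \<rho> B"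
proof -
  obtain R where R: "finite_measure R" "space R = space M" "sets R = sets M" "\<rho> = measure R"
    using NA_plus_measureE[OF \<rho>] by metis
  obtain N where N: "finite_measure N" "space N = space M" "sets N = sets M" "\<mu> = measure N"
    using NA_plus_measureE[OF \<mu>] by metis
  interpret R: finite_measure R by fact
  interpret N: finite_measure N by fact
  have "absolutely_continuous R N"
  proof (unfold absolutely_continuous_def, rule subsetI)
    fix Z assume "Z \<in> null_sets R"
    then have "Z \<in> sets M" "\<rho> Z = 0" by (auto simp: R null_sets_def measure_def)
    then have "\<mu> Z = 0" using dom[of Z] NA_plusD(4)[OF \<mu>, of Z] by simp
    then show "Z \<in> null_sets N"
      using \<open>Z \<in> sets M\<close> by (simp add: N null_sets_def N.emeasure_eq_measure)
  qed
  then obtain f where f: "f \<in> borel_measurable R" "density R f = N"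
    using R.Radon_Nikodym[of N] R N by auto
  have emN: "emeasure N B = (\<integral>\<^sup>+x. f x * indicator B x \<partial>R)" if "B \<in> sets M" for B
    using emeasure_density[OF f(1), of B] f(2) R(3) that by simp
  obtain m :: nat where m: "0 < m" "1 / m < \<epsilon>"
    using nat_approx_posE[OF \<open>0 < \<epsilon>\<close>] by (metis zero_less_Suc)
  \<comment> \<open>The slices below level 1 have width \<open>1 / m\<close>, which is less than
    \<open>\<epsilon>\<close>. The last slice collects all points with density at least 1; there the
    upper bound comes from \<open>dom\<close>, which is the case \<open>q = m\<close> below.\<close>
  define C where "C = (\<lambda>j. if j \<le> m then {x \<in> space R. f x < ennreal (j / m)} else space M)"
  have Cs: "C j \<in> sets M" for j
  proof -
    have "{x \<in> space R. f x < ennreal (j / m)} \<in> sets R" using f(1) by measurable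
    then show ?thesis by (simp add: C_def R(3))
  qed
  have Cm: "C j \<subseteq> C (Suc j)" for j
  proof -
    have "ennreal (j / m) \<le> ennreal (Suc j / m)" by (intro ennreal_leI divide_right_mono) auto
    then have "f x < ennreal (Suc j / m)" if "f x < ennreal (j / m)" for x
      using that by (rule order_less_le_trans[rotated])
    then show ?thesis by (auto simp: C_def R(2) simp del: of_nat_Suc)
  qed
  have C0: "C 0 = {}" by (simp add: C_def)
  let ?D = "(\<lambda>j. C (Suc j) - C j) ` {..<Suc m}"
  show ?thesis
  proof (rule that[of ?D])
    show "?D \<in> fin_partitions M (space M)"
      using chain_differences_partition[of C M "Suc m", OF Cs Cm C0] by (simp add: C_def)
    fix A assume "A \<in> ?D"
    then obtain q where "q < Suc m" and qA: "A = C (Suc q) - C q" by blast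
    then have q: "q \<le> m" "A = C (Suc q) - C q" by simp_all
    have "\<bar>\<mu> B - q / m * \<rho> B\<bar> \<le> \<epsilon> * \<rho> B" if B: "B \<in> sets M" "B \<subseteq> A" for B
    proof -
      have lower_f: "ennreal (q / m) * indicator B x \<le> f x * indicator B x" if "x \<in> space R" for x
        using that q B(2) by (auto simp: C_def R(2) split: split_indicator)
      have int_const: "ennreal (c * \<rho> B) = (\<integral>\<^sup>+x. ennreal c * indicator B x \<partial>R)" if "0 \<le> c" for c
        using B(1) R(3,4) that by (simp add: nn_integral_cmult_indicator R.emeasure_eq_measure ennreal_mult)
      have "ennreal (q / m * \<rho> B) = (\<integral>\<^sup>+x. ennreal (q / m) * indicator B x \<partial>R)"
        by (rule int_const) simp
      also have "\<dots> \<le> ennreal (\<mu> B)"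
        using emN[OF B(1)] lower_f N(4)
        by (auto simp: N.emeasure_eq_measure intro!: nn_integral_mono)
      finally have lower: "q / m * \<rho> B \<le> \<mu> B"
        using NA_plusD(4)[OF \<mu>] by (simp add: ennreal_le_iff)
      have "\<mu> B \<le> (q / m + 1 / m) * \<rho> B"
      proof (cases "q = m")
        case True
        have "1 * \<rho> B \<le> (q / m + 1 / m) * \<rho> B"
          using True m NA_plusD(4)[OF \<rho>] by (intro mult_right_mono) auto
        then show ?thesis using dom[OF B(1)] by simp
      next
        case False
        then have upper_f: "f x * indicator B x \<le> ennreal (Suc q / m) * indicator B x"
          if "x \<in> space R" for x
          using that q B(2) by (auto simp: C_def R(2) split: split_indicator)
        have "ennreal (\<mu> B) \<le> (\<integral>\<^sup>+x. ennreal (Suc q / m) * indicator B x \<partial>R)"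
          using emN[OF B(1)] upper_f N(4)
          by (auto simp: N.emeasure_eq_measure intro!: nn_integral_mono)
        also have "\<dots> = ennreal (Suc q / m * \<rho> B)"
          by (rule int_const[symmetric]) simp
        finally show ?thesis
          using NA_plusD(4)[OF \<rho>] by (simp add: ennreal_le_iff add_divide_distrib add.commute)
      qed
      moreover have "1 / m * \<rho> B \<le> \<epsilon> * \<rho> B"
        using m NA_plusD(4)[OF \<rho>] by (intro mult_right_mono) auto
      ultimately show ?thesis using lower by (auto simp: algebra_simps)
    qed
    then show "\<exists>c. \<forall>B\<in>sets M. B \<subseteq> A \<longrightarrow> \<bar>\<mu> B - c * \<rho> B\<bar> \<le> \<epsilon> * \<rho> B" by blast
  qed
qed

text \<open>Near proportionality on a piece is a statement about all its measurable subsets, so it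
  survives refinement, and the common refinement of two partitions serves the measures of
  both.\<close>

lemma nearly_proportional_partition_family:
  assumes \<rho>: "\<rho> \<in> NA_plus M" and "finite F" "F \<subseteq> NA_plus M"
    and "\<And>\<mu> E. \<mu> \<in> F \<Longrightarrow> E \<in> sets M \<Longrightarrow> \<mu> E \<le> \<rho> E" and \<epsilon>: "0 < \<epsilon>"
  shows "\<exists>D\<in>fin_partitions M (space M). \<forall>A\<in>D. \<forall>\<mu>\<in>F. \<exists>c. \<forall>B\<in>sets M. B \<subseteq> A \<longrightarrow>
    \<bar>\<mu> B - c * \<rho> B\<bar> \<le> \<epsilon> * \<rho> B"
  using assms(2-4)
proof (induction F rule: finite_induct)
  case empty
  have "{space M} \<in> fin_partitions M (space M)" by (auto simp: fin_partitions_def)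
  then show ?case by blast
next
  case (insert \<mu> F)
  then obtain D where D: "D \<in> fin_partitions M (space M)"
    "\<And>A \<mu>. A \<in> D \<Longrightarrow> \<mu> \<in> F \<Longrightarrow> \<exists>c. \<forall>B\<in>sets M. B \<subseteq> A \<longrightarrow> \<bar>\<mu> B - c * \<rho> B\<bar> \<le> \<epsilon> * \<rho> B"
    by auto
  have "\<mu> \<in> NA_plus M" "\<And>E. E \<in> sets M \<Longrightarrow> \<mu> E \<le> \<rho> E" using insert.prems by auto
  then obtain D' where D': "D' \<in> fin_partitions M (space M)"
    "\<And>A. A \<in> D' \<Longrightarrow> \<exists>c. \<forall>B\<in>sets M. B \<subseteq> A \<longrightarrow> \<bar>\<mu> B - c * \<rho> B\<bar> \<le> \<epsilon> * \<rho> B"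
    using nearly_proportional_partition[OF \<rho> _ _ \<epsilon>] by metis
  let ?D = "(\<lambda>(A, B). A \<inter> B) ` (D \<times> D')"
  note d = fin_partitionsD[OF D(1)] and d' = fin_partitionsD[OF D'(1)]
  have "disjoint ?D"
  proof (rule disjointI)
    fix X Y assume "X \<in> ?D" "Y \<in> ?D" "X \<noteq> Y"
    then obtain A A' B B' where X: "A \<in> D" "A' \<in> D'" "X = A \<inter> A'" "B \<in> D" "B' \<in> D'" "Y = B \<inter> B'"
      by auto
    then have "A \<noteq> B \<or> A' \<noteq> B'" using \<open>X \<noteq> Y\<close> by auto
    then have "A \<inter> B = {} \<or> A' \<inter> B' = {}" using X d(3) d'(3) by (meson disjointD)
    then show "X \<inter> Y = {}" using X by blast
  qed
  moreover have "\<Union>?D = space M"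
  proof -
    have "\<Union>?D = \<Union>D \<inter> \<Union>D'" by auto
    then show ?thesis using d d' by simp
  qed
  moreover have "finite ?D" "?D \<subseteq> sets M" using d d' by auto
  ultimately have refinement: "?D \<in> fin_partitions M (space M)" by (simp add: fin_partitions_def)
  have ratio: "\<exists>c. \<forall>B\<in>sets M. B \<subseteq> X \<longrightarrow> \<bar>\<eta> B - c * \<rho> B\<bar> \<le> \<epsilon> * \<rho> B"
    if X: "X \<in> ?D" "\<eta> \<in> insert \<mu> F" for X \<eta>
  proof -
    obtain A A' where A: "A \<in> D" "A' \<in> D'" "X = A \<inter> A'" using X by auto
    have "X \<subseteq> A" "X \<subseteq> A'" using A by auto
    moreover have "\<exists>Y\<in>{A, A'}. \<exists>c. \<forall>B\<in>sets M. B \<subseteq> Y \<longrightarrow> \<bar>\<eta> B - c * \<rho> B\<bar> \<le> \<epsilon> * \<rho> B"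
      using D(2)[OF A(1)] D'(2)[OF A(2)] X(2) by auto
    ultimately show ?thesis by (metis insertE singletonD subset_trans)
  qed
  show ?case by (intro bexI[of _ ?D] ballI ratio refinement)
qed

text \<open>Chains of \<open>n\<close> steps from \<open>\<emptyset>\<close> to \<open>\<Omega>\<close> each of which carries, up to \<open>\<delta> / n\<close>, the share
  \<open>1 / n\<close> of every measure in \<open>F\<close>; the first condition says \<open>1 / n \<le> \<delta>\<close>.\<close>

definition uniform_chains ::
    "'a measure \<Rightarrow> ('a set \<Rightarrow> real) set \<Rightarrow> real \<Rightarrow> (nat \<times> (nat \<Rightarrow> 'a set)) set" where
  "uniform_chains M F \<delta> = {(n, T). 1 \<le> real n * \<delta> \<and>
     (\<forall>j. T j \<in> sets M) \<and> (\<forall>j. T j \<subseteq> T (Suc j)) \<and> T 0 = {} \<and> T n = space M \<and>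
     (\<forall>\<mu>\<in>F. \<forall>j<n. \<bar>real n * \<mu> (T (Suc j) - T j) - \<mu> (space M)\<bar> \<le> \<delta>)}"

lemma uniform_chains_mono:
  assumes "F \<subseteq> G" "\<delta> \<le> \<delta>'"
  shows "uniform_chains M G \<delta> \<subseteq> uniform_chains M F \<delta>'"
proof -
  have "real n * \<delta> \<le> real n * \<delta>'" for n using assms(2) by (intro mult_left_mono) auto
  then have n: "1 \<le> real n * \<delta>'" if "1 \<le> real n * \<delta>" for n
    using that order_trans by blast
  have "x \<le> \<delta>'" if "x \<le> \<delta>" for x using that assms(2) by simp
  then show ?thesis
    using assms(1) n unfolding uniform_chains_def by blast
qed

text \<open>On a piece where every measure of \<open>F\<close> is nearly a multiple of
  \<open>\<rho>\<close>, steps of equal \<open>\<rho>\<close>-measure carry nearly equal shares of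
  all of them. The chains of the pieces are then united stage by stage.\<close>

lemma uniform_chains_nonempty:
  assumes F: "finite F" "F \<subseteq> NA_plus M" and \<delta>: "0 < \<delta>"
  shows "uniform_chains M F \<delta> \<noteq> {}"
proof -
  define \<rho> where "\<rho> = (\<lambda>E. \<Sum>\<mu>\<in>F. \<mu> E)"
  have \<rho>: "\<rho> \<in> NA_plus M" unfolding \<rho>_def using F by (intro NA_plus_sum) auto
  have dom: "\<mu> E \<le> \<rho> E" if "\<mu> \<in> F" "E \<in> sets M" for \<mu> E
    unfolding \<rho>_def using that F by (intro member_le_sum) (auto intro: NA_plusD(4))
  \<comment> \<open>Each piece \<open>A\<close> contributes the error
    \<open>\<epsilon> * \<rho> A\<close> twice, once for the step and once for the whole piece. The
    summand 1 keeps the denominator positive.\<close>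
  define \<epsilon> where "\<epsilon> = \<delta> / (2 * (\<rho> (space M) + 1))"
  have \<rho>1: "0 < \<rho> (space M) + 1" using NA_plusD(4)[OF \<rho>, of "space M"] by simp
  have \<epsilon>: "0 < \<epsilon>" "2 * \<epsilon> * \<rho> (space M) \<le> \<delta>"
    using \<delta> \<rho>1 by (auto simp: \<epsilon>_def field_simps)
  obtain n :: nat where n: "0 < n" "1 / \<delta> < n"
    using reals_Archimedean2[of "max 0 (1 / \<delta>)"] by auto
  have n\<delta>: "1 \<le> real n * \<delta>" using n \<delta> by (simp add: field_simps)
  have "\<exists>D\<in>fin_partitions M (space M). \<forall>A\<in>D. \<forall>\<mu>\<in>F. \<exists>c. \<forall>B\<in>sets M. B \<subseteq> A \<longrightarrow>
    \<bar>\<mu> B - c * \<rho> B\<bar> \<le> \<epsilon> * \<rho> B"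
    by (rule nearly_proportional_partition_family[OF \<rho> F _ \<epsilon>(1)]) (rule dom)
  then obtain D where D: "D \<in> fin_partitions M (space M)"
    "\<forall>A\<in>D. \<forall>\<mu>\<in>F. \<exists>c. \<forall>B\<in>sets M. B \<subseteq> A \<longrightarrow> \<bar>\<mu> B - c * \<rho> B\<bar> \<le> \<epsilon> * \<rho> B"
    by (elim bexE)
  note d = fin_partitionsD[OF D(1)]
  have "\<exists>C. (\<forall>j. C j \<in> sets M) \<and> (\<forall>j. C j \<subseteq> C (Suc j)) \<and> C 0 = {} \<and> C n = A \<and> (\<forall>j. C j \<subseteq> A) \<and>
      (\<forall>j<n. \<rho> (C (Suc j) - C j) = \<rho> A / n)" if "A \<in> D" for A
    using NA_plus_equal_chain[OF \<rho> _ n(1), of A] d(2) that by (metis subsetD)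
  then have "\<exists>C. \<forall>A\<in>D. (\<forall>j. C A j \<in> sets M) \<and> (\<forall>j. C A j \<subseteq> C A (Suc j)) \<and> C A 0 = {} \<and>
      C A n = A \<and> (\<forall>j. C A j \<subseteq> A) \<and> (\<forall>j<n. \<rho> (C A (Suc j) - C A j) = \<rho> A / n)"
    by (intro bchoice) blast
  then obtain C where C': "\<forall>A\<in>D. (\<forall>j. C A j \<in> sets M) \<and> (\<forall>j. C A j \<subseteq> C A (Suc j)) \<and> C A 0 = {} \<and>
      C A n = A \<and> (\<forall>j. C A j \<subseteq> A) \<and> (\<forall>j<n. \<rho> (C A (Suc j) - C A j) = \<rho> A / n)"
    by (elim exE)
  have C: "\<And>A j. A \<in> D \<Longrightarrow> C A j \<in> sets M" "\<And>A j. A \<in> D \<Longrightarrow> C A j \<subseteq> C A (Suc j)"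
    "\<And>A. A \<in> D \<Longrightarrow> C A 0 = {}" "\<And>A. A \<in> D \<Longrightarrow> C A n = A" "\<And>A j. A \<in> D \<Longrightarrow> C A j \<subseteq> A"
    "\<And>A j. A \<in> D \<Longrightarrow> j < n \<Longrightarrow> \<rho> (C A (Suc j) - C A j) = \<rho> A / n"
    using C' by simp_all
  define T where "T = (\<lambda>j. \<Union>A\<in>D. C A j)"
  have step: "T (Suc j) - T j = (\<Union>A\<in>D. C A (Suc j) - C A j)" for j
  proof -
    have "x \<notin> C B j" if "x \<in> C A (Suc j)" "x \<notin> C A j" "A \<in> D" "B \<in> D" for x A B
    proof (cases "A = B")
      case False
      then have "A \<inter> B = {}" using disjointD[OF d(3)] that by blast
      then show ?thesis using that C(5)[of A "Suc j"] C(5)[of B j] by blast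
    qed (use that in simp)
    then show ?thesis unfolding T_def by blast
  qed
  have "\<bar>real n * \<mu> (T (Suc j) - T j) - \<mu> (space M)\<bar> \<le> \<delta>" if \<mu>F: "\<mu> \<in> F" and j: "j < n" for \<mu> j
  proof -
    have \<mu>: "\<mu> \<in> NA M" using \<mu>F F NA_plusD(1) by blast
    have "disjoint_family_on (\<lambda>A. C A (Suc j) - C A j) D"
    proof (unfold disjoint_family_on_def, intro ballI impI)
      fix A B assume "A \<in> D" "B \<in> D" "A \<noteq> B"
      then show "(C A (Suc j) - C A j) \<inter> (C B (Suc j) - C B j) = {}"
        using C(5)[of A "Suc j"] C(5)[of B "Suc j"] disjointD[OF d(3), of A B] by blast
    qed
    then have \<mu>T: "\<mu> (T (Suc j) - T j) = (\<Sum>A\<in>D. \<mu> (C A (Suc j) - C A j))"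
      unfolding step using C(1) d(1) by (intro NA_sum_UN[OF \<mu>, symmetric]) auto
    have \<mu>sp: "\<mu> (space M) = (\<Sum>A\<in>D. \<mu> A)" and \<rho>sp: "\<rho> (space M) = (\<Sum>A\<in>D. \<rho> A)"
      using NA_sum_partition[OF \<mu> d(1-3)] NA_sum_partition[OF NA_plusD(1)[OF \<rho>] d(1-3)] d(4) by auto
    have "\<bar>real n * \<mu> (C A (Suc j) - C A j) - \<mu> A\<bar> \<le> 2 * \<epsilon> * \<rho> A" if A: "A \<in> D" for A
    proof -
      obtain c where c: "\<And>B. B \<in> sets M \<Longrightarrow> B \<subseteq> A \<Longrightarrow> \<bar>\<mu> B - c * \<rho> B\<bar> \<le> \<epsilon> * \<rho> B"
        using bspec[OF bspec[OF D(2) A] \<mu>F] by blast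
      let ?\<Delta> = "C A (Suc j) - C A j"
      have "\<bar>\<mu> ?\<Delta> - c * \<rho> ?\<Delta>\<bar> \<le> \<epsilon> * \<rho> ?\<Delta>" using C(1,5)[OF A] by (intro c) auto
      then have "real n * \<bar>\<mu> ?\<Delta> - c * \<rho> ?\<Delta>\<bar> \<le> real n * (\<epsilon> * \<rho> ?\<Delta>)" by (rule mult_left_mono) simp
      then have "\<bar>real n * (\<mu> ?\<Delta> - c * \<rho> ?\<Delta>)\<bar> \<le> real n * (\<epsilon> * \<rho> ?\<Delta>)" by (simp add: abs_mult)
      then have "\<bar>real n * \<mu> ?\<Delta> - c * \<rho> A\<bar> \<le> \<epsilon> * \<rho> A"
        using C(6)[OF A j] n(1) by (simp add: right_diff_distrib)
      moreover have "\<bar>\<mu> A - c * \<rho> A\<bar> \<le> \<epsilon> * \<rho> A" using A d(2) by (intro c) auto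
      ultimately show ?thesis by linarith
    qed
    then have "(\<Sum>A\<in>D. \<bar>real n * \<mu> (C A (Suc j) - C A j) - \<mu> A\<bar>) \<le> (\<Sum>A\<in>D. 2 * \<epsilon> * \<rho> A)"
      by (rule sum_mono)
    then have "(\<Sum>A\<in>D. \<bar>real n * \<mu> (C A (Suc j) - C A j) - \<mu> A\<bar>) \<le> 2 * \<epsilon> * \<rho> (space M)"
      by (simp add: \<rho>sp sum_distrib_left)
    moreover have "\<bar>real n * \<mu> (T (Suc j) - T j) - \<mu> (space M)\<bar> \<le>
        (\<Sum>A\<in>D. \<bar>real n * \<mu> (C A (Suc j) - C A j) - \<mu> A\<bar>)"
      unfolding \<mu>T \<mu>sp by (simp add: sum_distrib_left sum_subtractf[symmetric] sum_abs)
    ultimately show ?thesis using \<epsilon>(2) by linarith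
  qed
  moreover have "T j \<in> sets M" for j unfolding T_def using C(1) d(1) by auto
  moreover have "T j \<subseteq> T (Suc j)" for j unfolding T_def using C(2) by blast
  moreover have "T 0 = {}" "T n = space M" using C(3,4) d(4) by (auto simp: T_def)
  ultimately have "(n, T) \<in> uniform_chains M F \<delta>" using n\<delta> by (simp add: uniform_chains_def)
  then show ?thesis by blast
qed

definition uniform_chain_filter :: "'a measure \<Rightarrow> (nat \<times> (nat \<Rightarrow> 'a set)) filter" where
  "uniform_chain_filter M =
     (INF p\<in>{F. finite F \<and> F \<subseteq> NA_plus M} \<times> {0<..}. principal (uniform_chains M (fst p) (snd p)))"

text \<open>The union of two families with the smaller of the two tolerances refines both
  conditions, so the sets of chains form a filter base.\<close>

lemma eventually_uniform_chain_filter: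
  "eventually P (uniform_chain_filter M) \<longleftrightarrow>
     (\<exists>F \<delta>. finite F \<and> F \<subseteq> NA_plus M \<and> 0 < \<delta> \<and> (\<forall>x\<in>uniform_chains M F \<delta>. P x))"
proof -
  let ?I = "{F. finite F \<and> F \<subseteq> NA_plus M} \<times> {0::real<..}"
  have "eventually P (uniform_chain_filter M) \<longleftrightarrow>
      (\<exists>p\<in>?I. eventually P (principal (uniform_chains M (fst p) (snd p))))"
    unfolding uniform_chain_filter_def
  proof (rule eventually_INF_base)
    have "({}, 1::real) \<in> ?I" by simp
    then have "\<exists>p. p \<in> ?I" by (rule exI)
    then show "?I \<noteq> {}" by (simp only: ex_in_conv simp_thms)
    fix p q assume pq: "p \<in> ?I" "q \<in> ?I"
    let ?r = "(fst p \<union> fst q, min (snd p) (snd q))"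
    have "uniform_chains M (fst ?r) (snd ?r) \<subseteq> uniform_chains M (fst p) (snd p)"
      "uniform_chains M (fst ?r) (snd ?r) \<subseteq> uniform_chains M (fst q) (snd q)"
      by (rule uniform_chains_mono; simp)+
    moreover have "?r \<in> ?I" using pq by auto
    ultimately show "\<exists>r\<in>?I. principal (uniform_chains M (fst r) (snd r)) \<le>
        inf (principal (uniform_chains M (fst p) (snd p))) (principal (uniform_chains M (fst q) (snd q)))"
      by (intro bexI[of _ ?r] le_infI) simp_all
  qed
  then show ?thesis by (auto simp: eventually_principal)
qed

lemma uniform_chain_filter_neq_bot: "uniform_chain_filter M \<noteq> bot"
proof
  assume "uniform_chain_filter M = bot"
  then have "eventually (\<lambda>x. False) (uniform_chain_filter M)" by simp
  then show False
    using uniform_chains_nonempty unfolding eventually_uniform_chain_filter by blast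
qed

section \<open>Lipschitz games and automorphisms\<close>

text \<open>Monotonicity of \<open>\<nu> + \<mu>\<close> and of \<open>\<mu> - \<nu>\<close> bounds
  an increment of \<open>\<nu>\<close> from below and from above. Later proofs work with increments
  in place of the order of games.\<close>

lemma lipschitz_bounds_iff:
  "\<mu> \<in> lipschitz_bounds M \<nu> \<longleftrightarrow>
     \<mu> \<in> NA_plus M \<and> (\<forall>A\<in>sets M. \<forall>B\<in>sets M. A \<subseteq> B \<longrightarrow> \<bar>\<nu> B - \<nu> A\<bar> \<le> \<mu> B - \<mu> A)"
proof -
  have "x + y \<le> x' + y' \<and> y - x \<le> y' - x' \<longleftrightarrow> \<bar>x' - x\<bar> \<le> y' - y" for x y x' y' :: real
    by linarith
  then show ?thesis
    unfolding lipschitz_bounds_def game_le_def monotone_game_def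
    by (simp add: abs_le_iff) (smt (verit))
qed

lemma lipschitz_boundsD:
  assumes "\<mu> \<in> lipschitz_bounds M \<nu>"
  shows "\<mu> \<in> NA_plus M"
    "A \<in> sets M \<Longrightarrow> B \<in> sets M \<Longrightarrow> A \<subseteq> B \<Longrightarrow> \<bar>\<nu> B - \<nu> A\<bar> \<le> \<mu> B - \<mu> A"
  using assms by (simp_all add: lipschitz_bounds_iff)

lemma lipschitz_bound_abs_le:
  assumes "\<mu> \<in> lipschitz_bounds M \<nu>" "\<nu> \<in> games M" "E \<in> sets M"
  shows "\<bar>\<nu> E\<bar> \<le> \<mu> E"
  using lipschitz_boundsD(2)[OF assms(1), of "{}" E] assms(2,3)
    NA_plusD(2)[OF lipschitz_boundsD(1)[OF assms(1)]] by (simp add: games_def)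

lemma lipschitz_bounds_add:
  assumes "\<mu> \<in> lipschitz_bounds M \<nu>" "\<mu>' \<in> lipschitz_bounds M \<nu>'"
  shows "(\<lambda>E. \<mu> E + \<mu>' E) \<in> lipschitz_bounds M (\<lambda>E. \<nu> E + \<nu>' E)"
proof -
  have "\<bar>(\<nu> B + \<nu>' B) - (\<nu> A + \<nu>' A)\<bar> \<le> (\<mu> B + \<mu>' B) - (\<mu> A + \<mu>' A)"
    if "A \<in> sets M" "B \<in> sets M" "A \<subseteq> B" for A B
    using lipschitz_boundsD(2)[OF assms(1) that] lipschitz_boundsD(2)[OF assms(2) that] by linarith
  then show ?thesis
    using NA_plus_add[OF lipschitz_boundsD(1)[OF assms(1)] lipschitz_boundsD(1)[OF assms(2)]]
    by (simp add: lipschitz_bounds_iff)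
qed

lemma lipschitz_bounds_scale:
  assumes "\<mu> \<in> lipschitz_bounds M \<nu>"
  shows "(\<lambda>E. \<bar>c\<bar> * \<mu> E) \<in> lipschitz_bounds M (\<lambda>E. c * \<nu> E)"
proof -
  have "\<bar>c * \<nu> B - c * \<nu> A\<bar> \<le> \<bar>c\<bar> * \<mu> B - \<bar>c\<bar> * \<mu> A"
    if "A \<in> sets M" "B \<in> sets M" "A \<subseteq> B" for A B
    using mult_left_mono[OF lipschitz_boundsD(2)[OF assms that], of "\<bar>c\<bar>"]
    by (simp add: right_diff_distrib[symmetric] abs_mult)
  then show ?thesis
    using NA_plus_scale[OF lipschitz_boundsD(1)[OF assms], of "\<bar>c\<bar>"] by (simp add: lipschitz_bounds_iff)
qed

lemma lipschitz_bounds_zero: "(\<lambda>E. 0) \<in> lipschitz_bounds M (\<lambda>E. 0)"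
  by (simp add: lipschitz_bounds_iff NA_plus_zero)

lemma variation_sums_le_lipschitz_bound:
  assumes "\<mu> \<in> lipschitz_bounds M \<nu>" "v \<in> variation_sums M \<nu>"
  shows "v \<le> \<mu> (space M)"
proof -
  obtain m S where S: "v = (\<Sum>i<m. \<bar>\<nu> (S (Suc i)) - \<nu> (S i)\<bar>)" "\<forall>i\<le>m. S i \<in> sets M"
    "S 0 = {}" "S m = space M" "\<forall>i<m. S i \<subseteq> S (Suc i)"
    using assms(2) unfolding variation_sums_def by auto
  have "v \<le> (\<Sum>i<m. \<mu> (S (Suc i)) - \<mu> (S i))"
    unfolding S(1) using S by (intro sum_mono lipschitz_boundsD(2)[OF assms(1)]) auto
  also have "\<dots> = \<mu> (space M)"
    using S(3,4) NA_plusD(2)[OF lipschitz_boundsD(1)[OF assms(1)]]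
    by (simp add: sum_lessThan_telescope[of "\<lambda>i. \<mu> (S i)"])
  finally show ?thesis .
qed

lemma AC_inf_iff: "\<nu> \<in> AC_inf M \<longleftrightarrow> \<nu> \<in> games M \<and> lipschitz_bounds M \<nu> \<noteq> {}"
proof -
  have "bdd_above (variation_sums M \<nu>)" if "\<mu> \<in> lipschitz_bounds M \<nu>" for \<mu>
    using variation_sums_le_lipschitz_bound[OF that] by (rule bdd_aboveI)
  then show ?thesis unfolding AC_inf_def BV_def by auto
qed

section \<open>Powers of nonatomic probability measures and their closed span\<close>

text \<open>The remainder over the tangent line satisfies the recursion \<open>rec\<close>, so
  raising the degree from \<open>r\<close> to \<open>Suc r\<close> adds at most
  \<open>real r * x ^ 2\<close>. The factor \<open>(real r) ^ 2\<close> is a convenient bound for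
  the resulting sum of degrees.\<close>

lemma power_le_tangent:
  fixes a x :: real
  assumes "0 \<le> a" "0 \<le> x" "a + x \<le> 1"
  shows "0 \<le> (a + x) ^ r - a ^ r - real r * a ^ (r - 1) * x"
    "(a + x) ^ r - a ^ r - real r * a ^ (r - 1) * x \<le> (real r)\<^sup>2 * x\<^sup>2"
proof -
  define f where "f = (\<lambda>r::nat. (a + x) ^ r - a ^ r - real r * a ^ (r - 1) * x)"
  have rec: "f (Suc r) = (a + x) * f r + real r * a ^ (r - 1) * x\<^sup>2" for r
    by (cases r) (simp_all add: f_def algebra_simps power2_eq_square)
  have "0 \<le> f r \<and> f r \<le> (real r)\<^sup>2 * x\<^sup>2"
  proof (induction r)
    case 0
    then show ?case by (simp add: f_def)
  next
    case (Suc r)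
    have "0 \<le> f (Suc r)" unfolding rec using Suc assms by simp
    moreover have "(a + x) * f r \<le> 1 * f r" using Suc assms by (intro mult_right_mono) auto
    moreover have "a ^ (r - 1) \<le> 1" using assms by (intro power_le_one) auto
    then have "real r * a ^ (r - 1) * x\<^sup>2 \<le> real r * x\<^sup>2"
      by (intro mult_right_mono mult_left_le) auto
    moreover have "(real r)\<^sup>2 * x\<^sup>2 + real r * x\<^sup>2 \<le> (real (Suc r))\<^sup>2 * x\<^sup>2"
    proof -
      have "(real r)\<^sup>2 + real r \<le> (real (Suc r))\<^sup>2" by (simp add: power2_eq_square algebra_simps)
      from mult_right_mono[OF this, of "x\<^sup>2"] show ?thesis by (simp add: distrib_right)
    qed
    ultimately show ?case using Suc unfolding rec by linarith
  qed
  then show "0 \<le> (a + x) ^ r - a ^ r - real r * a ^ (r - 1) * x"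
    "(a + x) ^ r - a ^ r - real r * a ^ (r - 1) * x \<le> (real r)\<^sup>2 * x\<^sup>2"
    by (simp_all add: f_def)
qed

lemma NA_probD:
  assumes "\<mu> \<in> NA_prob M"
  shows "\<mu> \<in> NA_plus M" "\<mu> (space M) = 1" "E \<in> sets M \<Longrightarrow> \<mu> E \<le> 1"
  using assms NA_plus_mono[of \<mu> M E "space M"] sets.sets_into_space[of E M]
  by (auto simp: NA_prob_def)

text \<open>The constant adds the slope, at most \<open>r\<close>, and the factor
  \<open>real r ^ 2\<close> of the remainder in \<open>power_le_tangent\<close>, where
  \<open>x ^ 2 \<le> x\<close> is used.\<close>

lemma power_game_lipschitz:
  assumes \<mu>: "\<mu> \<in> NA_prob M"
  shows "(\<lambda>E. (r + real r ^ 2) * \<mu> E) \<in> lipschitz_bounds M (\<lambda>E. \<mu> E ^ r)"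
proof -
  note p = NA_probD(1)[OF \<mu>]
  have "\<bar>\<mu> B ^ r - \<mu> A ^ r\<bar> \<le> (r + real r ^ 2) * \<mu> B - (r + real r ^ 2) * \<mu> A"
    if AB: "A \<in> sets M" "B \<in> sets M" "A \<subseteq> B" for A B
  proof -
    define a x where "a = \<mu> A" and "x = \<mu> B - \<mu> A"
    have ax: "0 \<le> a" "0 \<le> x" "a + x \<le> 1"
      using NA_plusD(4)[OF p] NA_plus_mono[OF p AB(3,2)] NA_probD(3)[OF \<mu> AB(2)]
      by (auto simp: a_def x_def)
    have "\<mu> A ^ r \<le> \<mu> B ^ r"
      using ax by (intro power_mono) (auto simp: a_def x_def)
    moreover have "a ^ (r - 1) \<le> 1" using ax by (intro power_le_one) auto
    then have "real r * a ^ (r - 1) * x \<le> real r * x"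
      using ax by (intro mult_right_mono mult_left_le) auto
    moreover have "(real r)\<^sup>2 * x\<^sup>2 \<le> (real r)\<^sup>2 * x"
      using ax by (intro mult_left_mono) (auto simp: power2_eq_square mult_left_le)
    ultimately have "\<mu> B ^ r - \<mu> A ^ r \<le> r * x + (real r)\<^sup>2 * x" "\<mu> A ^ r \<le> \<mu> B ^ r"
      using power_le_tangent(2)[OF ax, of r] by (auto simp: a_def x_def)
    then show ?thesis by (simp add: x_def algebra_simps)
  qed
  moreover have "(\<lambda>E. (r + real r ^ 2) * \<mu> E) \<in> NA_plus M"
    by (intro NA_plus_scale p) simp
  ultimately show ?thesis by (simp add: lipschitz_bounds_iff)
qed

lemma power_spanE:
  assumes "\<eta> \<in> power_span M"
  obtains n :: nat and c \<mu> r where "\<eta> = (\<lambda>E. \<Sum>i<n. c i * \<mu> i E ^ r i)"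
    "\<forall>i<n. \<mu> i \<in> NA_prob M \<and> 1 \<le> r i"
  using assms unfolding power_span_def by (elim CollectE exE conjE)

lemma power_span_games:
  assumes "\<eta> \<in> power_span M"
  shows "\<eta> \<in> games M"
proof -
  obtain n :: nat and c \<mu> r where \<eta>: "\<eta> = (\<lambda>E. \<Sum>i<n. c i * \<mu> i E ^ r i)"
    and P: "\<forall>i<n. \<mu> i \<in> NA_prob M \<and> 1 \<le> r i"
    using assms by (elim power_spanE)
  have "c i * \<mu> i E ^ r i = 0" if "i < n" "E \<notin> sets M \<or> E = {}" for i E
  proof -
    have i: "\<mu> i \<in> NA_plus M" "r i \<noteq> 0" using P that(1) NA_probD(1) by fastforce+
    have "\<mu> i E = 0" using that(2) NA_plusD(2,3)[OF i(1)] by blast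
    then show ?thesis using i(2) by simp
  qed
  then show ?thesis unfolding \<eta> games_def by (auto intro!: sum.neutral)
qed

lemma power_span_lipschitz:
  assumes "\<eta> \<in> power_span M"
  shows "lipschitz_bounds M \<eta> \<noteq> {}"
proof -
  obtain n :: nat and c \<mu> r where \<eta>: "\<eta> = (\<lambda>E. \<Sum>i<n. c i * \<mu> i E ^ r i)"
    and P: "\<forall>i<n. \<mu> i \<in> NA_prob M \<and> 1 \<le> r i"
    using assms by (elim power_spanE)
  have "lipschitz_bounds M (\<lambda>E. \<Sum>i<m. c i * \<mu> i E ^ r i) \<noteq> {}" if "m \<le> n" for m
    using that
  proof (induction m)
    case 0
    have "lipschitz_bounds M (\<lambda>E. 0) \<noteq> {}" using lipschitz_bounds_zero by fast
    then show ?case by simp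
  next
    case (Suc m)
    then obtain \<kappa> where "\<kappa> \<in> lipschitz_bounds M (\<lambda>E. \<Sum>i<m. c i * \<mu> i E ^ r i)" by auto
    moreover have "\<mu> m \<in> NA_prob M" using P Suc by auto
    ultimately have "(\<lambda>E. \<kappa> E + \<bar>c m\<bar> * ((r m + real (r m) ^ 2) * \<mu> m E)) \<in>
        lipschitz_bounds M (\<lambda>E. (\<Sum>i<m. c i * \<mu> i E ^ r i) + c m * \<mu> m E ^ r m)"
      by (intro lipschitz_bounds_add lipschitz_bounds_scale power_game_lipschitz)
    then show ?case by auto
  qed
  then show ?thesis unfolding \<eta> by simp
qed

lemma sum_lessThan_add:
  fixes f :: "nat \<Rightarrow> real"
  shows "(\<Sum>i<m + n. f i) = (\<Sum>i<m. f i) + (\<Sum>i<n. f (m + i))"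
  by (induction n) auto

lemma power_span_add:
  assumes "\<eta> \<in> power_span M" "\<eta>' \<in> power_span M"
  shows "(\<lambda>E. \<eta> E + \<eta>' E) \<in> power_span M"
proof -
  obtain n :: nat and c \<mu> r where \<eta>: "\<eta> = (\<lambda>E. \<Sum>i<n. c i * \<mu> i E ^ r i)"
    and P: "\<forall>i<n. \<mu> i \<in> NA_prob M \<and> 1 \<le> r i"
    using assms(1) by (elim power_spanE)
  obtain n' :: nat and c' \<mu>' r' where \<eta>': "\<eta>' = (\<lambda>E. \<Sum>i<n'. c' i * \<mu>' i E ^ r' i)"
    and P': "\<forall>i<n'. \<mu>' i \<in> NA_prob M \<and> 1 \<le> r' i"
    using assms(2) by (elim power_spanE)
  let ?c = "\<lambda>i. if i < n then c i else c' (i - n)"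
  let ?\<mu> = "\<lambda>i. if i < n then \<mu> i else \<mu>' (i - n)"
  let ?r = "\<lambda>i. if i < n then r i else r' (i - n)"
  have "(\<lambda>E. \<eta> E + \<eta>' E) = (\<lambda>E. \<Sum>i<n + n'. ?c i * ?\<mu> i E ^ ?r i)"
    by (simp add: sum_lessThan_add \<eta> \<eta>')
  moreover have "\<forall>i<n + n'. ?\<mu> i \<in> NA_prob M \<and> 1 \<le> ?r i" using P P' by auto
  ultimately show ?thesis
    unfolding power_span_def by (intro CollectI exI[of _ "n + n'"] exI[of _ ?c] exI[of _ ?\<mu>] exI[of _ ?r]) simp
qed

lemma power_span_scale:
  assumes "\<eta> \<in> power_span M"
  shows "(\<lambda>E. a * \<eta> E) \<in> power_span M"
proof -
  obtain n :: nat and c \<mu> r where \<eta>: "\<eta> = (\<lambda>E. \<Sum>i<n. c i * \<mu> i E ^ r i)"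
    and P: "\<forall>i<n. \<mu> i \<in> NA_prob M \<and> 1 \<le> r i"
    using assms by (elim power_spanE)
  have "(\<lambda>E. a * \<eta> E) = (\<lambda>E. \<Sum>i<n. (a * c i) * \<mu> i E ^ r i)"
    by (simp add: \<eta> sum_distrib_left mult.assoc)
  then show ?thesis
    unfolding power_span_def using P
    by (intro CollectI exI[of _ n] exI[of _ "\<lambda>i. a * c i"] exI[of _ \<mu>] exI[of _ r]) simp
qed

lemma power_span_power:
  assumes "\<mu> \<in> NA_prob M" "1 \<le> r"
  shows "(\<lambda>E. \<mu> E ^ r) \<in> power_span M"
  unfolding power_span_def using assms
  by (intro CollectI exI[of _ "1::nat"] exI[of _ "\<lambda>i::nat. 1::real"] exI[of _ "\<lambda>i::nat. \<mu>"] exI[of _ "\<lambda>i::nat. r"]) simp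

lemma power_span_zero: "(\<lambda>E. 0) \<in> power_span M"
  unfolding power_span_def by (intro CollectI exI[of _ "0::nat"]) simp

text \<open>The infimum in \<open>AC_inf_norm\<close> is meaningful only for a nonempty set of
  bounds, which exists because both \<open>\<nu>\<close> and \<open>\<eta>\<close> are Lipschitz. An
  infimum below \<open>\<epsilon>\<close> is then the same as a single bound of mass below
  \<open>\<epsilon>\<close>, and the norm can be forgotten.\<close>

lemma pNA_inf_iff:
  "\<nu> \<in> pNA_inf M \<longleftrightarrow> \<nu> \<in> games M \<and> lipschitz_bounds M \<nu> \<noteq> {} \<and>
     (\<forall>\<epsilon>>0. \<exists>\<eta>\<in>power_span M. \<exists>\<mu>\<in>lipschitz_bounds M (\<lambda>E. \<nu> E - \<eta> E). \<mu> (space M) < \<epsilon>)"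
proof -
  have key: "AC_inf_norm M (\<lambda>E. \<nu> E - \<eta> E) < \<epsilon> \<longleftrightarrow>
      (\<exists>\<mu>\<in>lipschitz_bounds M (\<lambda>E. \<nu> E - \<eta> E). \<mu> (space M) < \<epsilon>)"
    if ne_\<nu>: "lipschitz_bounds M \<nu> \<noteq> {}" and \<eta>: "\<eta> \<in> power_span M" for \<eta> \<epsilon>
  proof -
    let ?B = "lipschitz_bounds M (\<lambda>E. \<nu> E - \<eta> E)"
    obtain \<mu> where "\<mu> \<in> lipschitz_bounds M \<nu>" using ne_\<nu> by blast
    moreover obtain \<kappa> where "\<kappa> \<in> lipschitz_bounds M (\<lambda>E. - 1 * \<eta> E)"
      using power_span_lipschitz[OF power_span_scale[OF \<eta>, of "- 1"]] by blast
    ultimately have "(\<lambda>E. \<mu> E + \<kappa> E) \<in> lipschitz_bounds M (\<lambda>E. \<nu> E + - 1 * \<eta> E)"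
      by (rule lipschitz_bounds_add)
    then have ne: "{\<mu> (space M) |\<mu>. \<mu> \<in> ?B} \<noteq> {}" by auto
    have bdd: "bdd_below {\<mu> (space M) |\<mu>. \<mu> \<in> ?B}"
      by (rule bdd_belowI[of _ 0]) (auto dest: lipschitz_boundsD(1) intro: NA_plusD(4))
    show ?thesis
      unfolding AC_inf_norm_def using cInf_less_iff[OF ne bdd] by auto
  qed
  show ?thesis
  proof (cases "lipschitz_bounds M \<nu> = {}")
    case False
    then show ?thesis by (simp add: pNA_inf_def AC_inf_iff key cong: bex_cong)
  qed (simp add: pNA_inf_def AC_inf_iff)
qed

lemma pNA_inf_approx:
  assumes "\<nu> \<in> pNA_inf M" "0 < \<epsilon>"
  obtains \<eta> \<mu> where "\<eta> \<in> power_span M" "\<mu> \<in> lipschitz_bounds M (\<lambda>E. \<nu> E - \<eta> E)"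
    "\<mu> (space M) < \<epsilon>"
proof -
  have "\<exists>\<eta>\<in>power_span M. \<exists>\<mu>\<in>lipschitz_bounds M (\<lambda>E. \<nu> E - \<eta> E). \<mu> (space M) < \<epsilon>"
    using assms by (simp add: pNA_inf_iff)
  then show ?thesis by (elim bexE) (rule that)
qed

lemma power_span_subset_pNA_inf: "power_span M \<subseteq> pNA_inf M"
proof
  fix \<eta> assume \<eta>: "\<eta> \<in> power_span M"
  have "\<exists>\<mu>\<in>lipschitz_bounds M (\<lambda>E. \<eta> E - \<eta> E). \<mu> (space M) < \<epsilon>" if "\<epsilon> > 0" for \<epsilon>
    using that lipschitz_bounds_zero by (intro bexI[of _ "\<lambda>E. 0"]) auto
  then show "\<eta> \<in> pNA_inf M"
    unfolding pNA_inf_iff using \<eta> power_span_games power_span_lipschitz by blast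
qed

lemma variation_sums_nonempty: "variation_sums M \<nu> \<noteq> {}"
proof -
  have "(\<Sum>i<1::nat. \<bar>\<nu> (if Suc i = 0 then {} else space M) - \<nu> (if i = 0 then {} else space M)\<bar>)
      \<in> variation_sums M \<nu>"
    unfolding variation_sums_def
    by (intro CollectI exI[of _ "1::nat"] exI[of _ "\<lambda>i. if i = 0 then {} else space M"]) auto
  then show ?thesis by blast
qed

lemma power_span_subset_pNA: "power_span M \<subseteq> pNA M"
proof
  fix \<eta> assume \<eta>: "\<eta> \<in> power_span M"
  have "variation_sums M (\<lambda>E. \<eta> E - \<eta> E) = {0}"
    using variation_sums_nonempty[of M "\<lambda>E. \<eta> E - \<eta> E"] by (auto simp: variation_sums_def)
  then have "BV_norm M (\<lambda>E. \<eta> E - \<eta> E) = 0" by (simp add: BV_norm_def)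
  moreover have "\<eta> \<in> BV M"
    using \<eta> power_span_subset_pNA_inf by (auto simp: pNA_inf_def AC_inf_def)
  ultimately show "\<eta> \<in> pNA M" unfolding pNA_def using \<eta> by force
qed

lemma pNA_inf_add:
  assumes "\<nu> \<in> pNA_inf M" "\<nu>' \<in> pNA_inf M"
  shows "(\<lambda>E. \<nu> E + \<nu>' E) \<in> pNA_inf M"
  unfolding pNA_inf_iff
proof (intro conjI allI impI)
  show "(\<lambda>E. \<nu> E + \<nu>' E) \<in> games M" using assms by (auto simp: pNA_inf_iff games_def)
  obtain \<mu> \<mu>' where "\<mu> \<in> lipschitz_bounds M \<nu>" "\<mu>' \<in> lipschitz_bounds M \<nu>'"
    using assms by (auto simp: pNA_inf_iff)
  then have "(\<lambda>E. \<mu> E + \<mu>' E) \<in> lipschitz_bounds M (\<lambda>E. \<nu> E + \<nu>' E)" by (rule lipschitz_bounds_add)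
  then show "lipschitz_bounds M (\<lambda>E. \<nu> E + \<nu>' E) \<noteq> {}" by (metis empty_iff)
  fix \<epsilon> :: real assume "\<epsilon> > 0"
  then have "\<epsilon> / 2 > 0" by simp
  obtain \<eta> \<mu> where 1: "\<eta> \<in> power_span M" "\<mu> \<in> lipschitz_bounds M (\<lambda>E. \<nu> E - \<eta> E)"
      "\<mu> (space M) < \<epsilon> / 2"
    using pNA_inf_approx[OF assms(1) \<open>\<epsilon> / 2 > 0\<close>] .
  obtain \<eta>' \<mu>' where 2: "\<eta>' \<in> power_span M" "\<mu>' \<in> lipschitz_bounds M (\<lambda>E. \<nu>' E - \<eta>' E)"
      "\<mu>' (space M) < \<epsilon> / 2"
    using pNA_inf_approx[OF assms(2) \<open>\<epsilon> / 2 > 0\<close>] .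
  have "(\<lambda>E. \<mu> E + \<mu>' E) \<in> lipschitz_bounds M (\<lambda>E. (\<nu> E + \<nu>' E) - (\<eta> E + \<eta>' E))"
    using lipschitz_bounds_add[OF 1(2) 2(2)] by (simp add: algebra_simps)
  then show "\<exists>\<eta>\<in>power_span M. \<exists>\<mu>\<in>lipschitz_bounds M (\<lambda>E. (\<nu> E + \<nu>' E) - \<eta> E). \<mu> (space M) < \<epsilon>"
    using 1(3) 2(3)
    by (intro bexI[OF _ power_span_add[OF 1(1) 2(1)]] bexI[of _ "\<lambda>E. \<mu> E + \<mu>' E"]) auto
qed

lemma pNA_inf_scale:
  assumes "\<nu> \<in> pNA_inf M"
  shows "(\<lambda>E. a * \<nu> E) \<in> pNA_inf M"
  unfolding pNA_inf_iff
proof (intro conjI allI impI)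
  show "(\<lambda>E. a * \<nu> E) \<in> games M" using assms by (auto simp: pNA_inf_iff games_def)
  obtain \<mu> where "\<mu> \<in> lipschitz_bounds M \<nu>"
    using assms by (auto simp: pNA_inf_iff)
  then have "(\<lambda>E. \<bar>a\<bar> * \<mu> E) \<in> lipschitz_bounds M (\<lambda>E. a * \<nu> E)" by (rule lipschitz_bounds_scale)
  then show "lipschitz_bounds M (\<lambda>E. a * \<nu> E) \<noteq> {}" by (metis empty_iff)
  fix \<epsilon> :: real assume "\<epsilon> > 0"
  then have "\<epsilon> / (\<bar>a\<bar> + 1) > 0" by simp
  then obtain \<eta> \<mu> where 1: "\<eta> \<in> power_span M" "\<mu> \<in> lipschitz_bounds M (\<lambda>E. \<nu> E - \<eta> E)"
      "\<mu> (space M) < \<epsilon> / (\<bar>a\<bar> + 1)"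
    by (rule pNA_inf_approx[OF assms])
  have "0 \<le> \<mu> (space M)" using NA_plusD(4)[OF lipschitz_boundsD(1)[OF 1(2)]] .
  then have "\<bar>a\<bar> * \<mu> (space M) < \<epsilon>"
    using 1(3) mult_right_mono[of "\<bar>a\<bar>" "\<bar>a\<bar> + 1" "\<mu> (space M)"]
    by (simp add: pos_less_divide_eq mult.commute)
  moreover have "(\<lambda>E. \<bar>a\<bar> * \<mu> E) \<in> lipschitz_bounds M (\<lambda>E. a * \<nu> E - a * \<eta> E)"
    using lipschitz_bounds_scale[OF 1(2), of a] by (simp add: algebra_simps)
  ultimately show "\<exists>\<eta>\<in>power_span M. \<exists>\<mu>\<in>lipschitz_bounds M (\<lambda>E. a * \<nu> E - \<eta> E). \<mu> (space M) < \<epsilon>"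
    by (intro bexI[OF _ power_span_scale[OF 1(1)]] bexI[of _ "\<lambda>E. \<bar>a\<bar> * \<mu> E"]) auto
qed

section \<open>Automorphisms and transported games\<close>

lemma automorphismD:
  assumes "\<theta> \<in> automorphisms M"
  shows "inj_on \<theta> (space M)" "\<theta> ` space M = space M"
    "E \<in> sets M \<Longrightarrow> \<theta> ` E \<in> sets M" "E \<in> sets M \<Longrightarrow> \<theta> -` E \<inter> space M \<in> sets M"
proof -
  have bij: "bij_betw \<theta> (space M) (space M)" and meas: "\<theta> \<in> measurable M M"
    and inv: "the_inv_into (space M) \<theta> \<in> measurable M M"
    using assms by (auto simp: automorphisms_def)
  show inj: "inj_on \<theta> (space M)" and im: "\<theta> ` space M = space M"
    using bij by (auto simp: bij_betw_def)
  show "\<theta> ` E \<in> sets M" if "E \<in> sets M"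
  proof -
    have "\<theta> ` E = the_inv_into (space M) \<theta> -` E \<inter> space M"
    proof (intro equalityI subsetI)
      fix y assume "y \<in> \<theta> ` E"
      then show "y \<in> the_inv_into (space M) \<theta> -` E \<inter> space M"
        using sets.sets_into_space[OF that] im by (auto simp: the_inv_into_f_f[OF inj] subset_iff)
    next
      fix y assume y: "y \<in> the_inv_into (space M) \<theta> -` E \<inter> space M"
      then have "\<theta> (the_inv_into (space M) \<theta> y) = y" using f_the_inv_into_f[OF inj] im by auto
      then show "y \<in> \<theta> ` E" using y by (metis IntD1 imageI vimageE)
    qed
    then show ?thesis using measurable_sets[OF inv that] by simp
  qed
  show "\<theta> -` E \<inter> space M \<in> sets M" if "E \<in> sets M"
    using measurable_sets[OF meas that] .
qed

lemma automorphism_image_Diff: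
  assumes "\<theta> \<in> automorphisms M" "A \<in> sets M" "B \<in> sets M"
  shows "\<theta> ` (A - B) = \<theta> ` A - \<theta> ` B"
  using assms(2,3)[THEN sets.sets_into_space]
  by (intro inj_on_image_set_diff[OF automorphismD(1)[OF assms(1)]]) auto

lemma automorphism_image_Int:
  assumes "\<theta> \<in> automorphisms M" "A \<in> sets M" "B \<in> sets M"
  shows "\<theta> ` (A \<inter> B) = \<theta> ` A \<inter> \<theta> ` B"
  using assms(2,3)[THEN sets.sets_into_space]
  by (intro inj_on_image_Int[OF automorphismD(1)[OF assms(1)]]) auto

lemma automorphism_preimageE:
  assumes "\<theta> \<in> automorphisms M" "E \<in> sets M"
  obtains E' where "E' \<in> sets M" "\<theta> ` E' = E"
proof (rule that)
  have "E \<subseteq> \<theta> ` space M"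
    using sets.sets_into_space[OF assms(2)] automorphismD(2)[OF assms(1)] by simp
  then show "\<theta> ` (\<theta> -` E \<inter> space M) = E" by blast
  show "\<theta> -` E \<inter> space M \<in> sets M"
    using automorphismD(4)[OF assms] .
qed

lemma transport_games: "\<nu> \<in> games M \<Longrightarrow> transport M \<theta> \<nu> \<in> games M"
  by (auto simp: games_def transport_def)

lemma transport_NA:
  assumes \<theta>: "\<theta> \<in> automorphisms M" and \<mu>: "\<mu> \<in> NA M"
  shows "transport M \<theta> \<mu> \<in> NA M"
proof -
  have "(\<lambda>i. transport M \<theta> \<mu> (A i)) sums transport M \<theta> \<mu> (\<Union>i. A i)"
    if A: "range A \<subseteq> sets M" "disjoint_family A" for A :: "nat \<Rightarrow> 'a set"
  proof -
    have "\<theta> ` A i \<inter> \<theta> ` A j = {}" if "i \<noteq> j" for i j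
      using automorphism_image_Int[OF \<theta>, of "A i" "A j"] A disjoint_family_onD[OF A(2), of i j] that
      by auto
    then have "disjoint_family (\<lambda>i. \<theta> ` A i)" by (simp add: disjoint_family_on_def)
    moreover have "range (\<lambda>i. \<theta> ` A i) \<subseteq> sets M" using automorphismD(3)[OF \<theta>] A(1) by auto
    ultimately have "(\<lambda>i. \<mu> (\<theta> ` A i)) sums \<mu> (\<Union>i. \<theta> ` A i)"
      using \<mu> unfolding NA_def by blast
    moreover have "A i \<in> sets M" for i using A by auto
    ultimately show ?thesis by (simp add: transport_def image_UN)
  qed
  moreover have "\<exists>T\<in>sets M. T \<subseteq> S \<and> transport M \<theta> \<mu> T \<noteq> 0 \<and> transport M \<theta> \<mu> (S - T) \<noteq> 0"
    if S: "S \<in> sets M" "transport M \<theta> \<mu> S \<noteq> 0" for S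
  proof -
    have "\<theta> ` S \<in> sets M" "\<mu> (\<theta> ` S) \<noteq> 0"
      using S automorphismD(3)[OF \<theta>] by (auto simp: transport_def)
    then obtain T where T: "T \<in> sets M" "T \<subseteq> \<theta> ` S" "\<mu> T \<noteq> 0" "\<mu> (\<theta> ` S - T) \<noteq> 0"
      using \<mu> unfolding NA_def by blast
    obtain T' where T': "T' \<in> sets M" "\<theta> ` T' = T" using automorphism_preimageE[OF \<theta> T(1)] .
    have "T' \<subseteq> S"
      using T(2) T' inj_on_image_subset_iff[OF automorphismD(1)[OF \<theta>], of T' S]
        sets.sets_into_space[OF S(1)] sets.sets_into_space[OF T'(1)] by simp
    then show ?thesis
      using T T' S(1) automorphism_image_Diff[OF \<theta> S(1) T'(1)]
      by (intro bexI[OF _ T'(1)]) (auto simp: transport_def)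
  qed
  moreover have "transport M \<theta> \<mu> \<in> games M" using \<mu> by (intro transport_games) (simp add: NA_def)
  ultimately show ?thesis by (simp add: NA_def)
qed

lemma transport_NA_plus:
  assumes "\<theta> \<in> automorphisms M" "\<mu> \<in> NA_plus M"
  shows "transport M \<theta> \<mu> \<in> NA_plus M"
  using transport_NA[OF assms(1) NA_plusD(1)[OF assms(2)]] NA_plusD(4)[OF assms(2)]
  by (simp add: NA_plus_def transport_def)

lemma transport_space: "\<theta> \<in> automorphisms M \<Longrightarrow> transport M \<theta> \<mu> (space M) = \<mu> (space M)"
  by (simp add: transport_def automorphismD(2))

lemma transport_lipschitz_bounds:
  assumes \<theta>: "\<theta> \<in> automorphisms M" and \<mu>: "\<mu> \<in> lipschitz_bounds M \<nu>"
  shows "transport M \<theta> \<mu> \<in> lipschitz_bounds M (transport M \<theta> \<nu>)"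
proof -
  have "\<bar>\<nu> (\<theta> ` B) - \<nu> (\<theta> ` A)\<bar> \<le> \<mu> (\<theta> ` B) - \<mu> (\<theta> ` A)" if "A \<in> sets M" "B \<in> sets M" "A \<subseteq> B" for A B
    using that by (intro lipschitz_boundsD(2)[OF \<mu>] automorphismD(3)[OF \<theta>] image_mono)
  then show ?thesis
    using transport_NA_plus[OF \<theta> lipschitz_boundsD(1)[OF \<mu>]]
    by (simp add: lipschitz_bounds_iff transport_def)
qed

lemma transport_power_span:
  assumes \<theta>: "\<theta> \<in> automorphisms M" and "\<eta> \<in> power_span M"
  shows "transport M \<theta> \<eta> \<in> power_span M"
proof -
  obtain n :: nat and c \<mu> r where \<eta>: "\<eta> = (\<lambda>E. \<Sum>i<n. c i * \<mu> i E ^ r i)"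
    and P: "\<forall>i<n. \<mu> i \<in> NA_prob M \<and> 1 \<le> r i"
    using assms(2) by (elim power_spanE)
  have "transport M \<theta> \<eta> E = (\<Sum>i<n. c i * transport M \<theta> (\<mu> i) E ^ r i)" for E
  proof (cases "E \<in> sets M")
    case False
    have "transport M \<theta> \<eta> E = 0" using False by (simp add: transport_def)
    moreover have "(\<Sum>i<n. c i * transport M \<theta> (\<mu> i) E ^ r i) = 0"
      using P False by (intro sum.neutral) (auto simp: transport_def)
    ultimately show ?thesis by (rule trans[OF _ sym])
  qed (simp add: transport_def \<eta>)
  then have "transport M \<theta> \<eta> = (\<lambda>E. \<Sum>i<n. c i * transport M \<theta> (\<mu> i) E ^ r i)" by blast
  moreover have "\<forall>i<n. transport M \<theta> (\<mu> i) \<in> NA_prob M \<and> 1 \<le> r i"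
    using P transport_NA_plus[OF \<theta>] transport_space[OF \<theta>] by (simp add: NA_prob_def)
  ultimately show ?thesis
    unfolding power_span_def
    by (intro CollectI exI[of _ n] exI[of _ c] exI[of _ "\<lambda>i. transport M \<theta> (\<mu> i)"] exI[of _ r]) simp
qed

lemma transport_pNA_inf:
  assumes \<theta>: "\<theta> \<in> automorphisms M" and \<nu>: "\<nu> \<in> pNA_inf M"
  shows "transport M \<theta> \<nu> \<in> pNA_inf M"
  unfolding pNA_inf_iff
proof (intro conjI allI impI)
  show "transport M \<theta> \<nu> \<in> games M" using \<nu> by (intro transport_games) (simp add: pNA_inf_iff)
  obtain \<mu> where "\<mu> \<in> lipschitz_bounds M \<nu>" using \<nu> by (auto simp: pNA_inf_iff)
  then have "transport M \<theta> \<mu> \<in> lipschitz_bounds M (transport M \<theta> \<nu>)"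
    by (rule transport_lipschitz_bounds[OF \<theta>])
  then show "lipschitz_bounds M (transport M \<theta> \<nu>) \<noteq> {}" by (metis empty_iff)
  fix \<epsilon> :: real assume "\<epsilon> > 0"
  then obtain \<eta> \<mu> where 1: "\<eta> \<in> power_span M" "\<mu> \<in> lipschitz_bounds M (\<lambda>E. \<nu> E - \<eta> E)"
      "\<mu> (space M) < \<epsilon>"
    by (rule pNA_inf_approx[OF \<nu>])
  have "transport M \<theta> (\<lambda>E. \<nu> E - \<eta> E) = (\<lambda>E. transport M \<theta> \<nu> E - transport M \<theta> \<eta> E)"
    by (auto simp: transport_def)
  then have "transport M \<theta> \<mu> \<in> lipschitz_bounds M (\<lambda>E. transport M \<theta> \<nu> E - transport M \<theta> \<eta> E)"
    using transport_lipschitz_bounds[OF \<theta> 1(2)] by simp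
  then show "\<exists>\<eta>\<in>power_span M. \<exists>\<mu>\<in>lipschitz_bounds M (\<lambda>E. transport M \<theta> \<nu> E - \<eta> E). \<mu> (space M) < \<epsilon>"
    using 1(3) transport_space[OF \<theta>]
    by (intro bexI[OF _ transport_power_span[OF \<theta> 1(1)]] bexI[of _ "transport M \<theta> \<mu>"]) auto
qed

lemma symmetric_subspace_pNA_inf: "symmetric_subspace M (pNA_inf M)"
proof -
  have "pNA_inf M \<subseteq> BV M" by (auto simp: pNA_inf_def AC_inf_def)
  moreover have "(\<lambda>E. 0) \<in> pNA_inf M" using power_span_zero power_span_subset_pNA_inf by blast
  ultimately show ?thesis
    by (simp add: symmetric_subspace_def pNA_inf_add pNA_inf_scale transport_pNA_inf)
qed

section \<open>The diagonal value\<close>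

text \<open>A discrete form of the diagonal formula: along a uniform chain \<open>T j\<close> stands
  for the diagonal point with parameter \<open>j / n\<close>, and the difference quotient in
  direction \<open>E\<close> replaces the derivative.\<close>

definition diagonal_sum :: "('a set \<Rightarrow> real) \<Rightarrow> 'a set \<Rightarrow> nat \<times> (nat \<Rightarrow> 'a set) \<Rightarrow> real" where
  "diagonal_sum \<nu> E = (\<lambda>(n, T). \<Sum>j<n. \<nu> (T j \<union> E \<inter> (T (Suc j) - T j)) - \<nu> (T j))"

definition diagonal_value :: "'a measure \<Rightarrow> ('a set \<Rightarrow> real) \<Rightarrow> 'a set \<Rightarrow> real" where
  "diagonal_value M \<nu> E =
     (if E \<in> sets M then Lim (uniform_chain_filter M) (diagonal_sum \<nu> E) else 0)"

lemma eventually_uniform_chains: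
  assumes "finite F" "F \<subseteq> NA_plus M" "0 < \<delta>"
  shows "eventually (\<lambda>x. x \<in> uniform_chains M F \<delta>) (uniform_chain_filter M)"
  unfolding eventually_uniform_chain_filter using assms by (intro exI[of _ F] exI[of _ \<delta>]) simp

text \<open>With no measures to control and tolerance 1, membership says only that the pair is a
  chain from the empty set to the space with at least one step. This suffices for facts that hold
  chain by chain.\<close>

lemma eventually_chain: "eventually (\<lambda>x. x \<in> uniform_chains M {} 1) (uniform_chain_filter M)"
  by (rule eventually_uniform_chains) auto

lemma uniform_chainsD:
  assumes "(n, T) \<in> uniform_chains M F \<delta>"
  shows "1 \<le> real n * \<delta>" "T j \<in> sets M" "T j \<subseteq> T (Suc j)" "T 0 = {}" "T n = space M"
    "\<mu> \<in> F \<Longrightarrow> j < n \<Longrightarrow> \<bar>real n * \<mu> (T (Suc j) - T j) - \<mu> (space M)\<bar> \<le> \<delta>"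
  using assms by (simp_all add: uniform_chains_def)

lemma diagonal_sum_combination:
  "diagonal_sum (\<lambda>E. \<Sum>i\<in>I. c i * \<nu> i E) E x = (\<Sum>i\<in>I. c i * diagonal_sum (\<nu> i) E x)"
  by (cases x) (simp add: diagonal_sum_def sum_subtractf right_diff_distrib sum_distrib_left
    sum.swap[of _ I])

lemma diagonal_sum_add:
  "diagonal_sum (\<lambda>E. \<nu> E + \<eta> E) E x = diagonal_sum \<nu> E x + diagonal_sum \<eta> E x"
  by (cases x) (simp add: diagonal_sum_def sum_subtractf sum.distrib)

lemma diagonal_sum_diff:
  "diagonal_sum (\<lambda>E. \<nu> E - \<eta> E) E x = diagonal_sum \<nu> E x - diagonal_sum \<eta> E x"
  by (cases x) (simp add: diagonal_sum_def sum_subtractf)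

lemma diagonal_sum_scale: "diagonal_sum (\<lambda>E. c * \<nu> E) E x = c * diagonal_sum \<nu> E x"
  by (cases x) (simp add: diagonal_sum_def sum_subtractf sum_distrib_left right_diff_distrib)

text \<open>For a measure the start of a step is irrelevant: the step contributes the measure of its
  part in \<open>E\<close>, and these parts partition \<open>E\<close>.\<close>

lemma diagonal_sum_NA:
  assumes \<nu>: "\<nu> \<in> NA M" and E: "E \<in> sets M" and x: "x \<in> uniform_chains M F \<delta>"
  shows "diagonal_sum \<nu> E x = \<nu> E"
proof -
  obtain n T where nT: "x = (n, T)" by force
  note c = uniform_chainsD[OF x[unfolded nT]]
  have "\<nu> (T j \<union> E \<inter> (T (Suc j) - T j)) - \<nu> (T j) = \<nu> (E \<inter> (T (Suc j) - T j))" for j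
    using c(2) E by (subst NA_Union[OF \<nu>]) auto
  then have "diagonal_sum \<nu> E x = (\<Sum>j<n. \<nu> (E \<inter> (T (Suc j) - T j)))"
    by (simp add: diagonal_sum_def nT)
  also have "\<dots> = \<nu> (\<Union>j<n. E \<inter> (T (Suc j) - T j))"
  proof (rule NA_sum_UN[OF \<nu>])
    show "disjoint_family_on (\<lambda>j. E \<inter> (T (Suc j) - T j)) {..<n}"
      using disjoint_family_Suc[of T, OF c(3)] by (auto simp: disjoint_family_on_def)
  qed (use c(2) E in auto)
  also have "(\<Union>j<n. E \<inter> (T (Suc j) - T j)) = E \<inter> (\<Union>j<n. T (Suc j) - T j)" by blast
  also have "\<dots> = E"
    unfolding UN_chain_differences[of T, OF c(3)] using c(4,5) sets.sets_into_space[OF E] by auto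
  finally show ?thesis .
qed

text \<open>The increments of \<open>\<nu>\<close> are bounded term by term by those of
  \<open>\<mu>\<close>, whose sum is exactly \<open>\<mu> E\<close>. The bound is the same for all
  chains, so a game close to the span in the Lipschitz norm has sums close to those of a game in the
  span.\<close>

lemma diagonal_sum_le_lipschitz_bound:
  assumes \<mu>: "\<mu> \<in> lipschitz_bounds M \<nu>" and E: "E \<in> sets M" and x: "x \<in> uniform_chains M F \<delta>"
  shows "\<bar>diagonal_sum \<nu> E x\<bar> \<le> \<mu> E"
proof -
  obtain n T where nT: "x = (n, T)" by force
  note c = uniform_chainsD[OF x[unfolded nT]]
  have "\<bar>diagonal_sum \<nu> E x\<bar> \<le> (\<Sum>j<n. \<bar>\<nu> (T j \<union> E \<inter> (T (Suc j) - T j)) - \<nu> (T j)\<bar>)"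
    unfolding nT diagonal_sum_def prod.case by (rule sum_abs)
  also have "\<dots> \<le> (\<Sum>j<n. \<mu> (T j \<union> E \<inter> (T (Suc j) - T j)) - \<mu> (T j))"
    using c(2) E by (intro sum_mono lipschitz_boundsD(2)[OF \<mu>]) auto
  also have "\<dots> = diagonal_sum \<mu> E x" by (simp add: diagonal_sum_def nT)
  also have "\<dots> = \<mu> E"
    by (rule diagonal_sum_NA[OF NA_plusD(1)[OF lipschitz_boundsD(1)[OF \<mu>]] E x])
  finally show ?thesis .
qed

text \<open>Each step changes \<open>a \<^sup>r\<close> by about \<open>r a\<^sup>r\<^sup>-\<^sup>1 d\<close> and its part in \<open>E\<close> by about
  \<open>r a\<^sup>r\<^sup>-\<^sup>1 \<mu>(E) d\<close>, so the sum is \<open>\<mu>(E)\<close> times a telescoping sum with value \<open>1\<close>.\<close>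

lemma diagonal_sum_power_tendsto:
  assumes \<mu>: "\<mu> \<in> NA_prob M" and r: "1 \<le> r" and E: "E \<in> sets M"
  shows "((\<lambda>x. diagonal_sum (\<lambda>A. \<mu> A ^ r) E x) \<longlongrightarrow> \<mu> E) (uniform_chain_filter M)"
proof (rule tendstoI)
  fix \<epsilon> :: real assume \<epsilon>: "0 < \<epsilon>"
  note p = NA_probD(1)[OF \<mu>]
  \<comment> \<open>The linear parts give \<open>2 * real r\<close>: a slope of at most
    \<open>r\<close> times two deviations of at most \<open>\<delta>\<close>. The two quadratic
    remainders give \<open>8 * (real r) ^ 2\<close>, through the bound \<open>4 * \<delta>\<close>
    for \<open>real n * (d j) ^ 2\<close>. Taking \<open>\<delta>\<close> at most 1 ensures that
    \<open>real n * d j\<close> is at most 2.\<close>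
  define K where "K = 2 * real r + 8 * (real r)\<^sup>2"
  define \<delta> where "\<delta> = min 1 (\<epsilon> / (2 * K))"
  have K: "0 < K" using r by (simp add: K_def add_pos_nonneg)
  have \<delta>: "0 < \<delta>" "\<delta> \<le> 1" "K * \<delta> < \<epsilon>"
  proof -
    show "0 < \<delta>" "\<delta> \<le> 1" using K \<epsilon> by (auto simp: \<delta>_def)
    have "K * \<delta> \<le> K * (\<epsilon> / (2 * K))" using K by (intro mult_left_mono) (auto simp: \<delta>_def)
    also have "\<dots> = \<epsilon> / 2" using K by simp
    finally show "K * \<delta> < \<epsilon>" using \<epsilon> by simp
  qed
  \<comment> \<open>Controlling the restriction of \<open>\<mu>\<close> to \<open>E\<close> as well
    forces each step to carry nearly the share \<open>1 / n\<close> of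
    \<open>\<mu> E\<close>.\<close>
  define \<mu>E where "\<mu>E = (\<lambda>A. if A \<in> sets M then \<mu> (A \<inter> E) else 0)"
  have "\<mu>E \<in> NA_plus M" unfolding \<mu>E_def by (rule NA_plus_restrict[OF p E])
  then have ev: "eventually (\<lambda>x. x \<in> uniform_chains M {\<mu>, \<mu>E} \<delta>) (uniform_chain_filter M)"
    using p \<delta> by (intro eventually_uniform_chains) auto
  define e where "e = \<mu> E"
  have e: "0 \<le> e" "e \<le> 1" using NA_plusD(4)[OF p] NA_probD(3)[OF \<mu> E] by (auto simp: e_def)
  have "dist (diagonal_sum (\<lambda>A. \<mu> A ^ r) E x) e < \<epsilon>" if x: "x \<in> uniform_chains M {\<mu>, \<mu>E} \<delta>" for x
  proof -
    obtain n T where nT: "x = (n, T)" by force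
    note c = uniform_chainsD[OF x[unfolded nT]]
    have n: "0 < n" using c(1) by (cases "n = 0") auto
    define a where "a = (\<lambda>j. \<mu> (T j))"
    define b where "b = (\<lambda>j. \<mu> (E \<inter> (T (Suc j) - T j)))"
    define d where "d = (\<lambda>j. \<mu> (T (Suc j) - T j))"
    have ad: "a (Suc j) = a j + d j" for j
      using NA_plus_Diff[OF p c(3,2,2)] by (simp add: a_def d_def)
    have ab: "\<mu> (T j \<union> E \<inter> (T (Suc j) - T j)) = a j + b j" for j
      unfolding a_def b_def using c(2) E by (intro NA_Union[OF NA_plusD(1)[OF p]]) auto
    have step: "\<bar>((a j + b j) ^ r - a j ^ r) - e * (a (Suc j) ^ r - a j ^ r)\<bar> \<le> K * \<delta> / n"
      if j: "j < n" for j
    proof -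
      have "b j \<le> d j"
        unfolding b_def d_def using c(2) by (intro NA_plus_mono[OF p]) auto
      moreover have "0 \<le> a j" "0 \<le> b j" by (simp_all add: a_def b_def NA_plusD(4)[OF p])
      moreover have "a j + d j \<le> 1" unfolding ad[symmetric] unfolding a_def using c(2) by (rule NA_probD(3)[OF \<mu>])
      ultimately have abd: "0 \<le> a j" "0 \<le> b j" "b j \<le> d j" "a j + d j \<le> 1" "a j + b j \<le> 1" "a j \<le> 1"
        by auto
      define f where "f = (\<lambda>y. (a j + y) ^ r - a j ^ r - r * a j ^ (r - 1) * y)"
      have f: "0 \<le> f (b j)" "f (b j) \<le> (real r)\<^sup>2 * (b j)\<^sup>2" "0 \<le> f (d j)" "f (d j) \<le> (real r)\<^sup>2 * (d j)\<^sup>2"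
        unfolding f_def using abd power_le_tangent[of "a j" "b j" r] power_le_tangent[of "a j" "d j" r] by auto
      have nd: "\<bar>real n * d j - 1\<bar> \<le> \<delta>"
        using c(6)[OF _ j, of \<mu>] NA_probD(2)[OF \<mu>] by (simp add: d_def)
      have "\<mu>E (T (Suc j) - T j) = b j" "\<mu>E (space M) = e"
        using c(2) sets.sets_into_space[OF E] by (auto simp: \<mu>E_def b_def e_def Int_commute Int_absorb1 Int_absorb2)
      then have nb: "\<bar>real n * b j - e\<bar> \<le> \<delta>" using c(6)[OF _ j, of \<mu>E] by simp
      have "real n * d j \<le> 2" using nd \<delta>(2) by linarith
      have "real n * (d j)\<^sup>2 = (real n * d j) * d j" by (simp add: power2_eq_square)
      also have "\<dots> \<le> 2 * d j" using \<open>real n * d j \<le> 2\<close> abd by (intro mult_right_mono) auto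
      also have "\<dots> \<le> 2 * (2 * \<delta>)"
      proof -
        \<comment> \<open>Here \<open>1 \<le> real n * \<delta>\<close> enters: many steps make a
          single step small, so that the quadratic errors vanish even after multiplication by
          \<open>n\<close>.\<close>
        have "d j \<le> (real n * \<delta>) * d j" using c(1) abd by (simp add: mult_le_cancel_right1)
        also have "\<dots> = \<delta> * (real n * d j)" by simp
        also have "\<dots> \<le> \<delta> * 2" using \<open>real n * d j \<le> 2\<close> \<delta> by (intro mult_left_mono) auto
        finally show ?thesis by simp
      qed
      finally have nd2: "real n * (d j)\<^sup>2 \<le> 4 * \<delta>" by simp
      have "(b j)\<^sup>2 \<le> (d j)\<^sup>2" using abd by (intro power_mono) auto
      then have "f (b j) \<le> (real r)\<^sup>2 * (d j)\<^sup>2" using f(2) mult_left_mono[of "(b j)\<^sup>2" "(d j)\<^sup>2" "(real r)\<^sup>2"] by simp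
      moreover have "e * f (d j) \<le> f (d j)" "0 \<le> e * f (d j)" using e f(3) by (auto simp: mult_left_le_one_le)
      ultimately have "\<bar>f (b j) - e * f (d j)\<bar> \<le> 2 * ((real r)\<^sup>2 * (d j)\<^sup>2)" using f by (auto simp: abs_le_iff)
      then have "real n * \<bar>f (b j) - e * f (d j)\<bar> \<le> real n * (2 * ((real r)\<^sup>2 * (d j)\<^sup>2))"
        by (intro mult_left_mono) auto
      also have "\<dots> = 2 * (real r)\<^sup>2 * (real n * (d j)\<^sup>2)" by simp
      also have "\<dots> \<le> 2 * (real r)\<^sup>2 * (4 * \<delta>)" using nd2 by (intro mult_left_mono) auto
      finally have quad: "real n * \<bar>f (b j) - e * f (d j)\<bar> \<le> 8 * (real r)\<^sup>2 * \<delta>" by simp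
      have "\<bar>e * (real n * d j - 1)\<bar> \<le> 1 * \<delta>" unfolding abs_mult using e nd by (intro mult_mono) auto
      then have "\<bar>real n * b j - e * (real n * d j)\<bar> \<le> 2 * \<delta>" using nb by (simp add: right_diff_distrib)
      moreover have "\<bar>r * a j ^ (r - 1)\<bar> \<le> r"
        using abd power_le_one[of "a j" "r - 1"] by (simp add: abs_mult mult_left_le)
      ultimately have "\<bar>r * a j ^ (r - 1)\<bar> * \<bar>real n * b j - e * (real n * d j)\<bar> \<le> r * (2 * \<delta>)"
        by (intro mult_mono) auto
      then have lin: "\<bar>r * a j ^ (r - 1) * (real n * b j - e * (real n * d j))\<bar> \<le> 2 * r * \<delta>"
        by (simp add: abs_mult)
      have "real n * (((a j + b j) ^ r - a j ^ r) - e * (a (Suc j) ^ r - a j ^ r)) =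
          real n * (f (b j) - e * f (d j)) + r * a j ^ (r - 1) * (real n * b j - e * (real n * d j))"
        by (simp add: f_def ad algebra_simps)
      also have "\<bar>\<dots>\<bar> \<le> real n * \<bar>f (b j) - e * f (d j)\<bar> + 2 * r * \<delta>"
        using lin by (intro order_trans[OF abs_triangle_ineq] add_mono) (auto simp: abs_mult)
      also have "\<dots> \<le> K * \<delta>" using quad by (simp add: K_def algebra_simps)
      finally have "real n * \<bar>((a j + b j) ^ r - a j ^ r) - e * (a (Suc j) ^ r - a j ^ r)\<bar> \<le> K * \<delta>"
        by (simp only: abs_mult abs_of_nat)
      then show ?thesis using n by (simp only: pos_le_divide_eq of_nat_0_less_iff mult.commute)
    qed
    have "(\<Sum>j<n. a (Suc j) ^ r - a j ^ r) = a n ^ r - a 0 ^ r"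
      by (rule sum_lessThan_telescope)
    also have "\<dots> = 1"
      using c(4,5) r NA_plusD(2)[OF p] NA_probD(2)[OF \<mu>] by (simp add: a_def power_0_left)
    finally have "(\<Sum>j<n. a (Suc j) ^ r - a j ^ r) = 1" .
    moreover have aT: "\<mu> (T j) = a j" for j by (simp add: a_def)
    ultimately have "diagonal_sum (\<lambda>A. \<mu> A ^ r) E x - e =
        (\<Sum>j<n. ((a j + b j) ^ r - a j ^ r) - e * (a (Suc j) ^ r - a j ^ r))"
      by (simp add: diagonal_sum_def nT ab aT sum_subtractf sum_distrib_left[symmetric])
    also have "\<bar>\<dots>\<bar> \<le> (\<Sum>j<n. K * \<delta> / n)"
      using step by (intro order_trans[OF sum_abs] sum_mono) auto
    also have "\<dots> = K * \<delta>" using n by simp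
    finally show ?thesis using \<delta>(3) by (simp add: dist_real_def)
  qed
  with ev show "eventually (\<lambda>x. dist (diagonal_sum (\<lambda>A. \<mu> A ^ r) E x) (\<mu> E) < \<epsilon>) (uniform_chain_filter M)"
    unfolding e_def by (rule eventually_mono)
qed

text \<open>The function \<open>l\<close> is the expected value of a nearby game in the span; half
  of \<open>\<epsilon>\<close> pays for the distance to that game, half for convergence there. It
  depends on \<open>\<epsilon>\<close> and on the chosen representation, but it is additive and
  serves all \<open>E\<close> at once, so it yields both convergence and additivity of the
  limit.\<close>

lemma diagonal_sum_approx:
  assumes \<nu>: "\<nu> \<in> pNA_inf M" and "0 < \<epsilon>"
  obtains l :: "'a set \<Rightarrow> real" where
    "\<forall>A\<in>sets M. \<forall>B\<in>sets M. A \<inter> B = {} \<longrightarrow> l (A \<union> B) = l A + l B"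
    "\<forall>E\<in>sets M. eventually (\<lambda>x. \<bar>diagonal_sum \<nu> E x - l E\<bar> < \<epsilon>) (uniform_chain_filter M)"
proof -
  have "0 < \<epsilon> / 2" using assms(2) by simp
  then obtain \<eta> \<kappa> where \<eta>: "\<eta> \<in> power_span M" and \<kappa>: "\<kappa> \<in> lipschitz_bounds M (\<lambda>E. \<nu> E - \<eta> E)"
    "\<kappa> (space M) < \<epsilon> / 2"
    by (rule pNA_inf_approx[OF \<nu>])
  obtain n :: nat and c \<mu> r where \<eta>_eq: "\<eta> = (\<lambda>E. \<Sum>i<n. c i * \<mu> i E ^ r i)"
    and P: "\<forall>i<n. \<mu> i \<in> NA_prob M \<and> 1 \<le> r i"
    using \<eta> by (rule power_spanE)
  define l where "l = (\<lambda>E. \<Sum>i<n. c i * \<mu> i E)"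
  show ?thesis
  proof (rule that[of l]; intro ballI impI)
    fix A B assume "A \<in> sets M" "B \<in> sets M" "A \<inter> B = {}"
    then have "\<mu> i (A \<union> B) = \<mu> i A + \<mu> i B" if "i < n" for i
      using P that NA_Union[OF NA_plusD(1)[OF NA_probD(1)]] by blast
    then show "l (A \<union> B) = l A + l B" by (simp add: l_def distrib_left sum.distrib)
  next
    fix E assume E: "E \<in> sets M"
    have "((\<lambda>x. \<Sum>i<n. c i * diagonal_sum (\<lambda>A. \<mu> i A ^ r i) E x) \<longlongrightarrow> (\<Sum>i<n. c i * \<mu> i E))
        (uniform_chain_filter M)"
      using P E by (intro tendsto_sum tendsto_mult tendsto_const diagonal_sum_power_tendsto) auto
    then have "(diagonal_sum \<eta> E \<longlongrightarrow> l E) (uniform_chain_filter M)"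
      by (simp add: \<eta>_eq l_def diagonal_sum_combination[abs_def])
    from tendstoD[OF this \<open>0 < \<epsilon> / 2\<close>]
    have "eventually (\<lambda>x. \<bar>diagonal_sum \<eta> E x - l E\<bar> < \<epsilon> / 2) (uniform_chain_filter M)"
      by (simp only: dist_real_def)
    with eventually_chain
    show "eventually (\<lambda>x. \<bar>diagonal_sum \<nu> E x - l E\<bar> < \<epsilon>) (uniform_chain_filter M)"
    proof eventually_elim
      case (elim x)
      have "\<kappa> E \<le> \<kappa> (space M)"
        using sets.sets_into_space[OF E] by (intro NA_plus_mono[OF lipschitz_boundsD(1)[OF \<kappa>(1)]]) auto
      moreover have "\<bar>diagonal_sum \<nu> E x - diagonal_sum \<eta> E x\<bar> \<le> \<kappa> E"
        using diagonal_sum_le_lipschitz_bound[OF \<kappa>(1) E elim(1)] by (simp add: diagonal_sum_diff)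
      ultimately show ?case using elim(2) \<kappa>(2) by linarith
    qed
  qed
qed

text \<open>Since the filter is proper, two approximating constants are both close to a common value
  \<open>f x\<close>, hence to each other. They form a Cauchy sequence, whose limit is the limit of
  \<open>f\<close>.\<close>

lemma real_filter_convergent:
  fixes f :: "'b \<Rightarrow> real"
  assumes "F \<noteq> bot" and approx: "\<And>\<epsilon>. 0 < \<epsilon> \<Longrightarrow> \<exists>l. eventually (\<lambda>x. \<bar>f x - l\<bar> < \<epsilon>) F"
  shows "\<exists>L. (f \<longlongrightarrow> L) F"
proof -
  have "\<exists>l. eventually (\<lambda>x. \<bar>f x - l\<bar> < inverse (Suc k)) F" for k by (rule approx) simp
  then obtain l where l: "\<And>k. eventually (\<lambda>x. \<bar>f x - l k\<bar> < inverse (Suc k)) F" by metis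
  have close: "\<bar>l j - l k\<bar> < inverse (Suc j) + inverse (Suc k)" for j k
  proof -
    have "eventually (\<lambda>x. \<bar>f x - l j\<bar> < inverse (Suc j) \<and> \<bar>f x - l k\<bar> < inverse (Suc k)) F"
      using l by (intro eventually_conj)
    then obtain x where "\<bar>f x - l j\<bar> < inverse (Suc j)" "\<bar>f x - l k\<bar> < inverse (Suc k)"
      using eventually_happens'[OF assms(1)] by blast
    then show ?thesis by linarith
  qed
  have small: "\<exists>N. \<forall>k\<ge>N. inverse (real (Suc k)) < \<epsilon>" if "0 < \<epsilon>" for \<epsilon>
    using order_tendstoD(2)[OF LIMSEQ_inverse_real_of_nat that] by (simp add: eventually_sequentially)
  have "Cauchy l"
  proof (rule metric_CauchyI)
    fix \<epsilon> :: real assume "0 < \<epsilon>"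
    then obtain N where N: "\<And>k. N \<le> k \<Longrightarrow> inverse (real (Suc k)) < \<epsilon> / 2" using small[of "\<epsilon> / 2"] by auto
    have "dist (l j) (l k) < \<epsilon>" if "N \<le> j" "N \<le> k" for j k
      using close[of j k] N[OF that(1)] N[OF that(2)] by (simp add: dist_real_def)
    then show "\<exists>N. \<forall>j\<ge>N. \<forall>k\<ge>N. dist (l j) (l k) < \<epsilon>" by blast
  qed
  then obtain L where L: "l \<longlonglongrightarrow> L" using real_Cauchy_convergent convergent_def by blast
  have "(f \<longlongrightarrow> L) F"
  proof (rule tendstoI)
    fix \<epsilon> :: real assume \<epsilon>: "0 < \<epsilon>"
    obtain N where N: "\<And>k. N \<le> k \<Longrightarrow> inverse (real (Suc k)) < \<epsilon> / 2" using small[of "\<epsilon> / 2"] \<epsilon> by auto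
    obtain N' where N': "\<And>k. N' \<le> k \<Longrightarrow> dist (l k) L < \<epsilon> / 2" using metric_LIMSEQ_D[OF L, of "\<epsilon> / 2"] \<epsilon> by auto
    have "inverse (real (Suc (max N N'))) < \<epsilon> / 2" "\<bar>l (max N N') - L\<bar> < \<epsilon> / 2"
      using N[of "max N N'"] N'[of "max N N'"] by (auto simp: dist_real_def)
    then have "\<bar>y - L\<bar> < \<epsilon>" if "\<bar>y - l (max N N')\<bar> < inverse (Suc (max N N'))" for y
      using that by linarith
    then show "eventually (\<lambda>x. dist (f x) L < \<epsilon>) F"
      using eventually_mono[OF l[of "max N N'"]] by (simp only: dist_real_def)
  qed
  then show ?thesis by blast
qed

lemma diagonal_value_tendsto:
  assumes \<nu>: "\<nu> \<in> pNA_inf M" and E: "E \<in> sets M"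
  shows "(diagonal_sum \<nu> E \<longlongrightarrow> diagonal_value M \<nu> E) (uniform_chain_filter M)"
proof -
  have "\<exists>L. (diagonal_sum \<nu> E \<longlongrightarrow> L) (uniform_chain_filter M)"
  proof (rule real_filter_convergent[OF uniform_chain_filter_neq_bot])
    fix \<epsilon> :: real assume "0 < \<epsilon>"
    then show "\<exists>l. eventually (\<lambda>x. \<bar>diagonal_sum \<nu> E x - l\<bar> < \<epsilon>) (uniform_chain_filter M)"
      using diagonal_sum_approx[OF \<nu>, of \<epsilon>] E by metis
  qed
  then obtain L where L: "(diagonal_sum \<nu> E \<longlongrightarrow> L) (uniform_chain_filter M)" ..
  then have "diagonal_value M \<nu> E = L"
    using tendsto_Lim[OF uniform_chain_filter_neq_bot] E by (simp add: diagonal_value_def)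
  then show ?thesis using L by simp
qed

lemma diagonal_value_eqI:
  assumes "\<nu> \<in> pNA_inf M" "E \<in> sets M" "(diagonal_sum \<nu> E \<longlongrightarrow> L) (uniform_chain_filter M)"
  shows "diagonal_value M \<nu> E = L"
  using tendsto_unique[OF uniform_chain_filter_neq_bot diagonal_value_tendsto[OF assms(1,2)] assms(3)] .

text \<open>The sums of a fixed chain need not be additive in the coalition. The limit is within
  \<open>\<epsilon> / 3\<close> of an additive \<open>l\<close> at each of the three sets
  involved.\<close>

lemma diagonal_value_additive:
  assumes \<nu>: "\<nu> \<in> pNA_inf M" and AB: "A \<in> sets M" "B \<in> sets M" "A \<inter> B = {}"
  shows "diagonal_value M \<nu> (A \<union> B) = diagonal_value M \<nu> A + diagonal_value M \<nu> B"
proof -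
  let ?\<psi> = "diagonal_value M \<nu>"
  have "\<bar>?\<psi> (A \<union> B) - (?\<psi> A + ?\<psi> B)\<bar> \<le> 0 + \<epsilon>" if "0 < \<epsilon>" for \<epsilon> :: real
  proof -
    have "0 < \<epsilon> / 3" using that by simp
    then obtain l where l: "\<forall>A\<in>sets M. \<forall>B\<in>sets M. A \<inter> B = {} \<longrightarrow> l (A \<union> B) = l A + l B"
      "\<forall>E\<in>sets M. eventually (\<lambda>x. \<bar>diagonal_sum \<nu> E x - l E\<bar> < \<epsilon> / 3) (uniform_chain_filter M)"
      by (rule diagonal_sum_approx[OF \<nu>])
    have "\<bar>?\<psi> E - l E\<bar> \<le> \<epsilon> / 3" if E: "E \<in> sets M" for E
    proof (rule tendsto_upperbound[OF _ _ uniform_chain_filter_neq_bot])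
      show "((\<lambda>x. \<bar>diagonal_sum \<nu> E x - l E\<bar>) \<longlongrightarrow> \<bar>?\<psi> E - l E\<bar>) (uniform_chain_filter M)"
        by (intro tendsto_intros diagonal_value_tendsto[OF \<nu> E])
      show "eventually (\<lambda>x. \<bar>diagonal_sum \<nu> E x - l E\<bar> \<le> \<epsilon> / 3) (uniform_chain_filter M)"
        using bspec[OF l(2) E] by (rule eventually_mono) simp
    qed
    from this[OF AB(1)] this[OF AB(2)] this[OF sets.Un[OF AB(1,2)]] l(1)[rule_format, OF AB]
    show ?thesis by linarith
  qed
  then have "\<bar>?\<psi> (A \<union> B) - (?\<psi> A + ?\<psi> B)\<bar> \<le> 0" by (rule field_le_epsilon)
  then show ?thesis by simp
qed

lemma diagonal_value_in_NA:
  assumes \<nu>: "\<nu> \<in> pNA_inf M"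
  shows "diagonal_value M \<nu> \<in> NA M"
proof -
  obtain \<mu> where \<mu>: "\<mu> \<in> lipschitz_bounds M \<nu>" using \<nu> by (auto simp: pNA_inf_iff)
  have dom: "\<bar>diagonal_value M \<nu> E\<bar> \<le> \<mu> E" if E: "E \<in> sets M" for E
  proof (rule tendsto_upperbound[OF _ _ uniform_chain_filter_neq_bot])
    show "((\<lambda>x. \<bar>diagonal_sum \<nu> E x\<bar>) \<longlongrightarrow> \<bar>diagonal_value M \<nu> E\<bar>) (uniform_chain_filter M)"
      by (intro tendsto_intros diagonal_value_tendsto[OF \<nu> E])
    show "eventually (\<lambda>x. \<bar>diagonal_sum \<nu> E x\<bar> \<le> \<mu> E) (uniform_chain_filter M)"
      using eventually_chain by (rule eventually_mono) (rule diagonal_sum_le_lipschitz_bound[OF \<mu> E])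
  qed
  have "diagonal_value M \<nu> {} = 0"
    using dom[of "{}"] NA_plusD(2)[OF lipschitz_boundsD(1)[OF \<mu>]] by simp
  then have "diagonal_value M \<nu> \<in> games M" by (simp add: games_def diagonal_value_def)
  then show ?thesis
    using dominated_additive_in_NA[OF _ lipschitz_boundsD(1)[OF \<mu>] dom diagonal_value_additive[OF \<nu>]]
    by blast
qed

text \<open>The image chain is uniform for \<open>F\<close> as soon as the chain is uniform for the
  transported measures, and these again form a finite subset of \<open>NA_plus M\<close>.\<close>

lemma filterlim_image_uniform_chain_filter:
  assumes \<theta>: "\<theta> \<in> automorphisms M"
  shows "filterlim (\<lambda>(n, T). (n, \<lambda>j. \<theta> ` T j)) (uniform_chain_filter M) (uniform_chain_filter M)"
  unfolding filterlim_iff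
proof (intro allI impI)
  fix P assume "eventually P (uniform_chain_filter M)"
  then obtain F \<delta> where F: "finite F" "F \<subseteq> NA_plus M" "0 < \<delta>" "\<forall>x\<in>uniform_chains M F \<delta>. P x"
    unfolding eventually_uniform_chain_filter by (elim exE conjE)
  have "eventually (\<lambda>x. x \<in> uniform_chains M (transport M \<theta> ` F) \<delta>) (uniform_chain_filter M)"
    using F transport_NA_plus[OF \<theta>] by (intro eventually_uniform_chains) auto
  then show "eventually (\<lambda>x. P (case x of (n, T) \<Rightarrow> (n, \<lambda>j. \<theta> ` T j))) (uniform_chain_filter M)"
  proof (rule eventually_mono)
    fix x assume x: "x \<in> uniform_chains M (transport M \<theta> ` F) \<delta>"
    obtain n T where nT: "x = (n, T)" by force
    note c = uniform_chainsD[OF x[unfolded nT]]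
    have "\<bar>real n * \<mu> (\<theta> ` T (Suc j) - \<theta> ` T j) - \<mu> (space M)\<bar> \<le> \<delta>" if "\<mu> \<in> F" "j < n" for \<mu> j
      using c(6)[OF imageI[OF that(1)] that(2)] c(2)
      by (simp add: transport_space[OF \<theta>] automorphism_image_Diff[OF \<theta>]) (simp add: transport_def automorphism_image_Diff[OF \<theta>])
    then have "(n, \<lambda>j. \<theta> ` T j) \<in> uniform_chains M F \<delta>"
      using c(1-5) automorphismD(2,3)[OF \<theta>] by (simp add: uniform_chains_def image_mono)
    then show "P (case x of (n, T) \<Rightarrow> (n, \<lambda>j. \<theta> ` T j))" using F(4) nT by simp
  qed
qed

text \<open>The transported game on a chain has the same sum for \<open>E\<close> as the original
  game on the image chain has for the image of \<open>E\<close>; taking images of chains preserves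
  the filter limit.\<close>

lemma diagonal_value_transport:
  assumes \<theta>: "\<theta> \<in> automorphisms M" and \<nu>: "\<nu> \<in> pNA_inf M"
  shows "transport M \<theta> (diagonal_value M \<nu>) = diagonal_value M (transport M \<theta> \<nu>)"
proof
  fix E
  show "transport M \<theta> (diagonal_value M \<nu>) E = diagonal_value M (transport M \<theta> \<nu>) E"
  proof (cases "E \<in> sets M")
    case E: True
    have "((\<lambda>x. diagonal_sum \<nu> (\<theta> ` E) (case x of (n, T) \<Rightarrow> (n, \<lambda>j. \<theta> ` T j))) \<longlongrightarrow>
        diagonal_value M \<nu> (\<theta> ` E)) (uniform_chain_filter M)"
      by (rule filterlim_compose[OF diagonal_value_tendsto[OF \<nu> automorphismD(3)[OF \<theta> E]]
        filterlim_image_uniform_chain_filter[OF \<theta>]])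
    moreover have "eventually (\<lambda>x. diagonal_sum \<nu> (\<theta> ` E) (case x of (n, T) \<Rightarrow> (n, \<lambda>j. \<theta> ` T j)) =
        diagonal_sum (transport M \<theta> \<nu>) E x) (uniform_chain_filter M)"
      using eventually_chain
    proof (rule eventually_mono)
      fix x assume x: "x \<in> uniform_chains M {} 1"
      obtain n T where nT: "x = (n, T)" by force
      note c = uniform_chainsD[OF x[unfolded nT]]
      have "\<theta> ` (T j \<union> E \<inter> (T (Suc j) - T j)) = \<theta> ` T j \<union> \<theta> ` E \<inter> (\<theta> ` T (Suc j) - \<theta> ` T j)" for j
        using automorphism_image_Int[OF \<theta> E, of "T (Suc j) - T j"]
          automorphism_image_Diff[OF \<theta>, of "T (Suc j)" "T j"] c(2) by (simp add: image_Un)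
      then show "diagonal_sum \<nu> (\<theta> ` E) (case x of (n, T) \<Rightarrow> (n, \<lambda>j. \<theta> ` T j)) =
          diagonal_sum (transport M \<theta> \<nu>) E x"
        using c(2) E by (simp add: diagonal_sum_def nT transport_def)
    qed
    ultimately have "(diagonal_sum (transport M \<theta> \<nu>) E \<longlongrightarrow> diagonal_value M \<nu> (\<theta> ` E)) (uniform_chain_filter M)"
      by (rule Lim_transform_eventually)
    then show ?thesis
      using diagonal_value_eqI[OF transport_pNA_inf[OF \<theta> \<nu>] E] E by (simp add: transport_def)
  qed (simp add: transport_def diagonal_value_def)
qed

theorem is_value_diagonal_value: "is_value M (pNA_inf M) (diagonal_value M)"
  unfolding is_value_def
proof (intro conjI ballI allI impI)
  show "symmetric_subspace M (pNA_inf M)" by (rule symmetric_subspace_pNA_inf)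
  fix \<nu> assume \<nu>: "\<nu> \<in> pNA_inf M"
  show "diagonal_value M \<nu> \<in> NA M" by (rule diagonal_value_in_NA[OF \<nu>])
  show "diagonal_value M (\<lambda>E. c * \<nu> E) = (\<lambda>E. c * diagonal_value M \<nu> E)" for c
  proof
    fix E show "diagonal_value M (\<lambda>E. c * \<nu> E) E = c * diagonal_value M \<nu> E"
    proof (cases "E \<in> sets M")
      case E: True
      have "((\<lambda>x. c * diagonal_sum \<nu> E x) \<longlongrightarrow> c * diagonal_value M \<nu> E) (uniform_chain_filter M)"
        by (intro tendsto_intros diagonal_value_tendsto[OF \<nu> E])
      then show ?thesis
        by (intro diagonal_value_eqI pNA_inf_scale \<nu> E) (simp add: diagonal_sum_scale[abs_def])
    qed (simp add: diagonal_value_def)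
  qed
  show "diagonal_value M (\<lambda>E. \<nu> E + \<eta> E) = (\<lambda>E. diagonal_value M \<nu> E + diagonal_value M \<eta> E)"
    if \<eta>: "\<eta> \<in> pNA_inf M" for \<eta>
  proof
    fix E show "diagonal_value M (\<lambda>E. \<nu> E + \<eta> E) E = diagonal_value M \<nu> E + diagonal_value M \<eta> E"
    proof (cases "E \<in> sets M")
      case E: True
      have "((\<lambda>x. diagonal_sum \<nu> E x + diagonal_sum \<eta> E x) \<longlongrightarrow>
          diagonal_value M \<nu> E + diagonal_value M \<eta> E) (uniform_chain_filter M)"
        by (intro tendsto_intros diagonal_value_tendsto[OF \<nu> E] diagonal_value_tendsto[OF \<eta> E])
      then show ?thesis
        by (intro diagonal_value_eqI pNA_inf_add \<nu> \<eta> E) (simp add: diagonal_sum_add[abs_def])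
    qed (simp add: diagonal_value_def)
  qed
  show "transport M \<theta> (diagonal_value M \<nu>) = diagonal_value M (transport M \<theta> \<nu>)"
    if "\<theta> \<in> automorphisms M" for \<theta>
    by (rule diagonal_value_transport[OF that \<nu>])
  show "0 \<le> diagonal_value M \<nu> E" if mono: "monotone_game M \<nu>" and E: "E \<in> sets M" for E
  proof (rule tendsto_lowerbound[OF diagonal_value_tendsto[OF \<nu> E] _ uniform_chain_filter_neq_bot])
    show "eventually (\<lambda>x. 0 \<le> diagonal_sum \<nu> E x) (uniform_chain_filter M)"
      using eventually_chain
    proof (rule eventually_mono)
      fix x assume x: "x \<in> uniform_chains M {} 1"
      obtain n T where nT: "x = (n, T)" by force
      note c = uniform_chainsD[OF x[unfolded nT]]
      have "\<nu> (T j) \<le> \<nu> (T j \<union> E \<inter> (T (Suc j) - T j))" for j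
        using mono c(2) E unfolding monotone_game_def by simp
      then show "0 \<le> diagonal_sum \<nu> E x" by (simp add: diagonal_sum_def nT sum_nonneg)
    qed
  qed
  show "diagonal_value M \<nu> (space M) = \<nu> (space M)"
  proof (rule diagonal_value_eqI[OF \<nu> sets.top], rule tendsto_eventually)
    show "eventually (\<lambda>x. diagonal_sum \<nu> (space M) x = \<nu> (space M)) (uniform_chain_filter M)"
      using eventually_chain
    proof (rule eventually_mono)
      fix x assume x: "x \<in> uniform_chains M {} 1"
      obtain n T where nT: "x = (n, T)" by force
      note c = uniform_chainsD[OF x[unfolded nT]]
      have "T j \<union> space M \<inter> (T (Suc j) - T j) = T (Suc j)" for j
        using c(3)[of j] sets.sets_into_space[OF c(2)] by blast
      then have "diagonal_sum \<nu> (space M) x = (\<Sum>j<n. \<nu> (T (Suc j)) - \<nu> (T j))"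
        by (simp add: diagonal_sum_def nT)
      also have "\<dots> = \<nu> (space M) - \<nu> {}" using c(4,5) by (simp add: sum_lessThan_telescope[of "\<lambda>j. \<nu> (T j)"])
      finally show "diagonal_sum \<nu> (space M) x = \<nu> (space M)"
        using \<nu> by (simp add: pNA_inf_iff games_def)
    qed
  qed
next
  fix \<nu> assume \<nu>: "\<nu> \<in> pNA_inf M \<inter> NA M"
  show "diagonal_value M \<nu> = \<nu>"
  proof
    fix E show "diagonal_value M \<nu> E = \<nu> E"
    proof (cases "E \<in> sets M")
      case True
      have "eventually (\<lambda>x. diagonal_sum \<nu> E x = \<nu> E) (uniform_chain_filter M)"
        using eventually_chain by (rule eventually_mono) (rule diagonal_sum_NA, use \<nu> True in auto)
      then show ?thesis
        using \<nu> True by (intro diagonal_value_eqI tendsto_eventually) auto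
    next
      case False
      then show ?thesis using \<nu> by (simp add: diagonal_value_def NA_def games_def)
    qed
  qed
qed

section \<open>The Burkill-Cesari integral as a value\<close>

lemma mesh_less_iff:
  assumes "finite D" "0 < \<delta>"
  shows "mesh \<rho> D < \<delta> \<longleftrightarrow> (\<forall>I\<in>D. \<rho> I < \<delta>)"
  using assms by (simp add: mesh_def)

lemma has_BC_limit_unique:
  assumes "\<rho> \<in> NA_plus M" "E \<in> sets M" "has_BC_limit M \<rho> \<nu> E L" "has_BC_limit M \<rho> \<nu> E L'"
  shows "L = L'"
proof (rule ccontr)
  assume "L \<noteq> L'"
  define \<epsilon> where "\<epsilon> = \<bar>L - L'\<bar> / 2"
  have \<epsilon>: "0 < \<epsilon>" using \<open>L \<noteq> L'\<close> by (simp add: \<epsilon>_def)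
  obtain \<delta> where \<delta>: "0 < \<delta>"
    "\<forall>D\<in>fin_partitions M E. mesh \<rho> D < \<delta> \<longrightarrow> \<bar>(\<Sum>I\<in>D. \<nu> I) - L\<bar> < \<epsilon>"
    using assms(3) \<epsilon> unfolding has_BC_limit_def by blast
  obtain \<delta>' where \<delta>': "0 < \<delta>'"
    "\<forall>D\<in>fin_partitions M E. mesh \<rho> D < \<delta>' \<longrightarrow> \<bar>(\<Sum>I\<in>D. \<nu> I) - L'\<bar> < \<epsilon>"
    using assms(4) \<epsilon> unfolding has_BC_limit_def by blast
  obtain D where D: "D \<in> fin_partitions M E" "mesh \<rho> D < min \<delta> \<delta>'"
    using fine_partition_exists[OF assms(1,2), of "min \<delta> \<delta>'"] \<delta>(1) \<delta>'(1) by auto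
  then have "\<bar>(\<Sum>I\<in>D. \<nu> I) - L\<bar> < \<epsilon>" "\<bar>(\<Sum>I\<in>D. \<nu> I) - L'\<bar> < \<epsilon>"
    using \<delta>(2) \<delta>'(2) by auto
  then have "\<bar>L - L'\<bar> < 2 * \<epsilon>" by linarith
  then show False by (simp add: \<epsilon>_def)
qed

text \<open>A larger control measure has a larger mesh, so fewer partitions count as fine. Two
  controls can therefore be replaced by their sum.\<close>

lemma has_BC_limit_mono:
  assumes "has_BC_limit M \<rho> \<nu> E L" and le: "\<And>I. I \<in> sets M \<Longrightarrow> \<rho> I \<le> \<rho>' I"
  shows "has_BC_limit M \<rho>' \<nu> E L"
  unfolding has_BC_limit_def
proof (intro allI impI)
  fix \<epsilon> :: real assume "0 < \<epsilon>"
  then obtain \<delta> where \<delta>: "0 < \<delta>"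
    "\<forall>D\<in>fin_partitions M E. mesh \<rho> D < \<delta> \<longrightarrow> \<bar>(\<Sum>I\<in>D. \<nu> I) - L\<bar> < \<epsilon>"
    using assms(1) unfolding has_BC_limit_def by blast
  have "mesh \<rho> D < \<delta>" if "D \<in> fin_partitions M E" "mesh \<rho>' D < \<delta>" for D
  proof -
    note d = fin_partitionsD[OF that(1)]
    have "\<rho> I < \<delta>" if "I \<in> D" for I
      using \<open>mesh \<rho>' D < \<delta>\<close> le[of I] that d(2) unfolding mesh_less_iff[OF d(1) \<delta>(1)]
      by (meson order_le_less_trans subsetD)
    then show ?thesis by (simp add: mesh_less_iff[OF d(1) \<delta>(1)])
  qed
  then show "\<exists>\<delta>>0. \<forall>D\<in>fin_partitions M E. mesh \<rho>' D < \<delta> \<longrightarrow> \<bar>(\<Sum>I\<in>D. \<nu> I) - L\<bar> < \<epsilon>"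
    using \<delta> by (intro exI[of _ \<delta>]) simp
qed

text \<open>Two admissible control measures are compared through their sum.\<close>

lemma BC_integral_eqI:
  assumes \<rho>: "\<rho> \<in> NA_plus M" "BC_integrable M \<rho> \<nu>" and E: "E \<in> sets M"
    and L: "has_BC_limit M \<rho> \<nu> E L"
  shows "BC_integral M \<nu> E = L"
proof -
  have "L' = L" if \<rho>': "\<rho>' \<in> NA_plus M" "has_BC_limit M \<rho>' \<nu> E L'" for \<rho>' L'
  proof (rule has_BC_limit_unique[OF NA_plus_add[OF \<rho>(1) \<rho>'(1)] E])
    show "has_BC_limit M (\<lambda>A. \<rho> A + \<rho>' A) \<nu> E L'"
      using \<rho>'(2) by (rule has_BC_limit_mono) (simp add: NA_plusD(4)[OF \<rho>(1)])
    show "has_BC_limit M (\<lambda>A. \<rho> A + \<rho>' A) \<nu> E L"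
      using L by (rule has_BC_limit_mono) (simp add: NA_plusD(4)[OF \<rho>'(1)])
  qed
  then have "(THE L. \<exists>\<rho>\<in>NA_plus M. BC_integrable M \<rho> \<nu> \<and> has_BC_limit M \<rho> \<nu> E L) = L"
    using \<rho> L by (intro the_equality) blast+
  then show ?thesis using E by (simp add: BC_integral_def)
qed

lemma BC_integral_limit:
  assumes \<rho>: "\<rho> \<in> NA_plus M" "BC_integrable M \<rho> \<nu>" and E: "E \<in> sets M"
  shows "has_BC_limit M \<rho> \<nu> E (BC_integral M \<nu> E)"
proof -
  obtain L where "has_BC_limit M \<rho> \<nu> E L" using \<rho>(2) E by (auto simp: BC_integrable_def)
  then show ?thesis using BC_integral_eqI[OF \<rho> E] by simp
qed

section \<open>Linearity, additivity and transport of Burkill-Cesari limits\<close>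

lemma has_BC_limit_add:
  assumes "has_BC_limit M \<rho> \<nu> E L" "has_BC_limit M \<rho> \<nu>' E L'"
  shows "has_BC_limit M \<rho> (\<lambda>A. \<nu> A + \<nu>' A) E (L + L')"
  unfolding has_BC_limit_def
proof (intro allI impI)
  fix \<epsilon> :: real assume "0 < \<epsilon>"
  then have \<epsilon>: "0 < \<epsilon> / 2" by simp
  obtain \<delta> where \<delta>: "0 < \<delta>"
    "\<forall>D\<in>fin_partitions M E. mesh \<rho> D < \<delta> \<longrightarrow> \<bar>(\<Sum>I\<in>D. \<nu> I) - L\<bar> < \<epsilon> / 2"
    using assms(1) \<epsilon> unfolding has_BC_limit_def by blast
  obtain \<delta>' where \<delta>': "0 < \<delta>'"
    "\<forall>D\<in>fin_partitions M E. mesh \<rho> D < \<delta>' \<longrightarrow> \<bar>(\<Sum>I\<in>D. \<nu>' I) - L'\<bar> < \<epsilon> / 2"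
    using assms(2) \<epsilon> unfolding has_BC_limit_def by blast
  have "\<bar>(\<Sum>I\<in>D. \<nu> I + \<nu>' I) - (L + L')\<bar> < \<epsilon>"
    if "D \<in> fin_partitions M E" "mesh \<rho> D < min \<delta> \<delta>'" for D
  proof -
    have "\<bar>(\<Sum>I\<in>D. \<nu> I) - L\<bar> < \<epsilon> / 2" "\<bar>(\<Sum>I\<in>D. \<nu>' I) - L'\<bar> < \<epsilon> / 2"
      using \<delta>(2) \<delta>'(2) that by auto
    then show ?thesis unfolding sum.distrib by linarith
  qed
  then show "\<exists>\<delta>>0. \<forall>D\<in>fin_partitions M E. mesh \<rho> D < \<delta> \<longrightarrow> \<bar>(\<Sum>I\<in>D. \<nu> I + \<nu>' I) - (L + L')\<bar> < \<epsilon>"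
    using \<delta>(1) \<delta>'(1) by (intro exI[of _ "min \<delta> \<delta>'"]) simp
qed

lemma has_BC_limit_scale:
  assumes "has_BC_limit M \<rho> \<nu> E L"
  shows "has_BC_limit M \<rho> (\<lambda>A. c * \<nu> A) E (c * L)"
  unfolding has_BC_limit_def
proof (intro allI impI)
  fix \<epsilon> :: real assume "0 < \<epsilon>"
  then have \<epsilon>: "0 < \<epsilon> / (\<bar>c\<bar> + 1)" by simp
  obtain \<delta> where \<delta>: "0 < \<delta>"
    "\<forall>D\<in>fin_partitions M E. mesh \<rho> D < \<delta> \<longrightarrow> \<bar>(\<Sum>I\<in>D. \<nu> I) - L\<bar> < \<epsilon> / (\<bar>c\<bar> + 1)"
    using assms(1) \<epsilon> unfolding has_BC_limit_def by blast
  have "\<bar>(\<Sum>I\<in>D. c * \<nu> I) - c * L\<bar> < \<epsilon>" if "D \<in> fin_partitions M E" "mesh \<rho> D < \<delta>" for D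
  proof -
    define y where "y = \<bar>(\<Sum>I\<in>D. \<nu> I) - L\<bar>"
    have "y < \<epsilon> / (\<bar>c\<bar> + 1)" using \<delta>(2) that by (simp add: y_def)
    then have "\<bar>c\<bar> * y + y < \<epsilon>" by (simp add: pos_less_divide_eq distrib_left mult.commute)
    moreover have "0 \<le> y" by (simp add: y_def)
    moreover have "\<bar>(\<Sum>I\<in>D. c * \<nu> I) - c * L\<bar> = \<bar>c\<bar> * y"
      unfolding y_def abs_mult[symmetric] by (simp add: right_diff_distrib sum_distrib_left)
    ultimately show ?thesis by linarith
  qed
  then show "\<exists>\<delta>>0. \<forall>D\<in>fin_partitions M E. mesh \<rho> D < \<delta> \<longrightarrow> \<bar>(\<Sum>I\<in>D. c * \<nu> I) - c * L\<bar> < \<epsilon>"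
    using \<delta>(1) by (intro exI[of _ \<delta>]) simp
qed

lemma has_BC_limit_NA:
  assumes "\<nu> \<in> NA M"
  shows "has_BC_limit M \<rho> \<nu> E (\<nu> E)"
  unfolding has_BC_limit_def
proof (intro allI impI exI[of _ 1] conjI ballI)
  fix \<epsilon> :: real and D assume "0 < \<epsilon>" "D \<in> fin_partitions M E"
  then show "\<bar>(\<Sum>I\<in>D. \<nu> I) - \<nu> E\<bar> < \<epsilon>"
    using NA_sum_partition[OF assms] fin_partitionsD[of D M E] by simp
qed simp

lemma has_BC_limit_lower_bound:
  assumes \<rho>: "\<rho> \<in> NA_plus M" and E: "E \<in> sets M" and L: "has_BC_limit M \<rho> \<nu> E L"
    and bound: "\<And>D. D \<in> fin_partitions M E \<Longrightarrow> a \<le> (\<Sum>I\<in>D. \<nu> I)"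
  shows "a \<le> L"
proof (rule field_le_epsilon)
  fix \<epsilon> :: real assume "0 < \<epsilon>"
  then obtain \<delta> where \<delta>: "0 < \<delta>"
    "\<forall>D\<in>fin_partitions M E. mesh \<rho> D < \<delta> \<longrightarrow> \<bar>(\<Sum>I\<in>D. \<nu> I) - L\<bar> < \<epsilon>"
    using L unfolding has_BC_limit_def by blast
  obtain D where D: "D \<in> fin_partitions M E" "mesh \<rho> D < \<delta>"
    using fine_partition_exists[OF \<rho> E \<delta>(1)] .
  then have "\<bar>(\<Sum>I\<in>D. \<nu> I) - L\<bar> < \<epsilon>" using \<delta>(2) by blast
  then show "a \<le> L + \<epsilon>" using bound[OF D(1)] by linarith
qed

lemma has_BC_limit_Union:
  assumes \<nu>0: "\<nu> {} = 0" and \<rho>: "\<rho> \<in> NA_plus M" and AB: "A \<in> sets M" "B \<in> sets M" "A \<inter> B = {}"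
    and LA: "has_BC_limit M \<rho> \<nu> A LA" and LB: "has_BC_limit M \<rho> \<nu> B LB"
    and L: "has_BC_limit M \<rho> \<nu> (A \<union> B) L"
  shows "L = LA + LB"
proof (rule ccontr)
  assume "L \<noteq> LA + LB"
  define \<epsilon> where "\<epsilon> = \<bar>L - (LA + LB)\<bar> / 3"
  have \<epsilon>: "0 < \<epsilon>" using \<open>L \<noteq> LA + LB\<close> by (simp add: \<epsilon>_def)
  obtain \<delta>A where \<delta>A: "0 < \<delta>A"
    "\<forall>D\<in>fin_partitions M A. mesh \<rho> D < \<delta>A \<longrightarrow> \<bar>(\<Sum>I\<in>D. \<nu> I) - LA\<bar> < \<epsilon>"
    using LA \<epsilon> unfolding has_BC_limit_def by blast
  obtain \<delta>B where \<delta>B: "0 < \<delta>B"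
    "\<forall>D\<in>fin_partitions M B. mesh \<rho> D < \<delta>B \<longrightarrow> \<bar>(\<Sum>I\<in>D. \<nu> I) - LB\<bar> < \<epsilon>"
    using LB \<epsilon> unfolding has_BC_limit_def by blast
  obtain \<delta> where \<delta>: "0 < \<delta>"
    "\<forall>D\<in>fin_partitions M (A \<union> B). mesh \<rho> D < \<delta> \<longrightarrow> \<bar>(\<Sum>I\<in>D. \<nu> I) - L\<bar> < \<epsilon>"
    using L \<epsilon> unfolding has_BC_limit_def by blast
  obtain D where D: "D \<in> fin_partitions M A" "mesh \<rho> D < min \<delta>A \<delta>"
    using fine_partition_exists[OF \<rho> AB(1), of "min \<delta>A \<delta>"] \<delta>A(1) \<delta>(1) by auto
  obtain D' where D': "D' \<in> fin_partitions M B" "mesh \<rho> D' < min \<delta>B \<delta>"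
    using fine_partition_exists[OF \<rho> AB(2), of "min \<delta>B \<delta>"] \<delta>B(1) \<delta>(1) by auto
  note d = fin_partitionsD[OF D(1)] and d' = fin_partitionsD[OF D'(1)]
  have cross: "I \<inter> J = {}" if "I \<in> D" "J \<in> D'" for I J using that d(4) d'(4) AB(3) by blast
  have "disjoint (D \<union> D')"
  proof (rule disjointI)
    fix X Y assume "X \<in> D \<union> D'" "Y \<in> D \<union> D'" "X \<noteq> Y"
    then consider "X \<in> D" "Y \<in> D" | "X \<in> D'" "Y \<in> D'" | "X \<in> D" "Y \<in> D'" | "Y \<in> D" "X \<in> D'"
      by blast
    then show "X \<inter> Y = {}"
    proof cases
      case 1
      then show ?thesis using disjointD[OF d(3) _ _ \<open>X \<noteq> Y\<close>] by blast
    next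
      case 2
      then show ?thesis using disjointD[OF d'(3) _ _ \<open>X \<noteq> Y\<close>] by blast
    qed (use cross in blast)+
  qed
  then have "D \<union> D' \<in> fin_partitions M (A \<union> B)"
    using d d' by (simp add: fin_partitions_def)
  moreover have "mesh \<rho> (D \<union> D') < \<delta>"
    using D(2) D'(2) d(1) d'(1) \<delta>(1) by (auto simp: mesh_less_iff)
  \<comment> \<open>Both partitions may contain the empty set, which their union counts only once;
    \<open>\<nu>0\<close> absorbs the difference.\<close>
  moreover have "(\<Sum>I\<in>D \<union> D'. \<nu> I) = (\<Sum>I\<in>D. \<nu> I) + (\<Sum>I\<in>D'. \<nu> I)"
  proof (rule sum.union_inter_neutral[OF d(1) d'(1)], intro ballI)
    fix I assume "I \<in> D \<inter> D'"
    then have "I = {}" using cross[of I I] by simp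
    then show "\<nu> I = 0" using \<nu>0 by simp
  qed
  ultimately have "\<bar>(\<Sum>I\<in>D. \<nu> I) + (\<Sum>I\<in>D'. \<nu> I) - L\<bar> < \<epsilon>" using \<delta>(2) by fastforce
  moreover have "\<bar>(\<Sum>I\<in>D. \<nu> I) - LA\<bar> < \<epsilon>" "\<bar>(\<Sum>I\<in>D'. \<nu> I) - LB\<bar> < \<epsilon>"
    using \<delta>A(2) \<delta>B(2) D D' by auto
  ultimately have "\<bar>L - (LA + LB)\<bar> < 3 * \<epsilon>" by linarith
  then show False by (simp add: \<epsilon>_def)
qed

lemma has_BC_limit_transport:
  assumes \<theta>: "\<theta> \<in> automorphisms M" and L: "has_BC_limit M \<rho> \<nu> (\<theta> ` E) L"
  shows "has_BC_limit M (transport M \<theta> \<rho>) (transport M \<theta> \<nu>) E L"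
  unfolding has_BC_limit_def
proof (intro allI impI)
  fix \<epsilon> :: real assume "0 < \<epsilon>"
  then obtain \<delta> where \<delta>: "0 < \<delta>"
    "\<forall>D\<in>fin_partitions M (\<theta> ` E). mesh \<rho> D < \<delta> \<longrightarrow> \<bar>(\<Sum>I\<in>D. \<nu> I) - L\<bar> < \<epsilon>"
    using L unfolding has_BC_limit_def by blast
  have "\<bar>(\<Sum>I\<in>D. transport M \<theta> \<nu> I) - L\<bar> < \<epsilon>"
    if D: "D \<in> fin_partitions M E" "mesh (transport M \<theta> \<rho>) D < \<delta>" for D
  proof -
    note d = fin_partitionsD[OF D(1)]
    have inj: "inj_on ((`) \<theta>) D"
    proof (rule inj_onI)
      fix I J assume "I \<in> D" "J \<in> D" "\<theta> ` I = \<theta> ` J"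
      then show "I = J"
        using inj_on_image_eq_iff[OF automorphismD(1)[OF \<theta>], of I J] d(2) sets.sets_into_space by blast
    qed
    have "disjoint ((`) \<theta> ` D)"
    proof (rule disjointI)
      fix X Y assume "X \<in> (`) \<theta> ` D" "Y \<in> (`) \<theta> ` D" "X \<noteq> Y"
      then obtain I J where IJ: "I \<in> D" "J \<in> D" "X = \<theta> ` I" "Y = \<theta> ` J" "I \<noteq> J" by auto
      then have "I \<inter> J = {}" using disjointD[OF d(3)] by blast
      then show "X \<inter> Y = {}"
        using automorphism_image_Int[OF \<theta>, of I J] IJ d(2) by auto
    qed
    moreover have "\<Union>((`) \<theta> ` D) = \<theta> ` E" using d(4) by blast
    moreover have "(`) \<theta> ` D \<subseteq> sets M" using d(2) automorphismD(3)[OF \<theta>] by blast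
    ultimately have "(`) \<theta> ` D \<in> fin_partitions M (\<theta> ` E)" using d(1) by (simp add: fin_partitions_def)
    moreover have eq: "transport M \<theta> \<kappa> I = \<kappa> (\<theta> ` I)" if "I \<in> D" for I \<kappa>
      using that d(2) by (auto simp: transport_def)
    have "mesh \<rho> ((`) \<theta> ` D) < \<delta>" using D(2) d(1) \<delta>(1) eq by (auto simp: mesh_less_iff)
    moreover have "(\<Sum>I\<in>(`) \<theta> ` D. \<nu> I) = (\<Sum>I\<in>D. transport M \<theta> \<nu> I)"
      using eq by (simp add: sum.reindex[OF inj])
    ultimately show ?thesis using \<delta>(2) by force
  qed
  then show "\<exists>\<delta>>0. \<forall>D\<in>fin_partitions M E. mesh (transport M \<theta> \<rho>) D < \<delta> \<longrightarrow>
      \<bar>(\<Sum>I\<in>D. transport M \<theta> \<nu> I) - L\<bar> < \<epsilon>"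
    using \<delta>(1) by (intro exI[of _ \<delta>]) simp
qed

section \<open>The Burkill-Cesari integral on \<open>BC\<close>\<close>

lemma BC_controlE:
  assumes "\<nu> \<in> BC M"
  obtains \<rho> where "\<rho> \<in> NA_plus M" "BC_integrable M \<rho> \<nu>"
  using assms by (auto simp: BC_def)

lemma BC_integralI:
  assumes "\<rho> \<in> NA_plus M" "\<nu> \<in> games M" "\<And>E. E \<in> sets M \<Longrightarrow> has_BC_limit M \<rho> \<nu> E (f E)"
    "\<And>E. E \<notin> sets M \<Longrightarrow> f E = 0"
  shows "\<nu> \<in> BC M" "BC_integral M \<nu> = f"
proof -
  have int: "BC_integrable M \<rho> \<nu>" using assms(3) by (auto simp: BC_integrable_def)
  then show "\<nu> \<in> BC M" using assms(1,2) by (auto simp: BC_def)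
  show "BC_integral M \<nu> = f"
  proof
    fix E show "BC_integral M \<nu> E = f E"
      using BC_integral_eqI[OF assms(1) int] assms(3,4) by (cases "E \<in> sets M") (auto simp: BC_integral_def)
  qed
qed

lemma BC_integral_outside: "E \<notin> sets M \<Longrightarrow> BC_integral M \<nu> E = 0"
  by (simp add: BC_integral_def)

lemma BC_add:
  assumes "\<nu> \<in> BC M" "\<nu>' \<in> BC M"
  shows "(\<lambda>E. \<nu> E + \<nu>' E) \<in> BC M"
    "BC_integral M (\<lambda>E. \<nu> E + \<nu>' E) = (\<lambda>E. BC_integral M \<nu> E + BC_integral M \<nu>' E)"
proof -
  obtain \<rho> where \<rho>: "\<rho> \<in> NA_plus M" "BC_integrable M \<rho> \<nu>" using assms(1) by (rule BC_controlE)
  obtain \<rho>' where \<rho>': "\<rho>' \<in> NA_plus M" "BC_integrable M \<rho>' \<nu>'" using assms(2) by (rule BC_controlE)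
  let ?\<rho> = "\<lambda>A. \<rho> A + \<rho>' A"
  have lim: "has_BC_limit M ?\<rho> (\<lambda>E. \<nu> E + \<nu>' E) E (BC_integral M \<nu> E + BC_integral M \<nu>' E)"
    if E: "E \<in> sets M" for E
  proof (rule has_BC_limit_add)
    show "has_BC_limit M ?\<rho> \<nu> E (BC_integral M \<nu> E)"
      using BC_integral_limit[OF \<rho> E] by (rule has_BC_limit_mono) (simp add: NA_plusD(4)[OF \<rho>'(1)])
    show "has_BC_limit M ?\<rho> \<nu>' E (BC_integral M \<nu>' E)"
      using BC_integral_limit[OF \<rho>' E] by (rule has_BC_limit_mono) (simp add: NA_plusD(4)[OF \<rho>(1)])
  qed
  have g: "(\<lambda>E. \<nu> E + \<nu>' E) \<in> games M" using assms by (auto simp: BC_def games_def)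
  show "(\<lambda>E. \<nu> E + \<nu>' E) \<in> BC M"
    "BC_integral M (\<lambda>E. \<nu> E + \<nu>' E) = (\<lambda>E. BC_integral M \<nu> E + BC_integral M \<nu>' E)"
    using BC_integralI[OF NA_plus_add[OF \<rho>(1) \<rho>'(1)] g lim] by (simp_all add: BC_integral_outside)
qed

lemma BC_scale:
  assumes "\<nu> \<in> BC M"
  shows "(\<lambda>E. c * \<nu> E) \<in> BC M"
    "BC_integral M (\<lambda>E. c * \<nu> E) = (\<lambda>E. c * BC_integral M \<nu> E)"
proof -
  obtain \<rho> where \<rho>: "\<rho> \<in> NA_plus M" "BC_integrable M \<rho> \<nu>" using assms(1) by (rule BC_controlE)
  have lim: "has_BC_limit M \<rho> (\<lambda>E. c * \<nu> E) E (c * BC_integral M \<nu> E)" if E: "E \<in> sets M" for E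
    by (rule has_BC_limit_scale[OF BC_integral_limit[OF \<rho> E]])
  have g: "(\<lambda>E. c * \<nu> E) \<in> games M" using assms by (auto simp: BC_def games_def)
  show "(\<lambda>E. c * \<nu> E) \<in> BC M"
    "BC_integral M (\<lambda>E. c * \<nu> E) = (\<lambda>E. c * BC_integral M \<nu> E)"
    using BC_integralI[OF \<rho>(1) g lim] by (simp_all add: BC_integral_outside)
qed

lemma BC_transport:
  assumes \<theta>: "\<theta> \<in> automorphisms M" and "\<nu> \<in> BC M"
  shows "transport M \<theta> \<nu> \<in> BC M"
    "BC_integral M (transport M \<theta> \<nu>) = transport M \<theta> (BC_integral M \<nu>)"
proof -
  obtain \<rho> where \<rho>: "\<rho> \<in> NA_plus M" "BC_integrable M \<rho> \<nu>" using assms(2) by (rule BC_controlE)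
  have lim: "has_BC_limit M (transport M \<theta> \<rho>) (transport M \<theta> \<nu>) E (transport M \<theta> (BC_integral M \<nu>) E)"
    if E: "E \<in> sets M" for E
    using has_BC_limit_transport[OF \<theta> BC_integral_limit[OF \<rho> automorphismD(3)[OF \<theta> E]]] E
    by (simp add: transport_def)
  have g: "transport M \<theta> \<nu> \<in> games M" using assms by (intro transport_games) (simp add: BC_def)
  show "transport M \<theta> \<nu> \<in> BC M"
    "BC_integral M (transport M \<theta> \<nu>) = transport M \<theta> (BC_integral M \<nu>)"
    using BC_integralI[OF transport_NA_plus[OF \<theta> \<rho>(1)] g lim] by (simp_all add: transport_def fun_eq_iff)
qed

lemma BC_integral_NA:
  assumes "\<nu> \<in> NA M"
  shows "\<nu> \<in> BC M" "BC_integral M \<nu> = \<nu>"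
proof -
  have "\<nu> \<in> games M" using assms by (simp add: NA_def)
  \<comment> \<open>Partition sums of a measure are exact, so even the zero measure serves as
    control, for which every partition has mesh 0.\<close>
  then show "\<nu> \<in> BC M" "BC_integral M \<nu> = \<nu>"
    using BC_integralI[OF NA_plus_zero _ has_BC_limit_NA[OF assms]] by (simp_all add: games_def)
qed

text \<open>A Lipschitz bound dominates every partition sum, hence also the integral. Finite
  additivity of the limit is then enough, by \<open>dominated_additive_in_NA\<close>.\<close>

lemma BC_integral_in_NA:
  assumes \<nu>: "\<nu> \<in> BC M" and \<mu>: "\<mu> \<in> lipschitz_bounds M \<nu>"
  shows "BC_integral M \<nu> \<in> NA M"
proof -
  obtain \<rho> where \<rho>: "\<rho> \<in> NA_plus M" "BC_integrable M \<rho> \<nu>" using \<nu> by (rule BC_controlE)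
  have g: "\<nu> \<in> games M" using \<nu> by (simp add: BC_def)
  note p = lipschitz_boundsD(1)[OF \<mu>]
  have dom: "\<bar>BC_integral M \<nu> E\<bar> \<le> \<mu> E" if E: "E \<in> sets M" for E
  proof -
    have bound: "\<bar>\<Sum>I\<in>D. \<nu> I\<bar> \<le> \<mu> E" if "D \<in> fin_partitions M E" for D
    proof -
      note d = fin_partitionsD[OF that]
      have "\<bar>\<Sum>I\<in>D. \<nu> I\<bar> \<le> (\<Sum>I\<in>D. \<mu> I)"
        using d(2) by (intro order_trans[OF sum_abs] sum_mono lipschitz_bound_abs_le[OF \<mu> g]) auto
      also have "\<dots> = \<mu> E" using NA_sum_partition[OF NA_plusD(1)[OF p] d(1-3)] d(4) by simp
      finally show ?thesis .
    qed
    have lim: "has_BC_limit M \<rho> \<nu> E (BC_integral M \<nu> E)" by (rule BC_integral_limit[OF \<rho> E])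
    have "- \<mu> E \<le> BC_integral M \<nu> E"
      by (rule has_BC_limit_lower_bound[OF \<rho>(1) E lim]) (use bound in \<open>simp add: abs_le_iff minus_le_iff\<close>)
    \<comment> \<open>The upper bound is the lower bound for the game multiplied by
      \<open>- 1\<close>.\<close>
    moreover have "- \<mu> E \<le> - 1 * BC_integral M \<nu> E"
      by (rule has_BC_limit_lower_bound[OF \<rho>(1) E has_BC_limit_scale[OF lim]])
        (use bound in \<open>simp add: abs_le_iff sum_negf\<close>)
    ultimately show ?thesis by (simp add: abs_le_iff minus_le_iff)
  qed
  have "BC_integral M \<nu> (A \<union> B) = BC_integral M \<nu> A + BC_integral M \<nu> B"
    if "A \<in> sets M" "B \<in> sets M" "A \<inter> B = {}" for A B
  proof (rule has_BC_limit_Union[OF _ \<rho>(1) that])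
    show "\<nu> {} = 0" using g by (simp add: games_def)
  qed (intro BC_integral_limit[OF \<rho>] sets.Un that)+
  moreover have "BC_integral M \<nu> \<in> games M"
    using dom[of "{}"] NA_plusD(2)[OF p] by (simp add: games_def BC_integral_outside)
  ultimately show ?thesis using dominated_additive_in_NA[OF _ p dom] by blast
qed

lemma symmetric_subspace_FEAS: "symmetric_subspace M (FEAS M)"
proof -
  have "(\<lambda>E. 0) \<in> NA M" using NA_plusD(1)[OF NA_plus_zero] .
  then have "(\<lambda>E. 0) \<in> FEAS M"
    using symmetric_subspace_pNA_inf[of M] by (simp add: FEAS_def BC_integral_NA symmetric_subspace_def)
  moreover have "FEAS M \<subseteq> BV M" by (auto simp: FEAS_def pNA_inf_def AC_inf_def)
  ultimately show ?thesis
    by (simp add: symmetric_subspace_def FEAS_def BC_add BC_scale BC_transport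
      pNA_inf_add pNA_inf_scale transport_pNA_inf transport_space)
qed

theorem is_value_BC_integral: "is_value M (FEAS M) (BC_integral M)"
  unfolding is_value_def
proof (intro conjI ballI allI impI)
  show "symmetric_subspace M (FEAS M)" by (rule symmetric_subspace_FEAS)
  fix \<nu> assume "\<nu> \<in> FEAS M"
  then have \<nu>: "\<nu> \<in> BC M" "\<nu> \<in> pNA_inf M" "BC_integral M \<nu> (space M) = \<nu> (space M)"
    by (auto simp: FEAS_def)
  show "BC_integral M \<nu> \<in> NA M"
    using \<nu> BC_integral_in_NA[OF \<nu>(1)] by (auto simp: pNA_inf_iff)
  show "BC_integral M (\<lambda>E. \<nu> E + \<eta> E) = (\<lambda>E. BC_integral M \<nu> E + BC_integral M \<eta> E)" if "\<eta> \<in> FEAS M" for \<eta>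
    using that by (intro BC_add \<nu>) (simp add: FEAS_def)
  show "BC_integral M (\<lambda>E. c * \<nu> E) = (\<lambda>E. c * BC_integral M \<nu> E)" for c by (rule BC_scale(2)[OF \<nu>(1)])
  show "transport M \<theta> (BC_integral M \<nu>) = BC_integral M (transport M \<theta> \<nu>)"
    if "\<theta> \<in> automorphisms M" for \<theta> using BC_transport(2)[OF that \<nu>(1)] by simp
  show "BC_integral M \<nu> (space M) = \<nu> (space M)" by (rule \<nu>(3))
  show "0 \<le> BC_integral M \<nu> E" if mono: "monotone_game M \<nu>" and E: "E \<in> sets M" for E
  proof -
    obtain \<rho> where \<rho>: "\<rho> \<in> NA_plus M" "BC_integrable M \<rho> \<nu>" using \<nu>(1) by (rule BC_controlE)
    have nonneg: "0 \<le> \<nu> I" if "I \<in> sets M" for I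
    proof -
      have "\<nu> {} \<le> \<nu> I" using mono that unfolding monotone_game_def by blast
      then show ?thesis using \<nu>(1) by (simp add: BC_def games_def)
    qed
    show ?thesis
    proof (rule has_BC_limit_lower_bound[OF \<rho>(1) E BC_integral_limit[OF \<rho> E]])
      show "0 \<le> (\<Sum>I\<in>D. \<nu> I)" if "D \<in> fin_partitions M E" for D
        using nonneg fin_partitionsD(2)[OF that] by (intro sum_nonneg) blast
    qed
  qed
next
  fix \<nu> assume "\<nu> \<in> FEAS M \<inter> NA M"
  then show "BC_integral M \<nu> = \<nu>" by (simp add: BC_integral_NA)
qed

section \<open>Comparison of the two values\<close>

lemma is_value_subspace:
  assumes "is_value M W \<phi>" "W' \<subseteq> W" "symmetric_subspace M W'"
  shows "is_value M W' \<phi>"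
  using assms unfolding is_value_def by blast

lemma is_valueD:
  assumes "is_value M W \<phi>"
  shows "\<nu> \<in> W \<Longrightarrow> \<phi> \<nu> \<in> NA M"
    "\<nu> \<in> W \<Longrightarrow> \<eta> \<in> W \<Longrightarrow> \<phi> (\<lambda>E. \<nu> E + \<eta> E) = (\<lambda>E. \<phi> \<nu> E + \<phi> \<eta> E)"
    "\<nu> \<in> W \<Longrightarrow> \<phi> (\<lambda>E. c * \<nu> E) = (\<lambda>E. c * \<phi> \<nu> E)"
    "\<nu> \<in> W \<Longrightarrow> monotone_game M \<nu> \<Longrightarrow> E \<in> sets M \<Longrightarrow> 0 \<le> \<phi> \<nu> E"
    "\<nu> \<in> W \<Longrightarrow> \<nu> \<in> NA M \<Longrightarrow> \<phi> \<nu> = \<nu>"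
    "\<nu> \<in> W \<Longrightarrow> \<phi> \<nu> (space M) = \<nu> (space M)"
  using assms by (simp_all add: is_value_def)

lemma is_value_square_bounds:
  assumes val: "is_value M W \<Phi>" and W: "power_span M \<subseteq> W" and \<mu>: "\<mu> \<in> NA_prob M" and E: "E \<in> sets M"
  shows "0 \<le> \<Phi> (\<lambda>E. \<mu> E ^ 2) E" "\<Phi> (\<lambda>E. \<mu> E ^ 2) E \<le> 2 * \<mu> E"
proof -
  note p = NA_probD(1)[OF \<mu>]
  have mono: "0 \<le> \<mu> A" "\<mu> A \<le> \<mu> B" "\<mu> B \<le> 1" if "A \<in> sets M" "B \<in> sets M" "A \<subseteq> B" for A B
    using NA_plusD(4)[OF p] NA_plus_mono[OF p that(3,2)] NA_probD(3)[OF \<mu> that(2)] by auto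
  have sq: "(\<lambda>E. \<mu> E ^ 2) \<in> power_span M" by (rule power_span_power[OF \<mu>]) simp
  have lin: "\<mu> \<in> power_span M" using power_span_power[OF \<mu>, of 1] by simp
  have lin2: "(\<lambda>E. 2 * \<mu> E) \<in> power_span M" by (rule power_span_scale[OF lin])
  have neg: "(\<lambda>E. - 1 * \<mu> E ^ 2) \<in> power_span M" by (rule power_span_scale[OF sq])
  \<comment> \<open>The difference is written as a sum with a multiple by \<open>- 1\<close>, so
    that additivity and homogeneity of a value apply literally.\<close>
  have diff: "(\<lambda>E. 2 * \<mu> E + - 1 * \<mu> E ^ 2) \<in> power_span M" by (rule power_span_add[OF lin2 neg])
  have positive: "0 \<le> \<Phi> \<nu> E" if "\<nu> \<in> power_span M" "monotone_game M \<nu>" for \<nu>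
    using is_valueD(4)[OF val subsetD[OF W that(1)] that(2) E] .
  have "monotone_game M (\<lambda>E. \<mu> E ^ 2)"
    unfolding monotone_game_def using mono by (auto intro!: power_mono)
  then show "0 \<le> \<Phi> (\<lambda>E. \<mu> E ^ 2) E" by (rule positive[OF sq])
  have "monotone_game M (\<lambda>E. 2 * \<mu> E + - 1 * \<mu> E ^ 2)"
    unfolding monotone_game_def
  proof (intro ballI impI)
    fix A B assume AB: "A \<in> sets M" "B \<in> sets M" "A \<subseteq> B"
    \<comment> \<open>This product is the increment of \<open>2 * \<mu> E - \<mu> E ^ 2\<close>; the
      second factor is nonnegative because \<open>\<mu>\<close> is at most 1.\<close>
    have "0 \<le> (\<mu> B - \<mu> A) * (2 - (\<mu> A + \<mu> B))" using mono[OF AB] by (intro mult_nonneg_nonneg) auto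
    then show "2 * \<mu> A + - 1 * \<mu> A ^ 2 \<le> 2 * \<mu> B + - 1 * \<mu> B ^ 2"
      by (simp add: algebra_simps power2_eq_square)
  qed
  then have "0 \<le> \<Phi> (\<lambda>E. 2 * \<mu> E + - 1 * \<mu> E ^ 2) E" by (rule positive[OF diff])
  also have "\<Phi> (\<lambda>E. 2 * \<mu> E + - 1 * \<mu> E ^ 2) = (\<lambda>E. \<Phi> (\<lambda>E. 2 * \<mu> E) E + \<Phi> (\<lambda>E. - 1 * \<mu> E ^ 2) E)"
    by (rule is_valueD(2)[OF val subsetD[OF W lin2] subsetD[OF W neg]])
  also have "\<Phi> (\<lambda>E. 2 * \<mu> E) = (\<lambda>E. 2 * \<Phi> \<mu> E)"
    by (rule is_valueD(3)[OF val subsetD[OF W lin]])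
  also have "\<Phi> \<mu> = \<mu>"
    by (rule is_valueD(5)[OF val subsetD[OF W lin] NA_plusD(1)[OF p]])
  also have "\<Phi> (\<lambda>E. - 1 * \<mu> E ^ 2) = (\<lambda>E. - 1 * \<Phi> (\<lambda>E. \<mu> E ^ 2) E)"
    by (rule is_valueD(3)[OF val subsetD[OF W sq]])
  finally show "\<Phi> (\<lambda>E. \<mu> E ^ 2) E \<le> 2 * \<mu> E" by simp
qed

lemma is_value_square_difference:
  assumes val: "is_value M W \<Phi>" and W: "power_span M \<subseteq> W"
    and \<mu>: "\<mu> \<in> NA_prob M" "\<mu>' \<in> NA_prob M" and A: "A \<in> sets M" "\<mu> A = 1" "\<mu>' A = 0"
  shows "\<Phi> (\<lambda>E. \<mu> E ^ 2 + - 1 * \<mu>' E ^ 2) A = 1"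
proof -
  have sq: "(\<lambda>E. \<mu> E ^ 2) \<in> power_span M" "(\<lambda>E. \<mu>' E ^ 2) \<in> power_span M"
    using \<mu> by (simp_all add: power_span_power)
  have neg: "(\<lambda>E. - 1 * \<mu>' E ^ 2) \<in> power_span M" by (rule power_span_scale[OF sq(2)])
  have co: "space M - A \<in> sets M" using A(1) by auto
  have "\<mu> (space M - A) = \<mu> (space M) - \<mu> A"
    using A sets.sets_into_space by (intro NA_plus_Diff[OF NA_probD(1)[OF \<mu>(1)]]) auto
  then have "\<mu> (space M - A) = 0" using NA_probD(2)[OF \<mu>(1)] A by simp
  then have zero: "\<Phi> (\<lambda>E. \<mu> E ^ 2) (space M - A) = 0"
    using is_value_square_bounds[OF val W \<mu>(1) co] by simp
  have "\<Phi> (\<lambda>E. \<mu> E ^ 2) \<in> NA M" "\<Phi> (\<lambda>E. \<mu> E ^ 2) (space M) = \<mu> (space M) ^ 2"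
    by (rule is_valueD(1,6)[OF val subsetD[OF W sq(1)]])+
  moreover have "A \<union> (space M - A) = space M" using sets.sets_into_space[OF A(1)] by blast
  ultimately have "\<Phi> (\<lambda>E. \<mu> E ^ 2) A = 1"
    using NA_Union[OF _ A(1) co, of "\<Phi> (\<lambda>E. \<mu> E ^ 2)"] zero NA_probD(2)[OF \<mu>(1)] by simp
  moreover have "\<Phi> (\<lambda>E. \<mu>' E ^ 2) A = 0"
    using is_value_square_bounds[OF val W \<mu>(2) A(1)] A(3) by simp
  moreover have "\<Phi> (\<lambda>E. \<mu> E ^ 2 + - 1 * \<mu>' E ^ 2) =
      (\<lambda>E. \<Phi> (\<lambda>E. \<mu> E ^ 2) E + \<Phi> (\<lambda>E. - 1 * \<mu>' E ^ 2) E)"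
    by (rule is_valueD(2)[OF val subsetD[OF W sq(1)] subsetD[OF W neg]])
  moreover have "\<Phi> (\<lambda>E. - 1 * \<mu>' E ^ 2) = (\<lambda>E. - 1 * \<Phi> (\<lambda>E. \<mu>' E ^ 2) E)"
    by (rule is_valueD(3)[OF val subsetD[OF W sq(2)]])
  ultimately show ?thesis by simp
qed

text \<open>With \<open>\<mu>\<close> as its own control, the sum of squares over a partition of
  \<open>E\<close> is at most the mesh times \<open>\<mu> E\<close>, so it tends to 0.\<close>

lemma BC_integral_square:
  assumes \<mu>: "\<mu> \<in> NA_prob M"
  shows "(\<lambda>E. \<mu> E ^ 2) \<in> BC M" "BC_integral M (\<lambda>E. \<mu> E ^ 2) = (\<lambda>E. 0)"
proof -
  note p = NA_probD(1)[OF \<mu>]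
  have lim: "has_BC_limit M \<mu> (\<lambda>E. \<mu> E ^ 2) E 0" if E: "E \<in> sets M" for E
    unfolding has_BC_limit_def
  proof (intro allI impI)
    fix \<epsilon> :: real assume "0 < \<epsilon>"
    have "\<bar>(\<Sum>I\<in>D. \<mu> I ^ 2) - 0\<bar> < \<epsilon>" if D: "D \<in> fin_partitions M E" "mesh \<mu> D < \<epsilon> / 2" for D
    proof -
      note d = fin_partitionsD[OF D(1)]
      have small: "\<mu> I < \<epsilon> / 2" if "I \<in> D" for I
        using D(2) that mesh_less_iff[OF d(1), of "\<epsilon> / 2" \<mu>] \<open>0 < \<epsilon>\<close> by simp
      have "(\<Sum>I\<in>D. \<mu> I ^ 2) \<le> (\<Sum>I\<in>D. \<epsilon> / 2 * \<mu> I)"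
        unfolding power2_eq_square using small NA_plusD(4)[OF p]
        by (intro sum_mono mult_right_mono) (auto intro: less_imp_le)
      also have "\<dots> = \<epsilon> / 2 * \<mu> E"
        unfolding sum_distrib_left[symmetric] using NA_sum_partition[OF NA_plusD(1)[OF p] d(1-3)] d(4) by simp
      also have "\<dots> \<le> \<epsilon> / 2 * 1" using NA_probD(3)[OF \<mu> E] \<open>0 < \<epsilon>\<close> by (intro mult_left_mono) auto
      finally show ?thesis using \<open>0 < \<epsilon>\<close> by (simp add: sum_nonneg)
    qed
    then show "\<exists>\<delta>>0. \<forall>D\<in>fin_partitions M E. mesh \<mu> D < \<delta> \<longrightarrow> \<bar>(\<Sum>I\<in>D. \<mu> I ^ 2) - 0\<bar> < \<epsilon>"
      using \<open>0 < \<epsilon>\<close> by (intro exI[of _ "\<epsilon> / 2"]) simp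
  qed
  have "(\<lambda>E. \<mu> E ^ 2) \<in> games M" by (intro power_span_games power_span_power \<mu>) simp
  then show "(\<lambda>E. \<mu> E ^ 2) \<in> BC M" "BC_integral M (\<lambda>E. \<mu> E ^ 2) = (\<lambda>E. 0)"
    using BC_integralI[OF p _ lim] by simp_all
qed

text \<open>A single square misses \<open>FEAS\<close>: its integral is 0 but its value at the space
  is 1. In the difference these defects cancel.\<close>

lemma square_difference_in_FEAS:
  assumes \<mu>: "\<mu> \<in> NA_prob M" "\<mu>' \<in> NA_prob M"
  shows "(\<lambda>E. \<mu> E ^ 2 + - 1 * \<mu>' E ^ 2) \<in> FEAS M"
    "BC_integral M (\<lambda>E. \<mu> E ^ 2 + - 1 * \<mu>' E ^ 2) = (\<lambda>E. 0)"
proof -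
  note b = BC_integral_square[OF \<mu>(1)] and b' = BC_integral_square[OF \<mu>(2)]
  note s' = BC_scale[OF b'(1), of "- 1"]
  show int: "BC_integral M (\<lambda>E. \<mu> E ^ 2 + - 1 * \<mu>' E ^ 2) = (\<lambda>E. 0)"
    using BC_add(2)[OF b(1) s'(1)] b(2) b'(2) s'(2) by simp
  have "(\<lambda>E. \<mu> E ^ 2 + - 1 * \<mu>' E ^ 2) \<in> power_span M"
    using \<mu> by (intro power_span_add power_span_scale power_span_power) auto
  then show "(\<lambda>E. \<mu> E ^ 2 + - 1 * \<mu>' E ^ 2) \<in> FEAS M"
    using BC_add(1)[OF b(1) s'(1)] power_span_subset_pNA_inf int NA_probD(2)[OF \<mu>(1)] NA_probD(2)[OF \<mu>(2)]
    unfolding FEAS_def by auto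
qed

lemma NA_prob_conditional:
  assumes \<mu>: "\<mu> \<in> NA_plus M" and B: "B \<in> sets M" "\<mu> B \<noteq> 0"
  shows "(\<lambda>E. 1 / \<mu> B * (if E \<in> sets M then \<mu> (E \<inter> B) else 0)) \<in> NA_prob M"
proof -
  have "(\<lambda>E. 1 / \<mu> B * (if E \<in> sets M then \<mu> (E \<inter> B) else 0)) \<in> NA_plus M"
    using NA_plusD(4)[OF \<mu>, of B] by (intro NA_plus_scale NA_plus_restrict[OF \<mu> B(1)]) simp
  moreover have "space M \<inter> B = B" using sets.sets_into_space[OF B(1)] by blast
  ultimately show ?thesis using B by (simp add: NA_prob_def)
qed

text \<open>One nonatomic probability measure suffices: the space splits into two sets of nonzero
  measure, and conditioning on each of them gives the pair.\<close>

lemma disjointly_supported_NA_prob: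
  assumes "standard_borel M" "uncountable (space M)"
  obtains \<mu> \<mu>' A where "\<mu> \<in> NA_prob M" "\<mu>' \<in> NA_prob M" "A \<in> sets M" "\<mu> A = 1" "\<mu>' A = 0"
proof -
  obtain \<kappa> where \<kappa>: "\<kappa> \<in> NA_prob M" using NA_prob_nonempty[OF assms] .
  note p = NA_probD(1)[OF \<kappa>]
  have "\<kappa> (space M) \<noteq> 0" using NA_probD(2)[OF \<kappa>] by simp
  then obtain A where A: "A \<in> sets M" "\<kappa> A \<noteq> 0" "\<kappa> (space M - A) \<noteq> 0"
    using NA_plusD(1)[OF p] unfolding NA_def by blast
  have co: "space M - A \<in> sets M" using A by auto
  show ?thesis
  proof (rule that[OF NA_prob_conditional[OF p A(1,2)] NA_prob_conditional[OF p co A(3)] A(1)])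
    have "A \<inter> (space M - A) = {}" by blast
    then show "1 / \<kappa> (space M - A) * (if A \<in> sets M then \<kappa> (A \<inter> (space M - A)) else 0) = 0"
      using NA_plusD(2)[OF p] by simp
  qed (use A in simp)
qed

theorem mainTheorem7:
  fixes M :: "'a measure"
  assumes "standard_borel M" and "uncountable (space M)"
  shows "is_value M (FEAS M) (BC_integral M) \<and>
         (\<forall>\<Phi>. is_aumann_shapley_value M \<Phi> \<longrightarrow> (\<exists>\<nu>\<in>FEAS M. BC_integral M \<nu> \<noteq> \<Phi> \<nu>)) \<and>
         (\<exists>\<phi> \<psi>. is_value M (FEAS M) \<phi> \<and> is_value M (FEAS M) \<psi> \<and> (\<exists>\<nu>\<in>FEAS M. \<phi> \<nu> \<noteq> \<psi> \<nu>))"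
proof -
  obtain \<mu> \<mu>' A where \<mu>: "\<mu> \<in> NA_prob M" "\<mu>' \<in> NA_prob M" "A \<in> sets M" "\<mu> A = 1" "\<mu>' A = 0"
    using disjointly_supported_NA_prob[OF assms] .
  define \<nu> where "\<nu> = (\<lambda>E. \<mu> E ^ 2 + - 1 * \<mu>' E ^ 2)"
  have \<nu>: "\<nu> \<in> FEAS M" "BC_integral M \<nu> = (\<lambda>E. 0)"
    using square_difference_in_FEAS[OF \<mu>(1,2)] by (simp_all add: \<nu>_def)
  \<comment> \<open>The space \<open>W\<close> is left open because the argument is applied both to
    \<open>pNA\<close> and to \<open>pNA_inf\<close>.\<close>
  have differs: "BC_integral M \<nu> \<noteq> \<Phi> \<nu>" if "is_value M W \<Phi>" "power_span M \<subseteq> W" for W \<Phi>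
  proof
    assume "BC_integral M \<nu> = \<Phi> \<nu>"
    then have "\<Phi> \<nu> A = 0" using \<nu>(2) by (metis (full_types))
    then show False using is_value_square_difference[OF that \<mu>] by (simp add: \<nu>_def)
  qed
  have "is_value M (FEAS M) (diagonal_value M)"
    by (rule is_value_subspace[OF is_value_diagonal_value _ symmetric_subspace_FEAS]) (auto simp: FEAS_def)
  \<comment> \<open>The comparison takes place on \<open>pNA_inf M\<close>, since the argument
    evaluates the value at single squares, which lie outside \<open>FEAS M\<close>.\<close>
  moreover have "BC_integral M \<nu> \<noteq> diagonal_value M \<nu>"
    by (rule differs[OF is_value_diagonal_value power_span_subset_pNA_inf])
  moreover have "BC_integral M \<nu> \<noteq> \<Phi> \<nu>" if "is_aumann_shapley_value M \<Phi>" for \<Phi>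
    using that differs[OF _ power_span_subset_pNA] by (simp add: is_aumann_shapley_value_def)
  ultimately show ?thesis using is_value_BC_integral \<nu>(1) by blast
qed

end
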